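(* The noncommutative plethystic bialgebra with noncommuting variables $\mathcal P^{\diamondsuit,\mathrm{nc}}$ is isomorphic to the homotopy cardinality of the incidence bialgebra of the simplicial groupoid $\mathcal B\,\mathcal T_{\mathsf M^{\mathrm r}}(\mathsf{Sym})$ (bar construction relative to $\mathsf M^{\mathrm r}$).
   Context: Monads and operads. $\mathbf{Grpd}$ is the category of groupoids. $\mathsf{M}^{\mathrm r}$ is the monad on $\mathbf{Grpd}$ sending $A$ to $\bigsqcup_{n\ge 1}A^n$ (nonempty tuples, morphisms componentwise), unit $a\mapsto (a)$, multiplication $\mu$ concatenation. $\mathsf{S}^{\mathrm r}$ sends $A$ to $\bigsqcup_{n\ge1}A^n/\!/\mathfrak S_n$: same objects, with additional isomorphisms $(a_1,\dots,a_n)\to(a_{\sigma(1)},\dots,a_{\sigma(n)})$ for $\sigma\in\mathfrak S_n$; same unit and multiplication. For $\mathsf P\in\{\mathsf M^{\mathrm r},\mathsf S^{\mathrm r}\}$, a $\mathsf P$-operad $Q$ consists of groupoids $Q_0$ (colours), $Q_1$ (operations), functors $s\colon Q_1\to \mathsf PQ_0$ (inputs), $t\colon Q_1\to Q_0$ (output), composition $m\colon \mathsf PQ_1\times_{\mathsf PQ_0}Q_1\to Q_1$ (the $Q_1$ factor being the root) and units $e\colon Q_0\to Q_1$ satisfying the usual compatibility, associativity and unit laws. $\mathsf{Sym}$ is the terminal $\mathsf S^{\mathrm r}$-operad on one colour: $Q_0=1$, $Q_1=\mathsf S^{\mathrm r}1$ (one $n$-ary operation for each $n\ge1$ with automorphism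 group $\mathfrak S_n$), composition given by $\mu$. $\mathcal T$-construction. (i) For $\mathsf P\in\{\mathsf M^{\mathrm r},\mathsf S^{\mathrm r}\}$ and a category $C$ internal to $\mathbf{Grpd}$ with discrete $C_0$, $\mathcal T_{\mathsf P}(C)$ is the $\mathsf P$-operad with colours $C_0$ whose operations are the pullback of $\mathsf P(\text{target})\colon \mathsf PC_1\to\mathsf PC_0$ along $C_0\times\mathsf P1\to\mathsf PC_0$, $(c,(\ast,\dots,\ast))\mapsto(c,\dots,c)$: nonempty tuples $(f_1,\dots,f_n)$ of arrows with common target $c$ (inputs the sources, output $c$), with the morphisms of $\mathsf PC_1$ between them; composition $(f_1,\dots,f_k)\circ((g^1_j)_j,\dots,(g^k_j)_j)=(f_1g^1_1,\dots,f_kg^k_{n_k})$; units identities. (ii) For a $\mathsf P'$-operad $Q$ with discrete $Q_0$, $\mathcal T^{\mathsf P'}(Q)$ is the category internal to $\mathbf{Grpd}$ with objects $Q_0$, arrows $c\to d$ the operations with all inputs $c$ and output $d$, composition $y\circ x=m((x,\dots,x);y)$, identities $e$. (iii) $\mathcal T_{\mathsf P}(Q):=\mathcal T_{\mathsf P}(\mathcal T^{\mathsf P'}(Q))$. Bar construction. For a $\mathsf P$-operad $Q$, $Q_n:=\mathsf PQ_{n-1}\times_{\mathsf PQ_0}Q_1$ ($n\ge 2$; $n$-level trees). $\mathcal BQ$ is the simplicial groupoid with $\mathcal B_nQ=\mathsf PQ_n$; $d_0$ discards the top (leafward) level keeping outputs ($\mathsf Pt$ for $n=1$), $d_n$ discards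 the root level and flattens via $\mu$, inner faces compose adjacent levels via $m$, degeneracies insert units. Incidence bialgebra. For a groupoid $G$, $|G|=\sum_{[x]}1/|\mathrm{Aut}(x)|$. For $X=\mathcal BQ$, $\mathbb Q_{\pi_0X_1}$ has basis $\delta_a$; $\Delta(\delta_f)=\sum_{a,b}\frac{|\Phi_{f;a,b}|}{|\mathrm{Aut}(a)||\mathrm{Aut}(b)|}\delta_a\otimes\delta_b$ with $\Phi_{f;a,b}$ the homotopy fibre over $(a,b)$ of $(d_2,d_0)$ restricted to the homotopy fibre of $d_1\colon X_2\to X_1$ over $f$; $\epsilon(\delta_f)=$ cardinality of the homotopy fibre of $s_0$ over $f$; product $\delta_a\delta_b=\delta_{a+b}$, $+$ being juxtaposition (concatenation) of configurations (unit adjoined). The bialgebra. $W$ is the set of nonempty finite words $\omega=\omega_1\cdots\omega_n$ in positive integers, $\mathbf x_\omega=x_{\omega_1}\cdots x_{\omega_n}$, $\omega!=\omega_1!\cdots\omega_n!$. Let $R$ be a noncommutative unital ring and consider power series in noncommuting variables $x_1,x_2,\dots$ without constant term and coefficients in $R$, written $F=\sum_{\omega\in W}F_\omega\mathbf x_\omega/\omega!$, with plethystic substitution $(G\circledast F)(x_1,x_2,\dots)=G(F_1,F_2,\dots)$, $F_k(x_1,x_2,\dots)=F(x_k,x_{2k},\dots)$. $\mathcal P^{\diamondsuit,\mathrm{nc}}$ is the free associative unital algebra $\mathbb Q\langle A_\omega:\omega\in W\rangle$ on the maps $A_\omega(F)=F_\omega$, with comultiplication induced by plethystic substitution ($\Delta(A_\omega)(F,G)=A_\omega(G\circledast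 F)$) and counit $\epsilon(A_\omega)=A_\omega(x_1)$. *)

theory Defs
  imports
    "HOL.Rat"
    "HOL-Library.Poly_Mapping"
    "HOL-Library.Product_Plus"
    "HOL-Combinatorics.Permutations"
begin

section \<open>Groupoids and functors\<close>

text \<open>The records for groupoids, functors, operads, internal categories, simplicial groupoids and
  bialgebras contain the data only. Functions are relevant on the respective carriers only.\<close>

record ('o, 'a) grpd =
  Ob :: "'o set"
  Ar :: "'a set"
  src :: "'a \<Rightarrow> 'o"
  tgt :: "'a \<Rightarrow> 'o"
  gid :: "'o \<Rightarrow> 'a"
  gcomp :: "'a \<Rightarrow> 'a \<Rightarrow> 'a"  \<comment> \<open>\<open>gcomp G g f\<close> is \<open>g\<close> after \<open>f\<close>\<close>

record ('o, 'a, 'p, 'b) funct =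
  onOb :: "'o \<Rightarrow> 'p"
  onAr :: "'a \<Rightarrow> 'b"

definition fun_id :: "('o, 'a, 'o, 'a) funct" where
  "fun_id = \<lparr>onOb = (\<lambda>x. x), onAr = (\<lambda>f. f)\<rparr>"

definition fun_comp :: "('p, 'b, 'r, 'c) funct \<Rightarrow> ('o, 'a, 'p, 'b) funct \<Rightarrow> ('o, 'a, 'r, 'c) funct" where
  "fun_comp G F = \<lparr>onOb = onOb G \<circ> onOb F, onAr = onAr G \<circ> onAr F\<rparr>"

definition one_grpd :: "(unit, unit) grpd" where
  "one_grpd = \<lparr>Ob = UNIV, Ar = UNIV, src = id, tgt = id, gid = id, gcomp = (\<lambda>_ _. ())\<rparr>"

definition prod_grpd :: "('o, 'a) grpd \<Rightarrow> ('p, 'b) grpd \<Rightarrow> ('o \<times> 'p, 'a \<times> 'b) grpd" where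
  "prod_grpd G H = \<lparr>Ob = Ob G \<times> Ob H, Ar = Ar G \<times> Ar H,
     src = map_prod (src G) (src H), tgt = map_prod (tgt G) (tgt H),
     gid = map_prod (gid G) (gid H),
     gcomp = (\<lambda>(g, g') (f, f'). (gcomp G g f, gcomp H g' f'))\<rparr>"

definition full_subgrpd :: "('o, 'a) grpd \<Rightarrow> 'o set \<Rightarrow> ('o, 'a) grpd" where
  "full_subgrpd G S = G\<lparr>Ob := Ob G \<inter> S, Ar := {f \<in> Ar G. src G f \<in> S \<and> tgt G f \<in> S}\<rparr>"

definition hofib :: "('o, 'a) grpd \<Rightarrow> ('p, 'b) grpd \<Rightarrow> ('o, 'a, 'p, 'b) funct \<Rightarrow> 'p
    \<Rightarrow> ('o \<times> 'b, ('o \<times> 'b) \<times> 'a \<times> ('o \<times> 'b)) grpd" where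
  "hofib G H F y =
     (let obs = {(x, \<phi>). x \<in> Ob G \<and> \<phi> \<in> Ar H \<and> src H \<phi> = onOb F x \<and> tgt H \<phi> = y} in
      \<lparr>Ob = obs,
       Ar = {(p, f, q). p \<in> obs \<and> q \<in> obs \<and> f \<in> Ar G \<and> src G f = fst p \<and> tgt G f = fst q \<and>
               gcomp H (snd q) (onAr F f) = snd p},
       src = (\<lambda>(p, f, q). p), tgt = (\<lambda>(p, f, q). q),
       gid = (\<lambda>p. (p, gid G (fst p), p)),
       gcomp = (\<lambda>(q', g, r) (p, f, q). (p, gcomp G g f, r))\<rparr>)"

definition iso_rel :: "('o, 'a) grpd \<Rightarrow> 'o rel" where
  "iso_rel G = {(x, y). x \<in> Ob G \<and> y \<in> Ob G \<and> (\<exists>f\<in>Ar G. src G f = x \<and> tgt G f = y)}"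

definition pi0 :: "('o, 'a) grpd \<Rightarrow> 'o set set" where
  "pi0 G = Ob G // iso_rel G"

definition iso_class :: "('o, 'a) grpd \<Rightarrow> 'o \<Rightarrow> 'o set" where
  "iso_class G x = iso_rel G `` {x}"

definition rep :: "'o set \<Rightarrow> 'o" where
  "rep c = (SOME x. x \<in> c)"

definition Aut :: "('o, 'a) grpd \<Rightarrow> 'o \<Rightarrow> 'a set" where
  "Aut G x = {f \<in> Ar G. src G f = x \<and> tgt G f = x}"

text \<open>Only meaningful for groupoids with finitely many components and finite automorphism groups.\<close>

definition hcard :: "('o, 'a) grpd \<Rightarrow> rat" where
  "hcard G = (\<Sum>c\<in>pi0 G. 1 / of_nat (card (Aut G (rep c))))"


section \<open>The monads\<close>

definition nelists :: "'a set \<Rightarrow> 'a list set" where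
  "nelists A = {xs. xs \<noteq> [] \<and> set xs \<subseteq> A}"

definition M_grpd :: "('o, 'a) grpd \<Rightarrow> ('o list, 'a list) grpd" where
  "M_grpd G = \<lparr>Ob = nelists (Ob G), Ar = nelists (Ar G),
     src = map (src G), tgt = map (tgt G), gid = map (gid G), gcomp = map2 (gcomp G)\<rparr>"

definition M_fun :: "('o, 'a, 'p, 'b) funct \<Rightarrow> ('o list, 'a list, 'p list, 'b list) funct" where
  "M_fun F = \<lparr>onOb = map (onOb F), onAr = map (onAr F)\<rparr>"

definition M_mu :: "('o list list, 'a list list, 'o list, 'a list) funct" where
  "M_mu = \<lparr>onOb = concat, onAr = concat\<rparr>"

type_synonym 'a s_arrow = "'a list \<times> (nat \<Rightarrow> nat)"

text \<open>An arrow \<open>(fs, \<sigma>)\<close> of the free symmetric monoidal groupoid from \<open>as\<close> to \<open>bs\<close> consists of a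
  permutation \<open>\<sigma>\<close> of the positions together with arrows \<open>fs ! i\<close> from \<open>as ! \<sigma> i\<close> to \<open>bs ! i\<close>.\<close>

definition S_grpd :: "('o, 'a) grpd \<Rightarrow> ('o list, 'a s_arrow) grpd" where
  "S_grpd G = \<lparr>Ob = nelists (Ob G),
     Ar = {(fs, \<sigma>). fs \<in> nelists (Ar G) \<and> \<sigma> permutes {..<length fs}},
     src = (\<lambda>(fs, \<sigma>). permute_list (inv \<sigma>) (map (src G) fs)),
     tgt = (\<lambda>(fs, \<sigma>). map (tgt G) fs),
     gid = (\<lambda>as. (map (gid G) as, id)),
     gcomp = (\<lambda>(gs, \<tau>) (fs, \<sigma>). (map2 (gcomp G) gs (permute_list \<tau> fs), \<sigma> \<circ> \<tau>))\<rparr>"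

text \<open>The permutation underlying the concatenation of the arrows in \<open>xs\<close>, when their order is
  permuted by \<open>\<tau>\<close>: the position \<open>j\<close> in the \<open>i\<close>th target block comes from the position
  \<open>\<sigma>\<^sub>i j\<close> in the source block number \<open>\<tau> i\<close>.\<close>

definition block_perm :: "'a s_arrow list \<Rightarrow> (nat \<Rightarrow> nat) \<Rightarrow> nat \<Rightarrow> nat" where
  "block_perm xs \<tau> =
     (let sizes = permute_list (inv \<tau>) (map (\<lambda>(fs, \<sigma>). length fs) xs);
          ps = concat (map (\<lambda>i. map (\<lambda>j. sum_list (take (\<tau> i) sizes) + snd (xs ! i) j)
                                     [0..<length (fst (xs ! i))]) [0..<length xs])
      in (\<lambda>k. if k < length ps then ps ! k else k))"

definition S_mu :: "('o list list, 'a s_arrow s_arrow, 'o list, 'a s_arrow) funct" where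
  "S_mu = \<lparr>onOb = concat, onAr = (\<lambda>(xs, \<tau>). (concat (map fst xs), block_perm xs \<tau>))\<rparr>"

definition S_eta :: "('o, 'a, 'o list, 'a s_arrow) funct" where
  "S_eta = \<lparr>onOb = (\<lambda>a. [a]), onAr = (\<lambda>f. ([f], id))\<rparr>"


section \<open>Operads and internal categories\<close>

text \<open>The type parameters \<open>'pc\<close> and \<open>'pq\<close> are the types of the arrows of \<open>P Q\<^sub>0\<close> and \<open>P Q\<^sub>1\<close>;
  the objects of \<open>P A\<close> are lists for both monads. The composition \<open>mul\<close> is
  defined on (the total type around) the pullback of \<open>P Q\<^sub>1\<close> and \<open>Q\<^sub>1\<close>, the root being the second
  component.\<close>

record ('c, 'ca, 'pc, 'q, 'qa, 'pq) operad =
  colours :: "('c, 'ca) grpd"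
  ops :: "('q, 'qa) grpd"
  inp :: "('q, 'qa, 'c list, 'pc) funct"
  outp :: "('q, 'qa, 'c, 'ca) funct"
  mul :: "('q list \<times> 'q, 'pq \<times> 'qa, 'q, 'qa) funct"
  unt :: "('c, 'ca, 'q, 'qa) funct"

type_synonym ('c, 'ca, 'q, 'qa) M_operad = "('c, 'ca, 'ca list, 'q, 'qa, 'qa list) operad"
type_synonym ('c, 'ca, 'q, 'qa) S_operad = "('c, 'ca, 'ca s_arrow, 'q, 'qa, 'qa s_arrow) operad"

definition Sym :: "(unit, unit, unit list, unit s_arrow) S_operad" where
  "Sym = \<lparr>colours = one_grpd, ops = S_grpd one_grpd, inp = fun_id,
     outp = \<lparr>onOb = (\<lambda>_. ()), onAr = (\<lambda>_. ())\<rparr>,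
     mul = fun_comp S_mu \<lparr>onOb = fst, onAr = fst\<rparr>,
     unt = S_eta\<rparr>"

text \<open>Categories internal to groupoids; \<open>icomp\<close> maps \<open>(y, x)\<close> to \<open>y\<close> after \<open>x\<close>.\<close>

record ('c, 'ca, 'f, 'fa) icat =
  C0 :: "('c, 'ca) grpd"
  C1 :: "('f, 'fa) grpd"
  isrc :: "('f, 'fa, 'c, 'ca) funct"
  itgt :: "('f, 'fa, 'c, 'ca) funct"
  icomp :: "('f \<times> 'f, 'fa \<times> 'fa, 'f, 'fa) funct"
  iid :: "('c, 'ca, 'f, 'fa) funct"


section \<open>The T-construction\<close>

text \<open>Colours are assumed to form a discrete groupoid. In \<open>y \<circ> x = m((x,\<dots>,x); y)\<close> for arrows
  \<open>\<beta>\<close>, \<open>\<alpha>\<close> the copies of \<open>\<alpha>\<close> are permuted according to the action of \<open>\<beta>\<close> on the inputs, so that the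
  pair lies in the pullback.\<close>

definition T_S :: "('c, 'ca, 'q, 'qa) S_operad \<Rightarrow> ('c, 'ca, 'q, 'qa) icat" where
  "T_S Q = \<lparr>C0 = colours Q,
     C1 = full_subgrpd (ops Q) {q. \<exists>c. set (onOb (inp Q) q) = {c}},
     isrc = \<lparr>onOb = (\<lambda>q. hd (onOb (inp Q) q)), onAr = (\<lambda>\<alpha>. hd (fst (onAr (inp Q) \<alpha>)))\<rparr>,
     itgt = outp Q,
     icomp = \<lparr>onOb = (\<lambda>(y, x). onOb (mul Q) (replicate (length (onOb (inp Q) y)) x, y)),
              onAr = (\<lambda>(\<beta>, \<alpha>). let (cs, \<sigma>) = onAr (inp Q) \<beta> in
                        onAr (mul Q) ((replicate (length cs) \<alpha>, \<sigma>), \<beta>))\<rparr>,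
     iid = unt Q\<rparr>"

definition T_M :: "('c, 'ca, 'f, 'fa) icat \<Rightarrow> ('c, 'ca, 'f list, 'fa list) M_operad" where
  "T_M C = \<lparr>colours = C0 C,
     ops = full_subgrpd (M_grpd (C1 C)) {fs. \<exists>c. set (map (onOb (itgt C)) fs) = {c}},
     inp = M_fun (isrc C),
     outp = \<lparr>onOb = (\<lambda>fs. onOb (itgt C) (hd fs)), onAr = (\<lambda>\<alpha>s. onAr (itgt C) (hd \<alpha>s))\<rparr>,
     mul = \<lparr>onOb = (\<lambda>(gss, fs). concat (map2 (\<lambda>gs f. map (\<lambda>g. onOb (icomp C) (f, g)) gs) gss fs)),
            onAr = (\<lambda>(gss, fs). concat (map2 (\<lambda>gs f. map (\<lambda>g. onAr (icomp C) (f, g)) gs) gss fs))\<rparr>,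
     unt = \<lparr>onOb = (\<lambda>c. [onOb (iid C) c]), onAr = (\<lambda>\<gamma>. [onAr (iid C) \<gamma>])\<rparr>\<rparr>"


section \<open>The bar construction of an M-operad\<close>

text \<open>Objects and arrows of the groupoids of \<open>n\<close>-level trees are trees whose nodes are decorated by
  objects, respectively arrows, of \<open>Q\<^sub>1\<close>. Trees start from \<open>Q\<^sub>0\<close> as in \<open>Q\<^sub>n = P Q\<^bsub>n-1\<^esub> \<times> Q\<^sub>1\<close> for all
  \<open>n \<ge> 1\<close> (fibre product over \<open>P Q\<^sub>0\<close>). For \<open>n = 1\<close> this identifies the operation \<open>q\<close> with the corolla
  \<open>Node q (map Leaf (s q))\<close>.\<close>

datatype ('c, 'q) ltree = Leaf (leaf: 'c) | Node (rootop: 'q) (subtrees: "('c, 'q) ltree list")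

primrec tout :: "('q \<Rightarrow> 'c) \<Rightarrow> ('c, 'q) ltree \<Rightarrow> 'c" where
  "tout t (Leaf c) = c"
| "tout t (Node q ts) = t q"

primrec ltrees :: "'c set \<Rightarrow> 'q set \<Rightarrow> ('q \<Rightarrow> 'c list) \<Rightarrow> ('q \<Rightarrow> 'c) \<Rightarrow> nat \<Rightarrow> ('c, 'q) ltree set" where
  "ltrees C Q s t 0 = Leaf ` C"
| "ltrees C Q s t (Suc n) =
     {Node q ts | q ts. q \<in> Q \<and> ts \<in> nelists (ltrees C Q s t n) \<and> map (tout t) ts = s q}"

primrec tcomp :: "('ca \<Rightarrow> 'ca \<Rightarrow> 'ca) \<Rightarrow> ('qa \<Rightarrow> 'qa \<Rightarrow> 'qa)
    \<Rightarrow> ('ca, 'qa) ltree \<Rightarrow> ('ca, 'qa) ltree \<Rightarrow> ('ca, 'qa) ltree" where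
  "tcomp k l (Leaf b) u = Leaf (k b (leaf u))"
| "tcomp k l (Node \<beta> ts) u =
     Node (l \<beta> (rootop u)) (map2 (\<lambda>h v. h v) (map (tcomp k l) ts) (subtrees u))"

definition tree_grpd ::
    "('c, 'ca, 'q, 'qa) M_operad \<Rightarrow> nat \<Rightarrow> (('c, 'q) ltree, ('ca, 'qa) ltree) grpd" where
  "tree_grpd Q n =
     \<lparr>Ob = ltrees (Ob (colours Q)) (Ob (ops Q)) (onOb (inp Q)) (onOb (outp Q)) n,
      Ar = ltrees (Ar (colours Q)) (Ar (ops Q)) (onAr (inp Q)) (onAr (outp Q)) n,
      src = map_ltree (src (colours Q)) (src (ops Q)),
      tgt = map_ltree (tgt (colours Q)) (tgt (ops Q)),
      gid = map_ltree (gid (colours Q)) (gid (ops Q)),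
      gcomp = tcomp (gcomp (colours Q)) (gcomp (ops Q))\<rparr>"

text \<open>\<open>tface t m n i\<close>, for \<open>i < n\<close>, maps \<open>n\<close>-level trees to \<open>(n-1)\<close>-level trees: it discards the top
  level for \<open>i = 0\<close>, and composes the \<open>i\<close>th with the \<open>(i+1)\<close>st level (counted from the leaves) for
  \<open>i > 0\<close>. \<open>tdegen t e n i\<close>, for \<open>i \<le> n\<close>, inserts a level of units just below the \<open>i\<close>th level.\<close>

primrec tface :: "('q \<Rightarrow> 'c) \<Rightarrow> ('q list \<times> 'q \<Rightarrow> 'q) \<Rightarrow> nat \<Rightarrow> nat
    \<Rightarrow> ('c, 'q) ltree \<Rightarrow> ('c, 'q) ltree" where
  "tface t m 0 i x = x"
| "tface t m (Suc n) i x =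
     (if i < n then Node (rootop x) (map (tface t m n i) (subtrees x))
      else if n = 0 then Leaf (tout t x)
      else Node (m (map rootop (subtrees x), rootop x)) (concat (map subtrees (subtrees x))))"

primrec tdegen :: "('q \<Rightarrow> 'c) \<Rightarrow> ('c \<Rightarrow> 'q) \<Rightarrow> nat \<Rightarrow> nat
    \<Rightarrow> ('c, 'q) ltree \<Rightarrow> ('c, 'q) ltree" where
  "tdegen t e 0 i x = Node (e (tout t x)) [x]"
| "tdegen t e (Suc n) i x =
     (if i \<le> n then Node (rootop x) (map (tdegen t e n i) (subtrees x))
      else Node (e (tout t x)) [x])"

record ('o, 'a) simp_grpd =
  lev :: "nat \<Rightarrow> ('o, 'a) grpd"
  face :: "nat \<Rightarrow> nat \<Rightarrow> ('o, 'a, 'o, 'a) funct"  \<comment> \<open>\<open>face X n i\<close> from level \<open>n\<close> to \<open>n - 1\<close>, \<open>i \<le> n\<close>\<close>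
  degen :: "nat \<Rightarrow> nat \<Rightarrow> ('o, 'a, 'o, 'a) funct"  \<comment> \<open>\<open>degen X n i\<close> from level \<open>n\<close> to \<open>n + 1\<close>, \<open>i \<le> n\<close>\<close>

definition bar :: "('c, 'ca, 'q, 'qa) M_operad
    \<Rightarrow> (('c, 'q) ltree list, ('ca, 'qa) ltree list) simp_grpd" where
  "bar Q = \<lparr>lev = (\<lambda>n. M_grpd (tree_grpd Q n)),
     face = (\<lambda>n i.
       if i = n
       then fun_comp M_mu (M_fun \<lparr>onOb = subtrees, onAr = subtrees\<rparr>)
       else M_fun \<lparr>onOb = tface (onOb (outp Q)) (onOb (mul Q)) n i,
                   onAr = tface (onAr (outp Q)) (onAr (mul Q)) n i\<rparr>),
     degen = (\<lambda>n i. M_fun \<lparr>onOb = tdegen (onOb (outp Q)) (onOb (unt Q)) n i,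
                           onAr = tdegen (onAr (outp Q)) (onAr (unt Q)) n i\<rparr>)\<rparr>"


section \<open>Bialgebras over the rationals\<close>

text \<open>A vector space with basis \<open>B\<close> is the set of \<open>v :: 'b \<Rightarrow>\<^sub>0 rat\<close> with \<open>keys v \<subseteq> B\<close>, and the tensor
  product of spaces with bases \<open>B\<close> and \<open>C\<close> is the space with basis \<open>B \<times> C\<close>.\<close>

definition smult :: "rat \<Rightarrow> ('b \<Rightarrow>\<^sub>0 rat) \<Rightarrow> ('b \<Rightarrow>\<^sub>0 rat)" where
  "smult c v = Poly_Mapping.map (\<lambda>x. c * x) v"

definition span_of :: "'b set \<Rightarrow> ('b \<Rightarrow>\<^sub>0 rat) set" where
  "span_of B = {v. Poly_Mapping.keys v \<subseteq> B}"

abbreviation delta :: "'b \<Rightarrow> ('b \<Rightarrow>\<^sub>0 rat)" where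
  "delta b \<equiv> Poly_Mapping.single b 1"

definition lin_ext :: "('b \<Rightarrow> ('c \<Rightarrow>\<^sub>0 rat)) \<Rightarrow> ('b \<Rightarrow>\<^sub>0 rat) \<Rightarrow> ('c \<Rightarrow>\<^sub>0 rat)" where
  "lin_ext f v = (\<Sum>b\<in>Poly_Mapping.keys v. smult (Poly_Mapping.lookup v b) (f b))"

definition lin_form :: "('b \<Rightarrow> rat) \<Rightarrow> ('b \<Rightarrow>\<^sub>0 rat) \<Rightarrow> rat" where
  "lin_form f v = (\<Sum>b\<in>Poly_Mapping.keys v. Poly_Mapping.lookup v b * f b)"

definition tensor :: "('b \<Rightarrow>\<^sub>0 rat) \<Rightarrow> ('c \<Rightarrow>\<^sub>0 rat) \<Rightarrow> ('b \<times> 'c \<Rightarrow>\<^sub>0 rat)" where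
  "tensor v w = lin_ext (\<lambda>b. lin_ext (\<lambda>c. delta (b, c)) w) v"

definition tensor_map :: "(('b \<Rightarrow>\<^sub>0 rat) \<Rightarrow> ('d \<Rightarrow>\<^sub>0 rat)) \<Rightarrow> (('c \<Rightarrow>\<^sub>0 rat) \<Rightarrow> ('e \<Rightarrow>\<^sub>0 rat))
    \<Rightarrow> ('b \<times> 'c \<Rightarrow>\<^sub>0 rat) \<Rightarrow> ('d \<times> 'e \<Rightarrow>\<^sub>0 rat)" where
  "tensor_map f g = lin_ext (\<lambda>(b, c). tensor (f (delta b)) (g (delta c)))"

record 'b balg =
  basis :: "'b set"
  bone :: "'b \<Rightarrow>\<^sub>0 rat"
  bmult :: "('b \<Rightarrow>\<^sub>0 rat) \<Rightarrow> ('b \<Rightarrow>\<^sub>0 rat) \<Rightarrow> ('b \<Rightarrow>\<^sub>0 rat)"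
  comult :: "('b \<Rightarrow>\<^sub>0 rat) \<Rightarrow> ('b \<times> 'b \<Rightarrow>\<^sub>0 rat)"
  counit :: "('b \<Rightarrow>\<^sub>0 rat) \<Rightarrow> rat"

definition linear_on :: "'b set \<Rightarrow> (('b \<Rightarrow>\<^sub>0 rat) \<Rightarrow> ('c \<Rightarrow>\<^sub>0 rat)) \<Rightarrow> bool" where
  "linear_on B f \<longleftrightarrow>
     (\<forall>v\<in>span_of B. \<forall>w\<in>span_of B. f (v + w) = f v + f w) \<and>
     (\<forall>c. \<forall>v\<in>span_of B. f (smult c v) = smult c (f v))"

definition bialgebra :: "'b balg \<Rightarrow> bool" where
  "bialgebra H \<longleftrightarrow>
     (let V = span_of (basis H); V2 = span_of (basis H \<times> basis H);
          mult2 = (\<lambda>t u. lin_ext (\<lambda>(a, b). lin_ext (\<lambda>(c, d).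
             tensor (bmult H (delta a) (delta c)) (bmult H (delta b) (delta d))) u) t) in
      bone H \<in> V \<and>
      (\<forall>v\<in>V. \<forall>w\<in>V. bmult H v w \<in> V) \<and>
      (\<forall>v\<in>V. linear_on (basis H) (bmult H v) \<and> linear_on (basis H) (\<lambda>w. bmult H w v)) \<and>
      (\<forall>u\<in>V. \<forall>v\<in>V. \<forall>w\<in>V. bmult H (bmult H u v) w = bmult H u (bmult H v w)) \<and>
      (\<forall>v\<in>V. bmult H (bone H) v = v \<and> bmult H v (bone H) = v) \<and>
      linear_on (basis H) (comult H) \<and> (\<forall>v\<in>V. comult H v \<in> V2) \<and>
      (\<forall>v\<in>V. \<forall>w\<in>V. counit H (v + w) = counit H v + counit H w) \<and>
      (\<forall>c. \<forall>v\<in>V. counit H (smult c v) = c * counit H v) \<and>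
      (\<forall>v\<in>V. lin_ext (\<lambda>((a, b), c). delta (a, (b, c))) (tensor_map (comult H) id (comult H v))
              = tensor_map id (comult H) (comult H v)) \<and>
      (\<forall>v\<in>V. lin_ext (\<lambda>(a, b). smult (counit H (delta a)) (delta b)) (comult H v) = v \<and>
              lin_ext (\<lambda>(a, b). smult (counit H (delta b)) (delta a)) (comult H v) = v) \<and>
      comult H (bone H) = tensor (bone H) (bone H) \<and>
      (\<forall>v\<in>V. \<forall>w\<in>V. comult H (bmult H v w) = mult2 (comult H v) (comult H w)) \<and>
      counit H (bone H) = 1 \<and>
      (\<forall>v\<in>V. \<forall>w\<in>V. counit H (bmult H v w) = counit H v * counit H w))"

definition bialgebra_iso :: "'b balg \<Rightarrow> 'c balg \<Rightarrow> (('b \<Rightarrow>\<^sub>0 rat) \<Rightarrow> ('c \<Rightarrow>\<^sub>0 rat)) \<Rightarrow> bool" where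
  "bialgebra_iso H K \<phi> \<longleftrightarrow>
     bij_betw \<phi> (span_of (basis H)) (span_of (basis K)) \<and>
     linear_on (basis H) \<phi> \<and>
     \<phi> (bone H) = bone K \<and>
     (\<forall>v\<in>span_of (basis H). \<forall>w\<in>span_of (basis H). \<phi> (bmult H v w) = bmult K (\<phi> v) (\<phi> w)) \<and>
     (\<forall>v\<in>span_of (basis H). comult K (\<phi> v) = tensor_map \<phi> \<phi> (comult H v)) \<and>
     (\<forall>v\<in>span_of (basis H). counit K (\<phi> v) = counit H v)"

definition isomorphic_bialgebras :: "'b balg \<Rightarrow> 'c balg \<Rightarrow> bool" where
  "isomorphic_bialgebras H K \<longleftrightarrow> bialgebra H \<and> bialgebra K \<and> (\<exists>\<phi>. bialgebra_iso H K \<phi>)"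


section \<open>The incidence bialgebra of a simplicial groupoid\<close>

text \<open>The order of the components follows \<open>(d\<^sub>2, d\<^sub>0)\<close>: \<open>a\<close> is the leaf layer and \<open>b\<close> the root layer.\<close>

definition Phi :: "('o, 'a) simp_grpd \<Rightarrow> 'o \<Rightarrow> 'o \<Rightarrow> 'o
    \<Rightarrow> (('o \<times> 'a) \<times> 'a \<times> 'a,
        (('o \<times> 'a) \<times> 'a \<times> 'a) \<times> (('o \<times> 'a) \<times> 'a \<times> ('o \<times> 'a)) \<times> (('o \<times> 'a) \<times> 'a \<times> 'a)) grpd" where
  "Phi X f a b =
     hofib (hofib (lev X 2) (lev X 1) (face X 2 1) f) (prod_grpd (lev X 1) (lev X 1))
       \<lparr>onOb = (\<lambda>(x, \<phi>). (onOb (face X 2 2) x, onOb (face X 2 0) x)),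
        onAr = (\<lambda>(p, g, q). (onAr (face X 2 2) g, onAr (face X 2 0) g))\<rparr> (a, b)"

definition inc_coeff :: "('o, 'a) simp_grpd \<Rightarrow> 'o set \<Rightarrow> 'o set \<Rightarrow> 'o set \<Rightarrow> rat" where
  "inc_coeff X f a b = hcard (Phi X (rep f) (rep a) (rep b)) /
     of_nat (card (Aut (lev X 1) (rep a)) * card (Aut (lev X 1) (rep b)))"

text \<open>The basis element \<open>None\<close> is the adjoined unit. The sum defining the comultiplication ranges
  over its (finite) support.\<close>

definition incidence_bialgebra ::
    "('o, 'a) simp_grpd \<Rightarrow> ('o \<Rightarrow> 'o \<Rightarrow> 'o) \<Rightarrow> 'o set option balg" where
  "incidence_bialgebra X jux =
     \<lparr>basis = insert None (Some ` pi0 (lev X 1)),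
      bone = delta None,
      bmult = (\<lambda>v w. lin_ext (\<lambda>a. lin_ext (\<lambda>b. delta
         (case (a, b) of
            (None, _) \<Rightarrow> b
          | (_, None) \<Rightarrow> a
          | (Some a', Some b') \<Rightarrow> Some (iso_class (lev X 1) (jux (rep a') (rep b'))))) w) v),
      comult = lin_ext (\<lambda>x. case x of
         None \<Rightarrow> delta (None, None)
       | Some f \<Rightarrow> \<Sum>(a, b)\<in>{(a, b). a \<in> pi0 (lev X 1) \<and> b \<in> pi0 (lev X 1) \<and> inc_coeff X f a b \<noteq> 0}.
                     Poly_Mapping.single (Some a, Some b) (inc_coeff X f a b)),
      counit = lin_form (\<lambda>x. case x of
         None \<Rightarrow> 1
       | Some f \<Rightarrow> hcard (hofib (lev X 0) (lev X 1) (degen X 0 0) (rep f)))\<rparr>"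


section \<open>Noncommutative power series and plethystic substitution\<close>

class rat_algebra_1 = ring_1 +
  fixes qscale :: "rat \<Rightarrow> 'a \<Rightarrow> 'a"
  assumes qscale_add_right: "qscale c (x + y) = qscale c x + qscale c y"
    and qscale_add_left: "qscale (c + d) x = qscale c x + qscale d x"
    and qscale_qscale: "qscale c (qscale d x) = qscale (c * d) x"
    and qscale_one: "qscale 1 x = x"
    and qscale_mult_left: "qscale c x * y = qscale c (x * y)"
    and qscale_mult_right: "x * qscale c y = qscale c (x * y)"

instantiation rat :: rat_algebra_1
begin
definition qscale_rat :: "rat \<Rightarrow> rat \<Rightarrow> rat" where "qscale_rat c x = c * x"
instance by standard (simp_all add: qscale_rat_def algebra_simps)
end

lemma qscale_zero_right [simp]: "qscale c (0 :: 'a :: rat_algebra_1) = 0"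
  using qscale_add_right[of c 0 0] by simp

lemma single_zero_central:
  fixes p :: "'a::monoid_add \<Rightarrow>\<^sub>0 'b::ring_1"
  assumes "\<And>y. c * y = y * c"
  shows "Poly_Mapping.single 0 c * p = p * Poly_Mapping.single 0 c"
proof -
  have p: "p = (\<Sum>k\<in>Poly_Mapping.keys p. Poly_Mapping.single k (Poly_Mapping.lookup p k))"
    by (rule poly_mapping_eqI)
      (auto simp: lookup_sum lookup_single when_def in_keys_iff sum.delta)
  show ?thesis
    by (subst (1 2) p) (simp add: sum_distrib_left sum_distrib_right mult_single assms)
qed

instantiation poly_mapping :: (monoid_add, rat_algebra_1) rat_algebra_1
begin

definition qscale_poly_mapping :: "rat \<Rightarrow> ('a \<Rightarrow>\<^sub>0 'b) \<Rightarrow> ('a \<Rightarrow>\<^sub>0 'b)" where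
  "qscale_poly_mapping c p = Poly_Mapping.single 0 (qscale c 1) * p"

instance
proof
  fix c d :: rat and p q :: "'a \<Rightarrow>\<^sub>0 'b"
  have central: "qscale c 1 * y = y * qscale c 1" for y :: 'b
    by (simp add: qscale_mult_left qscale_mult_right)
  show "qscale c (p + q) = qscale c p + qscale c q"
    by (simp add: qscale_poly_mapping_def distrib_left)
  show "qscale (c + d) p = qscale c p + qscale d p"
    by (simp add: qscale_poly_mapping_def qscale_add_left single_add distrib_right)
  show "qscale c (qscale d p) = qscale (c * d) p"
    by (simp add: qscale_poly_mapping_def mult.assoc[symmetric] mult_single qscale_mult_left qscale_qscale)
  show "qscale 1 p = p"
    by (simp add: qscale_poly_mapping_def qscale_one)
  show "qscale c p * q = qscale c (p * q)"
    by (simp add: qscale_poly_mapping_def mult.assoc)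
  show "p * qscale c q = qscale c (p * q)"
    unfolding qscale_poly_mapping_def
    by (simp add: mult.assoc[symmetric] single_zero_central[OF central, symmetric])
qed

end

text \<open>Power series in noncommuting variables (which commute with the coefficients) are given by
  the coefficients of the words. The words of \<open>W\<close> index the series without constant term.\<close>

type_synonym 'r ncseries = "nat list \<Rightarrow> 'r"

definition W :: "nat list set" where
  "W = {w. w \<noteq> [] \<and> (\<forall>i\<in>set w. 0 < i)}"

definition wfact :: "nat list \<Rightarrow> nat" where
  "wfact w = prod_list (map fact w)"

text \<open>\<open>acoeff w F\<close> is \<open>A\<^sub>w(F) = F\<^sub>w\<close>, and \<open>series a\<close> is the series with \<open>F\<^sub>w = a w\<close> for \<open>w \<in> W\<close>.\<close>

definition acoeff :: "nat list \<Rightarrow> 'r::rat_algebra_1 ncseries \<Rightarrow> 'r" where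
  "acoeff w F = qscale (of_nat (wfact w)) (F w)"

definition series :: "(nat list \<Rightarrow> 'r) \<Rightarrow> 'r::rat_algebra_1 ncseries" where
  "series a = (\<lambda>w. if w \<in> W then qscale (1 / of_nat (wfact w)) (a w) else 0)"

definition ser_one :: "'r::ring_1 ncseries" where
  "ser_one = (\<lambda>w. if w = [] then 1 else 0)"

definition ser_mult :: "'r::ring_1 ncseries \<Rightarrow> 'r ncseries \<Rightarrow> 'r ncseries" where
  "ser_mult F G = (\<lambda>w. \<Sum>i\<le>length w. F (take i w) * G (drop i w))"

definition dilate :: "nat \<Rightarrow> 'r::ring_1 ncseries \<Rightarrow> 'r ncseries" where
  "dilate k F = (\<lambda>w. \<Sum>v. F v when map ((*) k) v = w)"  \<comment> \<open>\<open>F(x\<^sub>k, x\<^bsub>2k\<^esub>, \<dots>)\<close>\<close>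

definition pleth :: "'r::ring_1 ncseries \<Rightarrow> 'r ncseries \<Rightarrow> 'r ncseries"  (infixl "\<circledast>" 70) where
  "G \<circledast> F = (\<lambda>w. \<Sum>v. G v * foldr ser_mult (map (\<lambda>k. dilate k F) v) ser_one w)"


section \<open>The noncommutative plethystic bialgebra\<close>

text \<open>The free monoid, written additively so that \<open>'a fmon \<Rightarrow>\<^sub>0 rat\<close> is the free algebra on \<open>'a\<close>, and
  \<open>'a fmon \<times> 'a fmon \<Rightarrow>\<^sub>0 rat\<close> is its tensor square.\<close>

datatype 'a fmon = Fmon (letters: "'a list")

instantiation fmon :: (type) monoid_add
begin
definition zero_fmon :: "'a fmon" where "0 = Fmon []"
definition plus_fmon :: "'a fmon \<Rightarrow> 'a fmon \<Rightarrow> 'a fmon" where "u + v = Fmon (letters u @ letters v)"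
instance by standard (simp_all add: zero_fmon_def plus_fmon_def)
end

type_synonym pleth_alg = "nat list fmon \<Rightarrow>\<^sub>0 rat"
type_synonym pleth_alg2 = "nat list fmon \<times> nat list fmon \<Rightarrow>\<^sub>0 rat"

definition gen :: "nat list \<Rightarrow> pleth_alg" where
  "gen w = delta (Fmon [w])"

text \<open>\<open>A\<^sub>w(G \<circledast> F)\<close> for the generic series \<open>F\<close> and \<open>G\<close> with \<open>F\<^sub>w = A\<^sub>w \<otimes> 1\<close> and \<open>G\<^sub>w = 1 \<otimes> A\<^sub>w\<close>. See
  below for its evaluation at arbitrary series.\<close>

definition pleth_comult_gen :: "nat list \<Rightarrow> pleth_alg2" where
  "pleth_comult_gen w = acoeff w (series (\<lambda>v. tensor 1 (gen v)) \<circledast> series (\<lambda>v. tensor (gen v) 1))"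

definition pleth_counit_gen :: "nat list \<Rightarrow> rat" where
  "pleth_counit_gen w = acoeff w (\<lambda>v. if v = [1] then 1 else 0)"

definition plethystic_bialgebra :: "nat list fmon balg" where
  "plethystic_bialgebra =
     \<lparr>basis = {Fmon ws | ws. set ws \<subseteq> W},
      bone = 1,
      bmult = (*),
      comult = lin_ext (\<lambda>u. prod_list (map pleth_comult_gen (letters u))),
      counit = lin_form (\<lambda>u. prod_list (map pleth_counit_gen (letters u)))\<rparr>"

text \<open>Over a noncommutative ring the coefficients of \<open>G\<close> stand to the left in \<open>G \<circledast> F\<close>; therefore
  \<open>a \<otimes> b\<close> is evaluated at \<open>(F, G)\<close> as \<open>b(G) a(F)\<close>.\<close>

definition ev2 :: "'r::rat_algebra_1 ncseries \<Rightarrow> 'r ncseries \<Rightarrow> pleth_alg2 \<Rightarrow> 'r" where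
  "ev2 F G t = (\<Sum>(u, v)\<in>Poly_Mapping.keys t. qscale (Poly_Mapping.lookup t (u, v))
     (prod_list (map (\<lambda>w. acoeff w G) (letters v)) * prod_list (map (\<lambda>w. acoeff w F) (letters u))))"

text \<open>\<open>splits v w\<close> is the set of \<open>(g\<^sub>1, \<dots>, g\<^sub>k)\<close> such that \<open>w\<close> is the concatenation of the \<open>v\<^sub>i g\<^sub>i\<close>,
  i.e. of the ways in which \<open>G\<^sub>v F\<^bsub>g\<^sub>1\<^esub> \<cdots> F\<^bsub>g\<^sub>k\<^esub>\<close> contributes to the coefficient of \<open>w\<close> in \<open>G \<circledast> F\<close>.\<close>

definition splits :: "nat list \<Rightarrow> nat list \<Rightarrow> nat list list set" where
  "splits v w = {gs. set gs \<subseteq> W \<and> length gs = length v \<and>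
     concat (map2 (\<lambda>k g. map ((*) k) g) v gs) = w}"

lemma splits_Nil: "splits [] w = (if w = [] then {[]} else {})"
  by (auto simp: splits_def)

lemma splits_Cons:
  "splits (k # v) w = (\<Union>i\<le>length w. (\<lambda>(g, gs). g # gs) `
     ({g \<in> W. map ((*) k) g = take i w} \<times> splits v (drop i w)))"
proof (intro set_eqI iffI)
  fix hs assume "hs \<in> splits (k # v) w"
  then obtain g gs where hs: "hs = g # gs" "g \<in> W" "set gs \<subseteq> W" "length gs = length v"
    "map ((*) k) g @ concat (map2 (\<lambda>k g. map ((*) k) g) v gs) = w"
    by (cases hs) (auto simp: splits_def)
  have "length g \<le> length w" "map ((*) k) g = take (length g) w" "gs \<in> splits v (drop (length g) w)"
    using hs(3-4) by (auto simp: splits_def simp flip: hs(5))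
  then show "hs \<in> (\<Union>i\<le>length w. (\<lambda>(g, gs). g # gs) `
     ({g \<in> W. map ((*) k) g = take i w} \<times> splits v (drop i w)))"
    using hs(1,2) by blast
next
  fix hs assume "hs \<in> (\<Union>i\<le>length w. (\<lambda>(g, gs). g # gs) `
     ({g \<in> W. map ((*) k) g = take i w} \<times> splits v (drop i w)))"
  then obtain i g gs where *: "hs = g # gs" "g \<in> W" "map ((*) k) g = take i w" "gs \<in> splits v (drop i w)"
    by auto
  have "map ((*) k) g @ concat (map2 (\<lambda>k g. map ((*) k) g) v gs) = w"
    using *(3,4) by (simp add: splits_def)
  then show "hs \<in> splits (k # v) w"
    using * by (simp add: splits_def)
qed

lemma dilate_fibre:
  assumes "0 < k"
  shows "finite {g \<in> W. map ((*) k) g = w}"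
proof -
  have "inj ((*) k)" using assms by (simp add: inj_def)
  then have "inj (map ((*) k))" by (rule inj_mapI)
  then have "finite (map ((*) k) -` {w})" by (intro finite_vimageI) simp_all
  then show ?thesis by (rule rev_finite_subset) auto
qed

lemma dilate_eq:
  assumes "0 < k" "\<And>v. v \<notin> W \<Longrightarrow> F v = 0"
  shows "dilate k F w = (\<Sum>g\<in>{g \<in> W. map ((*) k) g = w}. F g)"
proof -
  have "dilate k F w = (\<Sum>g\<in>{g \<in> W. map ((*) k) g = w}. F g when map ((*) k) g = w)"
    unfolding dilate_def using assms dilate_fibre[OF assms(1)]
    by (intro Sum_any.expand_superset) (auto simp: when_def)
  also have "\<dots> = (\<Sum>g\<in>{g \<in> W. map ((*) k) g = w}. F g)"
    by (rule sum.cong) auto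
  finally show ?thesis .
qed

lemma finite_splits:
  assumes "\<forall>k\<in>set v. 0 < k" shows "finite (splits v w)"
  using assms by (induction v arbitrary: w) (auto simp: splits_Nil splits_Cons dilate_fibre)

lemma monomial_eq:
  fixes F :: "'r::ring_1 ncseries"
  assumes "\<forall>k\<in>set v. 0 < k" "\<And>v. v \<notin> W \<Longrightarrow> F v = 0"
  shows "foldr ser_mult (map (\<lambda>k. dilate k F) v) ser_one w = (\<Sum>gs\<in>splits v w. prod_list (map F gs))"
  using assms(1)
proof (induction v arbitrary: w)
  case Nil
  show ?case by (simp add: ser_one_def splits_Nil)
next
  case (Cons k v)
  have k: "0 < k" using Cons.prems by simp
  let ?A = "\<lambda>i. {g \<in> W. map ((*) k) g = take i w} \<times> splits v (drop i w)"
  have fin: "finite (?A i)" for i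
    using Cons.prems by (auto simp: dilate_fibre finite_splits)
  have disj: "(\<lambda>(g, gs). g # gs) ` ?A i \<inter> (\<lambda>(g, gs). g # gs) ` ?A j = {}"
    if "i \<le> length w" "j \<le> length w" "i \<noteq> j" for i j
  proof -
    have "length (hd hs) = n" if n: "n \<le> length w" and hs: "hs \<in> (\<lambda>(g, gs). g # gs) ` ?A n" for n hs
    proof -
      obtain g where g: "hd hs = g" "map ((*) k) g = take n w" using hs by auto
      have "length g = length (take n w)" using arg_cong[OF g(2), of length] by simp
      then show ?thesis using n g(1) by simp
    qed
    then show ?thesis using that by blast
  qed
  have "(\<Sum>gs\<in>splits (k # v) w. prod_list (map F gs))
      = (\<Sum>i\<le>length w. \<Sum>gs\<in>(\<lambda>(g, gs). g # gs) ` ?A i. prod_list (map F gs))"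
    unfolding splits_Cons
    by (rule sum.UNION_disjoint) (use disj in \<open>simp_all add: fin\<close>)
  also have "\<dots> = (\<Sum>i\<le>length w. \<Sum>(g, gs)\<in>?A i. F g * prod_list (map F gs))"
    by (intro sum.cong refl) (subst sum.reindex, auto simp: inj_on_def intro!: sum.cong)
  also have "\<dots> = (\<Sum>i\<le>length w. dilate k F (take i w) * foldr ser_mult (map (\<lambda>k. dilate k F) v) ser_one (drop i w))"
    using Cons by (intro sum.cong refl)
      (simp add: dilate_eq[OF k assms(2)] sum_product sum.cartesian_product)
  finally show ?case by (simp add: ser_mult_def[of "dilate k F"])
qed

lemma finite_splits_ne: "finite {v \<in> W. splits v w \<noteq> {}}"
proof (rule finite_subset)
  show "finite {v. set v \<subseteq> {..sum_list w} \<and> length v \<le> length w}"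
    by (rule finite_lists_length_le) simp
  have *: "set v \<subseteq> {..sum_list w} \<and> length v \<le> length w" if "gs \<in> splits v w" for v gs
    using that
  proof (induction v arbitrary: w gs)
    case Nil then show ?case by simp
  next
    case (Cons k v)
    from Cons.prems obtain i g gs' where *: "g \<in> W" "map ((*) k) g = take i w"
      "gs' \<in> splits v (drop i w)" unfolding splits_Cons by blast
    have w: "w = map ((*) k) g @ drop i w" by (simp only: *(2) append_take_drop_id)
    obtain a g' where g: "g = a # g'" "0 < a"
    proof (cases g)
      case Nil then show ?thesis using *(1) by (simp add: W_def)
    next
      case (Cons a g') then show ?thesis using *(1) that by (simp add: W_def)
    qed
    define y where "y = drop i w"
    have w': "w = k * a # map ((*) k) g' @ y" using w by (simp only: g(1) y_def list.map append_Cons)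
    have "k \<le> k * a" using g(2) by simp
    then have "k \<le> sum_list w" unfolding w' sum_list.Cons by (rule trans_le_add1)
    moreover have "sum_list y \<le> sum_list w" "Suc (length y) \<le> length w"
      unfolding w' by simp_all
    moreover have "set v \<subseteq> {..sum_list y}" "length v \<le> length y"
      using Cons.IH[OF *(3)] unfolding y_def by blast+
    ultimately show ?case by auto
  qed
  show "{v \<in> W. splits v w \<noteq> {}} \<subseteq> {v. set v \<subseteq> {..sum_list w} \<and> length v \<le> length w}"
  proof
    fix v assume "v \<in> {v \<in> W. splits v w \<noteq> {}}"
    then obtain gs where "gs \<in> splits v w" by auto
    from *[OF this] show "v \<in> {v. set v \<subseteq> {..sum_list w} \<and> length v \<le> length w}" by (rule CollectI)
  qed
qed

lemma pleth_eq:
  fixes F G :: "'r::ring_1 ncseries"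
  assumes "\<And>v. v \<notin> W \<Longrightarrow> F v = 0" "\<And>v. v \<notin> W \<Longrightarrow> G v = 0"
  shows "(G \<circledast> F) w = (\<Sum>v | v \<in> W \<and> splits v w \<noteq> {}. \<Sum>gs\<in>splits v w. G v * prod_list (map F gs))"
proof -
  have eq: "G v * foldr ser_mult (map (\<lambda>k. dilate k F) v) ser_one w
      = (\<Sum>gs\<in>splits v w. G v * prod_list (map F gs))" if "v \<in> W" for v
    using monomial_eq[of v F w] assms(1) that by (simp add: W_def sum_distrib_left)
  have "(G \<circledast> F) w = (\<Sum>v | v \<in> W \<and> splits v w \<noteq> {}.
      G v * foldr ser_mult (map (\<lambda>k. dilate k F) v) ser_one w)"
    unfolding pleth_def
  proof (rule Sum_any.expand_superset[OF finite_splits_ne], clarify)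
    fix v assume *: "G v * foldr ser_mult (map (\<lambda>k. dilate k F) v) ser_one w \<noteq> 0"
    then have v: "v \<in> W" using assms(2) by fastforce
    show "v \<in> W \<and> splits v w \<noteq> {}" using v * unfolding eq[OF v] by auto
  qed
  then show ?thesis using eq by simp
qed

lemma qscale_zero_left [simp]: "qscale 0 (x :: 'a :: rat_algebra_1) = 0"
  using qscale_add_left[of 0 0 x] by simp

lemma qscale_sum_right: "qscale c (sum f A) = (\<Sum>a\<in>A. qscale c (f a :: 'a :: rat_algebra_1))"
  by (induction A rule: infinite_finite_induct) (simp_all add: qscale_add_right)

lemma qscale_single: "qscale c (Poly_Mapping.single k (d::rat)) = Poly_Mapping.single k (c * d)"
  by (simp add: qscale_poly_mapping_def mult_single qscale_rat_def)

lemma ev2_superset: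
  assumes "finite S" "Poly_Mapping.keys t \<subseteq> S"
  shows "ev2 F G t = (\<Sum>(u, v)\<in>S. qscale (Poly_Mapping.lookup t (u, v))
     (prod_list (map (\<lambda>w. acoeff w G) (letters v)) * prod_list (map (\<lambda>w. acoeff w F) (letters u))))"
  unfolding ev2_def by (rule sum.mono_neutral_left) (use assms in \<open>auto simp: in_keys_iff\<close>)

lemma ev2_add: "ev2 F G (s + t) = ev2 F G s + ev2 F G t"
proof -
  let ?S = "Poly_Mapping.keys s \<union> Poly_Mapping.keys t"
  have "Poly_Mapping.keys (s + t) \<subseteq> ?S" by (rule Poly_Mapping.keys_add)
  then show ?thesis
    by (subst (1 2 3) ev2_superset[of ?S])
      (auto simp: sum.distrib[symmetric] lookup_add qscale_add_left intro!: sum.cong)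
qed

lemma ev2_sum: "ev2 F G (sum f A) = (\<Sum>a\<in>A. ev2 F G (f a))"
  by (induction A rule: infinite_finite_induct) (simp_all add: ev2_add, simp_all add: ev2_def)

lemma ev2_single:
  "ev2 F G (Poly_Mapping.single (u, v) c) = qscale c
     (prod_list (map (\<lambda>w. acoeff w G) (letters v)) * prod_list (map (\<lambda>w. acoeff w F) (letters u)))"
  by (subst ev2_superset[of "{(u, v)}"]) auto

lemma smult_single: "smult x (Poly_Mapping.single k y) = Poly_Mapping.single k (x * y)"
  by (rule poly_mapping_eqI) (simp add: smult_def Poly_Mapping.map.rep_eq lookup_single when_def)

lemma smult_zero [simp]: "smult x 0 = 0"
  by (rule poly_mapping_eqI) (simp add: smult_def Poly_Mapping.map.rep_eq)

lemma tensor_single: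
  "tensor (Poly_Mapping.single a c) (Poly_Mapping.single b d) = Poly_Mapping.single (a, b) (c * d)"
  by (cases "c = 0"; cases "d = 0") (simp_all add: tensor_def lin_ext_def smult_single)

lemma wfact_nz: "wfact w \<noteq> 0"
  by (induction w) (auto simp: wfact_def)

lemma prod_gen:
  assumes "set gs \<subseteq> W"
  shows "prod_list (map (series (\<lambda>v. tensor (gen v) 1)) gs)
    = Poly_Mapping.single (Fmon gs, 0 :: nat list fmon) (1 / of_nat (prod_list (map wfact gs)))"
  using assms
proof (induction gs)
  case Nil
  show ?case by (simp flip: zero_fmon_def zero_prod_def)
next
  case (Cons g gs)
  have "tensor (gen g) 1 = Poly_Mapping.single (Fmon [g], 0 :: nat list fmon) 1"
    using tensor_single[of "Fmon [g]" 1 0 1] by (simp add: gen_def)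
  then have "series (\<lambda>v. tensor (gen v) 1) g
      = Poly_Mapping.single (Fmon [g], 0 :: nat list fmon) (1 / of_nat (wfact g))"
    using Cons.prems by (simp add: series_def qscale_single)
  then show ?case using Cons
    by (simp add: mult_single plus_fmon_def zero_fmon_def)
qed

lemma pleth_comult_gen_eq:
  "pleth_comult_gen w = (\<Sum>v | v \<in> W \<and> splits v w \<noteq> {}. \<Sum>gs\<in>splits v w.
     Poly_Mapping.single (Fmon gs, Fmon [v])
       (of_nat (wfact w) / of_nat (wfact v * prod_list (map wfact gs))))"
proof -
  have gv: "tensor 1 (gen v) = Poly_Mapping.single (0, Fmon [v]) 1" for v
    using tensor_single[of 0 1 "Fmon [v]" 1] by (simp add: gen_def)
  show ?thesis unfolding pleth_comult_gen_def acoeff_def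
    apply (subst pleth_eq)
      apply (simp add: series_def)
     apply (simp add: series_def)
    apply (simp only: qscale_sum_right)
    apply (intro sum.cong refl)
    apply (subst prod_gen)
     apply (simp add: splits_def)
    apply (simp add: series_def gv qscale_single mult_single zero_fmon_def plus_fmon_def)
    done
qed

lemma prod_acoeff:
  "prod_list (map (\<lambda>w. acoeff w F) gs) = qscale (of_nat (prod_list (map wfact gs))) (prod_list (map F gs))"
  by (induction gs) (simp_all add: qscale_one acoeff_def qscale_mult_left qscale_mult_right qscale_qscale mult.commute)

lemma ev2_pleth_comult_gen:
  fixes F G :: "'r::rat_algebra_1 ncseries"
  assumes "\<And>v. v \<notin> W \<Longrightarrow> F v = 0" "\<And>v. v \<notin> W \<Longrightarrow> G v = 0"
  shows "ev2 F G (pleth_comult_gen w) = acoeff w (G \<circledast> F)"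
proof -
  have nz: "prod_list (map wfact gs) \<noteq> 0" for gs
    by (induction gs) (simp_all add: wfact_nz)
  have pl: "(G \<circledast> F) w = (\<Sum>v | v \<in> W \<and> splits v w \<noteq> {}. \<Sum>gs\<in>splits v w. G v * prod_list (map F gs))"
    using assms by (rule pleth_eq)
  show ?thesis
    unfolding pleth_comult_gen_eq ev2_sum ev2_single acoeff_def[of w F] acoeff_def[of w "G \<circledast> F"]
      pl qscale_sum_right
    by (intro sum.cong refl)
      (simp add: prod_acoeff acoeff_def[of _ G] qscale_mult_left qscale_mult_right qscale_qscale nz wfact_nz)
qed

end

theory Submission
  imports Defs
begin

text \<open>
  Both bialgebras are incidence bialgebras of one category, whose arrows are the finite lists of words
  of \<open>W\<close>: a list is a layer of corollas, one of arity \<open>length v\<close> for each word \<open>v\<close>, and composition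
  grafts layers, the node \<open>v\<close> with \<open>gs\<close> grafted onto it becoming the concatenation of the words
  \<open>v\<^sub>i g\<^sub>i\<close>. Coassociativity is the associativity of grafting, and multiplicativity of the coproduct holds
  because a factorization of a concatenation splits uniquely. Expanding \<open>G \<circledast> F\<close> gives
  the coproduct as the sum over the factorizations \<open>w = v \<circ> g\<close> with the coefficients
  \<open>w! / (g! v!)\<close>. In the groupoids of the bar construction of \<open>T_M (T_S Sym)\<close> every arrow is an automorphism,
  \<open>X\<^sub>1\<close> has the lists of words \<open>w\<close>, with automorphism groups of order \<open>w!\<close>, as its objects, and \<open>X\<^sub>2\<close> the
  composable pairs. The iterated homotopy fibre over \<open>w\<close>, \<open>g\<close> and \<open>v\<close> therefore has
  cardinality \<open>w! g! v! / (g! v!)\<close> or \<open>0\<close>, which gives the same coefficients.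
\<close>

section \<open>Linear extension\<close>

text \<open>An operation of \<open>TSym\<close> is a tuple of operations of \<open>Sym\<close>, that
  is, a word of arities. Since \<open>M_grpd\<close> never permutes entries, the letters keep their
  order, and the symmetric groups survive only as automorphisms of single letters: the former
  matches noncommuting variables, the latter produces the factorials \<open>wfact\<close>. The
  automorphisms of a two-level forest number g! v! because the unique colour has only its identity,
  so that the arrows at the two levels are chosen independently. Homotopy cardinalities are found
  without determining components. In a finite groupoid the cardinality is the sum over all objects
  of 1 / (number of arrows out of the object), and this number does not change in passing to a
  homotopy fibre. The price is that the faces and the degeneracy involved must be shown to be
  functors between groupoids. The inner face is the obstacle, since it composes permutations. In
  \<open>m((x,...,x);y)\<close> all blocks have the same size, and the block permutation becomes a
  pair of permutations acting on the rows and the columns of a grid.\<close>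

lemma lookup_smult [simp]: "Poly_Mapping.lookup (smult c v) b = c * Poly_Mapping.lookup v b"
  by (simp add: smult_def Poly_Mapping.map.rep_eq when_def)

lemma smult_add_right: "smult c (v + w) = smult c v + smult c w"
  by (rule poly_mapping_eqI) (simp add: lookup_add distrib_left)

lemma smult_add_left: "smult (c + d) v = smult c v + smult d v"
  by (rule poly_mapping_eqI) (simp add: lookup_add distrib_right)

lemma smult_smult [simp]: "smult c (smult d v) = smult (c * d) v"
  by (rule poly_mapping_eqI) simp

lemma smult_0_left [simp]: "smult 0 v = 0"
  by (rule poly_mapping_eqI) simp

lemma smult_1 [simp]: "smult 1 v = v"
  by (rule poly_mapping_eqI) simp

lemma smult_sum: "smult c (sum f A) = (\<Sum>a\<in>A. smult c (f a))"
  by (induction A rule: infinite_finite_induct) (simp_all add: smult_add_right)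

lemma keys_smult: "Poly_Mapping.keys (smult c v) \<subseteq> Poly_Mapping.keys v"
  by (auto simp: in_keys_iff)

lemma lin_ext_superset:
  assumes "finite S" "Poly_Mapping.keys v \<subseteq> S"
  shows "lin_ext f v = (\<Sum>b\<in>S. smult (Poly_Mapping.lookup v b) (f b))"
  unfolding lin_ext_def by (rule sum.mono_neutral_left) (use assms in \<open>auto simp: in_keys_iff\<close>)

lemma lin_form_superset:
  assumes "finite S" "Poly_Mapping.keys v \<subseteq> S"
  shows "lin_form f v = (\<Sum>b\<in>S. Poly_Mapping.lookup v b * f b)"
  unfolding lin_form_def by (rule sum.mono_neutral_left) (use assms in \<open>auto simp: in_keys_iff\<close>)

lemma lin_ext_0 [simp]: "lin_ext f 0 = 0"
  by (simp add: lin_ext_def)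

lemma lin_form_0 [simp]: "lin_form f 0 = 0"
  by (simp add: lin_form_def)

lemma lin_ext_add: "lin_ext f (v + w) = lin_ext f v + lin_ext f w"
proof -
  let ?S = "Poly_Mapping.keys v \<union> Poly_Mapping.keys w"
  have "Poly_Mapping.keys (v + w) \<subseteq> ?S" by (rule Poly_Mapping.keys_add)
  then show ?thesis
    by (subst (1 2 3) lin_ext_superset[of ?S])
      (auto simp: sum.distrib[symmetric] lookup_add smult_add_left intro!: sum.cong)
qed

lemma lin_form_add: "lin_form f (v + w) = lin_form f v + lin_form f w"
proof -
  let ?S = "Poly_Mapping.keys v \<union> Poly_Mapping.keys w"
  have "Poly_Mapping.keys (v + w) \<subseteq> ?S" by (rule Poly_Mapping.keys_add)
  then show ?thesis
    by (subst (1 2 3) lin_form_superset[of ?S])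
      (auto simp: sum.distrib[symmetric] lookup_add distrib_right intro!: sum.cong)
qed

lemma lin_ext_smult: "lin_ext f (smult c v) = smult c (lin_ext f v)"
  by (subst (1 2) lin_ext_superset[of "Poly_Mapping.keys v"]) (auto simp: keys_smult[THEN subsetD] smult_sum)

lemma lin_form_smult: "lin_form f (smult c v) = c * lin_form f v"
  by (subst (1 2) lin_form_superset[of "Poly_Mapping.keys v"])
    (auto simp: keys_smult[THEN subsetD] sum_distrib_left mult.assoc)

lemma lin_ext_sum: "lin_ext f (sum g A) = (\<Sum>a\<in>A. lin_ext f (g a))"
  by (induction A rule: infinite_finite_induct) (simp_all add: lin_ext_add)

lemma lin_form_sum: "lin_form f (sum g A) = (\<Sum>a\<in>A. lin_form f (g a))"
  by (induction A rule: infinite_finite_induct) (simp_all add: lin_form_add)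

lemma lin_ext_single [simp]: "lin_ext f (Poly_Mapping.single b c) = smult c (f b)"
  by (cases "c = 0") (simp_all add: lin_ext_def)

lemma lin_form_single [simp]: "lin_form f (Poly_Mapping.single b c) = c * f b"
  by (cases "c = 0") (simp_all add: lin_form_def)

lemma lin_ext_cong: "(\<And>b. b \<in> Poly_Mapping.keys v \<Longrightarrow> f b = g b) \<Longrightarrow> lin_ext f v = lin_ext g v"
  by (simp add: lin_ext_def)

lemma lin_form_cong: "(\<And>b. b \<in> Poly_Mapping.keys v \<Longrightarrow> f b = g b) \<Longrightarrow> lin_form f v = lin_form g v"
  by (simp add: lin_form_def)

text \<open>Collapsing a composite into a single linear extension leaves maps that can be compared
  on basis vectors; identities of linear maps below are reduced to the basis in this way.\<close>

lemma lin_ext_comp: "lin_ext g (lin_ext f v) = lin_ext (\<lambda>b. lin_ext g (f b)) v"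
  by (simp add: lin_ext_def[of f] lin_ext_def[of "\<lambda>b. lin_ext g (f b)"] lin_ext_sum lin_ext_smult)

lemma lin_form_lin_ext: "lin_form g (lin_ext f v) = lin_form (\<lambda>b. lin_form g (f b)) v"
  by (simp add: lin_ext_def lin_form_def[of "\<lambda>b. lin_form g (f b)"] lin_form_sum lin_form_smult)

lemma lin_ext_add_fun: "lin_ext (\<lambda>b. f b + g b) v = lin_ext f v + lin_ext g v"
  by (simp add: lin_ext_def smult_add_right sum.distrib)

lemma lin_ext_smult_fun: "lin_ext (\<lambda>b. smult c (f b)) v = smult c (lin_ext f v)"
  by (simp add: lin_ext_def smult_sum mult.commute)

lemma lin_ext_zero_fun [simp]: "lin_ext (\<lambda>_. 0) v = 0"
  by (rule poly_mapping_eqI) (simp add: lin_ext_def lookup_sum)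

lemma lin_ext_sum_fun: "lin_ext (\<lambda>b. \<Sum>a\<in>A. f a b) v = (\<Sum>a\<in>A. lin_ext (f a) v)"
  by (induction A rule: infinite_finite_induct) (simp_all add: lin_ext_add_fun)

text \<open>Used for the compatibility of product and coproduct, where the sum over the right factor
  has to move past the coproduct of the left one.\<close>

lemma lin_ext_swap: "lin_ext (\<lambda>a. lin_ext (f a) w) v = lin_ext (\<lambda>b. lin_ext (\<lambda>a. f a b) v) w"
  by (simp add: lin_ext_def[of _ w] lin_ext_sum_fun lin_ext_smult_fun)

lemma lin_ext_delta: "lin_ext delta v = v"
  by (rule poly_mapping_eqI)
    (auto simp: lin_ext_def smult_single lookup_sum lookup_single when_def in_keys_iff)

lemma span_of_0 [simp]: "0 \<in> span_of B"
  by (simp add: span_of_def)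

lemma span_of_add: "v \<in> span_of B \<Longrightarrow> w \<in> span_of B \<Longrightarrow> v + w \<in> span_of B"
  unfolding span_of_def using Poly_Mapping.keys_add[of v w] by blast

lemma span_of_smult: "v \<in> span_of B \<Longrightarrow> smult c v \<in> span_of B"
  unfolding span_of_def using keys_smult[of c v] by blast

lemma span_of_sum: "(\<And>a. a \<in> A \<Longrightarrow> f a \<in> span_of B) \<Longrightarrow> sum f A \<in> span_of B"
  by (induction A rule: infinite_finite_induct) (simp_all add: span_of_add)

lemma span_of_single: "b \<in> B \<Longrightarrow> Poly_Mapping.single b c \<in> span_of B"
  by (simp add: span_of_def)

lemma keys_in_span: "v \<in> span_of B \<Longrightarrow> b \<in> Poly_Mapping.keys v \<Longrightarrow> b \<in> B"
  by (auto simp: span_of_def)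

lemma lin_ext_in_span:
  "v \<in> span_of B \<Longrightarrow> (\<And>b. b \<in> B \<Longrightarrow> f b \<in> span_of C) \<Longrightarrow> lin_ext f v \<in> span_of C"
  unfolding lin_ext_def by (intro span_of_sum span_of_smult) (auto dest: keys_in_span)

lemma lin_ext_cong_span:
  "v \<in> span_of B \<Longrightarrow> (\<And>b. b \<in> B \<Longrightarrow> f b = g b) \<Longrightarrow> lin_ext f v = lin_ext g v"
  by (rule lin_ext_cong) (auto dest: keys_in_span)

lemma lin_form_cong_span:
  "v \<in> span_of B \<Longrightarrow> (\<And>b. b \<in> B \<Longrightarrow> f b = g b) \<Longrightarrow> lin_form f v = lin_form g v"
  by (rule lin_form_cong) (auto dest: keys_in_span)

lemma linear_on_lin_ext: "linear_on B (lin_ext f)"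
  by (simp add: linear_on_def lin_ext_add lin_ext_smult)

section \<open>Grafting words\<close>

text \<open>The composite of the operation \<open>v\<close> with the operations \<open>gs\<close> on
  its inputs: composition in \<open>T_S Sym\<close> multiplies arities, hence the scaling by
  \<open>k\<close>. In plethysm the same scaling is the dilation of the variables, and the formula
  is the one in \<open>splits\<close>.\<close>

definition layer :: "nat list \<Rightarrow> nat list list \<Rightarrow> nat list" where
  "layer v gs = concat (map2 (\<lambda>k g. map ((*) k) g) v gs)"

text \<open>A list of words is a layer of a forest, in which a word \<open>v\<close> is a node of arity \<open>length v\<close>;
  \<open>graft vs gs\<close> is meaningful only if the inputs of \<open>vs\<close> are as many as the nodes \<open>gs\<close>.\<close>

primrec graft :: "nat list list \<Rightarrow> nat list list \<Rightarrow> nat list list" where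
  "graft [] gs = []"
| "graft (v # vs) gs = layer v (take (length v) gs) # graft vs (drop (length v) gs)"

abbreviation arity :: "nat list list \<Rightarrow> nat" where
  "arity vs \<equiv> length (concat vs)"

lemma layer_Nil [simp]: "layer [] gs = []"
  by (simp add: layer_def)

lemma layer_Cons [simp]: "layer (k # v) (g # gs) = map ((*) k) g @ layer v gs"
  by (simp add: layer_def)

lemma layer_append:
  "length v = length gs \<Longrightarrow> layer (v @ v') (gs @ gs') = layer v gs @ layer v' gs'"
  by (simp add: layer_def)

lemma length_layer: "length v = length gs \<Longrightarrow> length (layer v gs) = arity gs"
  by (induction v gs rule: list_induct2) simp_all

text \<open>Dilations compose, \<open>k * (l * j) = (k * l) * j\<close>; this is the arithmetic
  behind the associativity of grafting.\<close>

lemma map_layer: "length v = length gs \<Longrightarrow> map ((*) k) (layer v gs) = layer (map ((*) k) v) gs"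
  by (induction v gs rule: list_induct2) (simp_all add: mult.assoc)

lemma graft_append:
  "arity vs = length gs \<Longrightarrow> graft (vs @ vs') (gs @ gs') = graft vs gs @ graft vs' gs'"
  by (induction vs arbitrary: gs) auto

lemma length_graft [simp]: "length (graft vs gs) = length vs"
  by (induction vs arbitrary: gs) auto

lemma arity_graft: "arity vs = length gs \<Longrightarrow> arity (graft vs gs) = arity gs"
proof (induction vs arbitrary: gs)
  case Nil
  then show ?case by simp
next
  case (Cons v vs)
  have "arity gs = arity (take (length v) gs) + arity (drop (length v) gs)"
    by (simp flip: length_append concat_append)
  then show ?case using Cons by (simp add: length_layer)
qed

text \<open>Associativity over a single root. The induction peels off one node \<open>h\<close> of
  the middle layer together with the \<open>length h\<close> nodes of \<open>gs\<close> that sit on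
  it.\<close>

lemma layer_layer:
  assumes "length u = length hs" "arity hs = length gs"
  shows "layer (layer u hs) gs = layer u (graft hs gs)"
  using assms
proof (induction u hs arbitrary: gs rule: list_induct2)
  case Nil
  then show ?case by simp
next
  case (Cons k u h hs)
  let ?g = "take (length h) gs" and ?g' = "drop (length h) gs"
  have "layer (layer (k # u) (h # hs)) (?g @ ?g') = layer (map ((*) k) h) ?g @ layer (layer u hs) ?g'"
    using Cons.prems by (simp add: layer_append del: append_take_drop_id)
  then show ?case using Cons by (simp add: map_layer)
qed

lemma graft_assoc:
  assumes "arity us = length hs" "arity hs = length gs"
  shows "graft (graft us hs) gs = graft us (graft hs gs)"
  using assms
proof (induction us arbitrary: hs gs)
  case Nil
  then show ?case by simp
next
  case (Cons u us)
  \<comment> \<open>\<open>h\<close> are the nodes sitting on the root \<open>u\<close>, and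
    \<open>g\<close> those sitting on \<open>h\<close>; each layer is cut by counting the inputs of
    the layer below.\<close>
  define h h' where "h = take (length u) hs" and "h' = drop (length u) hs"
  define g g' where "g = take (arity h) gs" and "g' = drop (arity h) gs"
  have eq: "hs = h @ h'" "gs = g @ g'" by (simp_all add: h_def h'_def g_def g'_def)
  have len1: "length u = length h" "arity us = length h'"
    using Cons.prems(1) by (simp_all add: h_def h'_def)
  have "arity h + arity h' = length gs"
    using Cons.prems(2) by (simp add: eq(1))
  then have len2: "arity h = length g" "arity h' = length g'"
    by (simp_all add: g_def g'_def)
  show ?case
    using Cons.IH[OF len1(2) len2(2)] len1 len2 unfolding eq
    by (simp add: graft_append layer_layer length_layer)
qed

lemma layer_closed:
  assumes "v \<in> W" "gs \<in> lists W" "length v = length gs"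
  shows "layer v gs \<in> W"
proof -
  have "\<forall>i\<in>set (layer v gs). 0 < i"
    if "length v = length gs" "\<forall>i\<in>set v. 0 < i" "\<forall>g\<in>set gs. \<forall>i\<in>set g. 0 < i" for v gs
    using that by (induction v gs rule: list_induct2) auto
  then have "\<forall>i\<in>set (layer v gs). 0 < i"
    using assms by (auto simp: W_def)
  moreover have "layer v gs \<noteq> []"
    using assms by (cases v; cases gs) (auto simp: W_def)
  ultimately show ?thesis by (simp add: W_def)
qed

lemma graft_closed:
  "vs \<in> lists W \<Longrightarrow> gs \<in> lists W \<Longrightarrow> arity vs = length gs \<Longrightarrow> graft vs gs \<in> lists W"
proof (induction vs arbitrary: gs)
  case Nil
  then show ?case by simp
next
  case (Cons v vs)
  have "take (length v) gs \<in> lists W" "drop (length v) gs \<in> lists W"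
    using Cons.prems(2) by (auto simp: lists_eq_set dest: in_set_takeD in_set_dropD)
  then show ?case
    using Cons by (simp add: layer_closed)
qed

text \<open>The leaf layer comes first, in agreement with the order of the faces (d_2, d_0) and with
  the tensor factor that carries the coefficients of the inner series \<open>F\<close>.\<close>

definition factorizations :: "nat list list \<Rightarrow> (nat list list \<times> nat list list) set" where
  "factorizations ws = {(gs, vs). gs \<in> lists W \<and> vs \<in> lists W \<and> arity vs = length gs \<and> graft vs gs = ws}"

definition wsfact :: "nat list list \<Rightarrow> nat" where
  "wsfact ws = prod_list (map wfact ws)"

text \<open>The numerator is the factorial of the composite, so that the weights of successive
  factorizations telescope.\<close>

definition weight :: "nat list list \<Rightarrow> nat list list \<Rightarrow> rat" where
  "weight gs vs = of_nat (wsfact (graft vs gs)) / of_nat (wsfact gs * wsfact vs)"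

lemma wsfact_nz [simp]: "wsfact ws \<noteq> 0"
  by (induction ws) (simp_all add: wsfact_def wfact_nz)

lemma wsfact_append: "wsfact (us @ ws) = wsfact us * wsfact ws"
  by (simp add: wsfact_def)

lemma factorizations_Nil: "factorizations [] = {([], [])}"
proof -
  have "vs = []" if "graft vs gs = []" for vs gs
    using length_graft[of vs gs] that by simp
  then show ?thesis by (fastforce simp: factorizations_def)
qed

text \<open>The point where grafting and substitution meet: each pair stands for one term, a
  coefficient of \<open>G\<close> at \<open>v\<close> times coefficients of \<open>F\<close> at the
  entries of \<open>gs\<close>, in the coefficient of \<open>w\<close> of the plethysm.\<close>

lemma factorizations_single:
  "factorizations [w] = {(gs, [v]) | gs v. v \<in> W \<and> gs \<in> splits v w}"
  (is "_ = ?R")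
proof (intro set_eqI iffI)
  fix p assume "p \<in> factorizations [w]"
  then obtain gs vs where p: "p = (gs, vs)" "gs \<in> lists W" "vs \<in> lists W" "arity vs = length gs"
    "graft vs gs = [w]" by (auto simp: factorizations_def)
  have "length vs = 1" using length_graft[of vs gs] p(5) by simp
  then obtain v where "vs = [v]" by (auto simp: length_Suc_conv)
  then show "p \<in> ?R" using p by (auto simp: splits_def layer_def)
next
  fix p assume "p \<in> ?R"
  then show "p \<in> factorizations [w]"
    by (auto simp: factorizations_def splits_def layer_def)
qed

lemma factorizations_append:
  "factorizations (us @ ws) = (\<lambda>((gs, vs), (gs', vs')). (gs @ gs', vs @ vs')) `
     (factorizations us \<times> factorizations ws)" (is "_ = ?f ` _")
proof (intro set_eqI iffI)
  fix p assume "p \<in> factorizations (us @ ws)"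
  then obtain gs vs where p: "p = (gs, vs)" "gs \<in> lists W" "vs \<in> lists W" "arity vs = length gs"
    "graft vs gs = us @ ws" by (auto simp: factorizations_def)
  \<comment> \<open>Grafting preserves the number of roots, which forces the cut of
    \<open>vs\<close>; the arity of the first piece then forces the cut of
    \<open>gs\<close>.\<close>
  define v v' where "v = take (length us) vs" and "v' = drop (length us) vs"
  define g g' where "g = take (arity v) gs" and "g' = drop (arity v) gs"
  have eq: "vs = v @ v'" "gs = g @ g'" by (simp_all add: v_def v'_def g_def g'_def)
  have "length vs = length us + length ws" using length_graft[of vs gs] p(5) by simp
  then have lenv: "length v = length us" by (simp add: v_def)
  have "arity v + arity v' = length gs" using p(4) by (simp add: eq(1))
  then have leng: "arity v = length g" "arity v' = length g'" by (simp_all add: g_def g'_def)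
  have "graft v g @ graft v' g' = us @ ws"
    using p(5) unfolding eq by (simp add: graft_append leng)
  then have "graft v g = us" "graft v' g' = ws" by (simp_all add: lenv)
  then have "(g, v) \<in> factorizations us" "(g', v') \<in> factorizations ws"
    using p(2,3) leng unfolding eq by (simp_all add: factorizations_def)
  then show "p \<in> ?f ` (factorizations us \<times> factorizations ws)"
    unfolding p(1) eq by force
next
  fix p assume "p \<in> ?f ` (factorizations us \<times> factorizations ws)"
  then show "p \<in> factorizations (us @ ws)"
    by (auto simp: factorizations_def graft_append)
qed

lemma inj_on_append_factorizations:
  "inj_on (\<lambda>((gs, vs), (gs', vs')). (gs @ gs', vs @ vs')) (factorizations us \<times> factorizations ws)"
proof -
  have key: "g = h \<and> v = u \<and> g' = h' \<and> v' = u'"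
    if *: "(g, v) \<in> factorizations us" "(h, u) \<in> factorizations us" "v @ v' = u @ u'" "g @ g' = h @ h'"
    for g v g' v' h u h' u'
  proof -
  \<comment> \<open>Both \<open>v\<close> and \<open>u\<close> have as many roots as
    \<open>us\<close>.\<close>
  have "length v = length u" using * by (auto simp: factorizations_def dest: arg_cong[of _ _ length])
  then have uv: "v = u" "v' = u'" using *(3) by auto
  then have "length g = length h" using *(1,2) by (auto simp: factorizations_def)
  then have "g = h" "g' = h'" using *(4) by auto
  with uv show ?thesis by simp
  qed
  show ?thesis
  proof (rule inj_onI)
    fix p q assume *: "p \<in> factorizations us \<times> factorizations ws" "q \<in> factorizations us \<times> factorizations ws"
      "(\<lambda>((gs, vs), (gs', vs')). (gs @ gs', vs @ vs')) p = (\<lambda>((gs, vs), (gs', vs')). (gs @ gs', vs @ vs')) q"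
    obtain g v g' v' h u h' u' where "p = ((g, v), (g', v'))" "q = ((h, u), (h', u'))"
      by (metis surj_pair)
    then show "p = q" using * key[of g v h u v' u' g' h'] by simp
  qed
qed

lemma finite_factorizations: "finite (factorizations ws)"
proof (induction ws)
  case Nil
  then show ?case by (simp add: factorizations_Nil)
next
  case (Cons w ws)
  have "factorizations [w] \<subseteq> (\<Union>v\<in>{v\<in>W. splits v w \<noteq> {}}. splits v w \<times> {[v]})"
    by (auto simp: factorizations_single)
  moreover have "finite (\<Union>v\<in>{v\<in>W. splits v w \<noteq> {}}. splits v w \<times> {[v]})"
    using finite_splits_ne[of w] by (intro finite_UN_I) (auto intro: finite_splits simp: W_def)
  ultimately have "finite (factorizations [w])" by (rule finite_subset)
  with Cons show ?case using factorizations_append[of "[w]" ws] by simp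
qed

section \<open>Layers of units\<close>

abbreviation units :: "nat \<Rightarrow> nat list list" where
  "units n \<equiv> replicate n [1]"

lemma layer_unit_left: "layer [Suc 0] [g] = g"
  by (simp add: map_idI)

lemma layer_unit_right: "layer g (replicate (length g) [Suc 0]) = g"
  by (induction g) simp_all

lemma graft_unit_left: "graft (units (length gs)) gs = gs"
  by (induction gs) (auto simp: layer_unit_left simp del: layer_Cons)

lemma graft_unit_right: "graft vs (units (arity vs)) = vs"
  by (induction vs) (simp_all add: layer_unit_right replicate_add)

lemma units_in_lists: "units n \<in> lists W"
  by (auto simp: W_def)

lemma wsfact_units [simp]: "wsfact (units n) = 1"
  by (induction n) (simp_all add: wsfact_def wfact_def)

lemma arity_units [simp]: "arity (units n) = n"
  by (induction n) simp_all

lemma unit_words_eq: "set ws \<subseteq> {[1]} \<Longrightarrow> units (length ws) = ws"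
  by (rule replicate_length_same) auto

text \<open>The counit is supported on lists of the word \<open>[1]\<close>. That a single
  factorization has such a leaf layer is the left counit law; its companion for the root layer is
  the right one.\<close>

lemma factorizations_unit_left:
  assumes "ws \<in> lists W"
  shows "{p \<in> factorizations ws. set (fst p) \<subseteq> {[1]}} = {(units (arity ws), ws)}"
proof -
  have key: "gs = units (arity ws) \<and> vs = ws"
    if "(gs, vs) \<in> factorizations ws" "set gs \<subseteq> {[1]}" for gs vs
  proof -
    have *: "arity vs = length gs" "graft vs gs = ws" using that(1) by (auto simp: factorizations_def)
    have gs: "gs = units (arity vs)" using unit_words_eq[OF that(2)] unfolding *(1) by (rule sym)
    have "vs = ws" using *(2) unfolding gs graft_unit_right .
    with gs show ?thesis by blast
  qed
  have mem: "(units (arity ws), ws) \<in> factorizations ws"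
    using assms units_in_lists graft_unit_right arity_units by (simp add: factorizations_def)
  show ?thesis
  proof (intro subset_antisym subsetI)
    fix p assume "p \<in> {p \<in> factorizations ws. set (fst p) \<subseteq> {[1]}}"
    then show "p \<in> {(units (arity ws), ws)}" using key[of "fst p" "snd p"] by (simp add: prod_eq_iff)
  next
    fix p assume "p \<in> {(units (arity ws), ws)}"
    then show "p \<in> {p \<in> factorizations ws. set (fst p) \<subseteq> {[1]}}" using mem by auto
  qed
qed

lemma factorizations_unit_right:
  assumes "ws \<in> lists W"
  shows "{p \<in> factorizations ws. set (snd p) \<subseteq> {[1]}} = {(ws, units (length ws))}"
proof -
  have key: "gs = ws \<and> vs = units (length ws)"
    if "(gs, vs) \<in> factorizations ws" "set vs \<subseteq> {[1]}" for gs vs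
  proof -
    have *: "arity vs = length gs" "graft vs gs = ws" using that(1) by (auto simp: factorizations_def)
    have "length vs = arity (units (length vs))" by (rule arity_units[symmetric])
    also have "\<dots> = length gs" unfolding unit_words_eq[OF that(2)] by (rule *(1))
    finally have vs: "vs = units (length gs)" using unit_words_eq[OF that(2)] by simp
    have "gs = ws" using *(2) unfolding vs graft_unit_left .
    with vs show ?thesis by blast
  qed
  have mem: "(ws, units (length ws)) \<in> factorizations ws"
    using assms units_in_lists graft_unit_left arity_units by (simp add: factorizations_def)
  show ?thesis
  proof (intro subset_antisym subsetI)
    fix p assume "p \<in> {p \<in> factorizations ws. set (snd p) \<subseteq> {[1]}}"
    then show "p \<in> {(ws, units (length ws))}" using key[of "fst p" "snd p"] by (simp add: prod_eq_iff)
  next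
    fix p assume "p \<in> {(ws, units (length ws))}"
    then show "p \<in> {p \<in> factorizations ws. set (snd p) \<subseteq> {[1]}}" using mem by auto
  qed
qed

text \<open>Both sides parametrize the triples of composable layers: this is coassociativity.\<close>

lemma factorizations_assoc:
  "bij_betw (\<lambda>((g, v), (a, b)). ((a, graft v b), (b, v)))
     (SIGMA p:factorizations ws. factorizations (fst p))
     (SIGMA p:factorizations ws. factorizations (snd p))" (is "bij_betw ?f ?A ?B")
proof (rule bij_betw_byWitness[where f' = "\<lambda>((a, v), (b, c)). ((graft b a, c), (a, b))"])
  let ?g = "\<lambda>((a, v), (b, c)). ((graft b a, c), (a, b))"
  have "g = graft b a \<and> ?f ((g, v), (a, b)) \<in> ?B" if "((g, v), (a, b)) \<in> ?A" for g v a b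
  proof -
    from that have *: "v \<in> lists W" "arity v = length g" "graft v g = ws"
      "a \<in> lists W" "b \<in> lists W" "arity b = length a" "graft b a = g"
      by (auto simp: factorizations_def)
    \<comment> \<open>\<open>g\<close> is \<open>graft b a\<close>, which has as many nodes as
      \<open>b\<close>.\<close>
    have "arity v = length b" using *(2,7) by auto
    then show ?thesis
      using * graft_assoc[of v b a] arity_graft[of v b] graft_closed[of v b]
      by (simp add: factorizations_def)
  qed
  then show "\<forall>x\<in>?A. ?g (?f x) = x" "?f ` ?A \<subseteq> ?B"
    by auto
  have "v = graft c b \<and> ?g ((a, v), (b, c)) \<in> ?A" if "((a, v), (b, c)) \<in> ?B" for a v b c
  proof -
    from that have *: "a \<in> lists W" "arity v = length a" "graft v a = ws"
      "b \<in> lists W" "c \<in> lists W" "arity c = length b" "graft c b = v"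
      by (auto simp: factorizations_def)
    have "arity b = length a" using *(2,6,7) arity_graft[of c b] by simp
    then show ?thesis
      using * graft_assoc[of c b a] graft_closed[of b a]
      by (simp add: factorizations_def)
  qed
  then show "\<forall>x\<in>?B. ?f (?g x) = x" "?g ` ?B \<subseteq> ?A"
    by auto
qed

section \<open>The bialgebra of factorizations of words\<close>

definition forests :: "nat list list set" where
  "forests = lists W"

lemma Nil_forests [simp]: "[] \<in> forests"
  by (simp add: forests_def)

lemma append_forests [simp]: "us @ ws \<in> forests \<longleftrightarrow> us \<in> forests \<and> ws \<in> forests"
  by (auto simp: forests_def)

lemma in_factorizations:
  "(gs, vs) \<in> factorizations ws \<longleftrightarrow> gs \<in> forests \<and> vs \<in> forests \<and> arity vs = length gs \<and> graft vs gs = ws"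
  by (simp add: factorizations_def forests_def)

lemma lin_form_mult_fun: "lin_form (\<lambda>b. c * f b) v = c * lin_form f v"
  by (simp add: lin_form_def sum_distrib_left mult.left_commute)

lemma lin_form_mult_fun_right: "lin_form (\<lambda>b. f b * c) v = lin_form f v * c"
  by (simp add: lin_form_def sum_distrib_right mult.assoc)

lemma wsfact_simps: "wsfact [] = 1" "wsfact (w # ws) = wfact w * wsfact ws"
  by (simp_all add: wsfact_def)

text \<open>A bialgebra whose basis is a copy of the forests under the injection
  \<open>\<beta>\<close> and whose structure constants are those of grafting. The maps
  \<open>m\<close>, \<open>D\<close> and \<open>e\<close> are controlled only on this copy, which is
  why equations are proved on the span of the basis.\<close>

locale word_bialgebra =
  fixes H :: "'b balg" and \<beta> :: "nat list list \<Rightarrow> 'b"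
    and m :: "'b \<Rightarrow> 'b \<Rightarrow> 'b" and D :: "'b \<Rightarrow> 'b \<times> 'b \<Rightarrow>\<^sub>0 rat" and e :: "'b \<Rightarrow> rat"
  assumes inj: "inj_on \<beta> (forests)"
    and basis: "basis H = \<beta> ` forests"
    and bone: "bone H = delta (\<beta> [])"
    and bmult: "bmult H v w = lin_ext (\<lambda>a. lin_ext (\<lambda>b. delta (m a b)) w) v"
    and comult: "comult H = lin_ext D"
    and counit: "counit H = lin_form e"
    and m: "us \<in> forests \<Longrightarrow> ws \<in> forests \<Longrightarrow> m (\<beta> us) (\<beta> ws) = \<beta> (us @ ws)"
    and D: "ws \<in> forests \<Longrightarrow> D (\<beta> ws) =
      (\<Sum>(gs, vs)\<in>factorizations ws. Poly_Mapping.single (\<beta> gs, \<beta> vs) (weight gs vs))"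
    and e: "ws \<in> forests \<Longrightarrow> e (\<beta> ws) = (if set ws \<subseteq> {[1]} then 1 else 0)"
begin

lemma span_cong:
  assumes "v \<in> span_of (basis H)" "\<And>ws. ws \<in> forests \<Longrightarrow> f (\<beta> ws) = g (\<beta> ws)"
  shows "lin_ext f v = lin_ext g v"
  using assms(1) by (rule lin_ext_cong_span) (auto simp: basis assms(2))

lemma span_form_cong:
  assumes "v \<in> span_of (basis H)" "\<And>ws. ws \<in> forests \<Longrightarrow> f (\<beta> ws) = g (\<beta> ws)"
  shows "lin_form f v = lin_form g v"
  using assms(1) by (rule lin_form_cong_span) (auto simp: basis assms(2))

lemma bmult_delta:
  "us \<in> forests \<Longrightarrow> ws \<in> forests \<Longrightarrow> bmult H (delta (\<beta> us)) (delta (\<beta> ws)) = delta (\<beta> (us @ ws))"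
  by (simp add: bmult m)

lemma bmult_closed:
  assumes "v \<in> span_of (basis H)" "w \<in> span_of (basis H)"
  shows "bmult H v w \<in> span_of (basis H)"
  unfolding bmult using assms
  by (intro lin_ext_in_span[OF assms(1)] lin_ext_in_span[OF assms(2)] span_of_single) (auto simp: basis m)

lemma comult_closed:
  assumes "v \<in> span_of (basis H)"
  shows "comult H v \<in> span_of (basis H \<times> basis H)"
  unfolding comult using assms
  by (rule lin_ext_in_span) (auto simp: basis D in_factorizations intro!: span_of_sum span_of_single)

lemma bmult_assoc:
  assumes "u \<in> span_of (basis H)" "v \<in> span_of (basis H)" "w \<in> span_of (basis H)"
  shows "bmult H (bmult H u v) w = bmult H u (bmult H v w)"
  unfolding bmult lin_ext_comp lin_ext_single smult_1
  by (intro span_cong assms) (simp add: m)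

lemma bmult_unit:
  assumes "v \<in> span_of (basis H)"
  shows "bmult H (bone H) v = v" "bmult H v (bone H) = v"
proof -
  have "lin_ext (\<lambda>b. delta (m (\<beta> []) b)) v = lin_ext delta v" "lin_ext (\<lambda>a. delta (m a (\<beta> []))) v = lin_ext delta v"
    using assms by (auto intro!: span_cong simp: m)
  then show "bmult H (bone H) v = v" "bmult H v (bone H) = v"
    by (simp_all add: bmult bone lin_ext_delta)
qed

text \<open>The weights telescope: composable layers \<open>a\<close>, \<open>b\<close>,
  \<open>c\<close> receive \<open>w! / (a! b! c!)\<close> from either bracketing. What remains is
  the reindexing by \<open>factorizations_assoc\<close>.\<close>

lemma coassoc_gen:
  assumes "ws \<in> forests"
  shows "lin_ext (\<lambda>((a, b), c). delta (a, (b, c))) (tensor_map (comult H) id (D (\<beta> ws)))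
    = tensor_map id (comult H) (D (\<beta> ws))"
proof -
  let ?s = "\<lambda>a b c. Poly_Mapping.single (\<beta> a, \<beta> b, \<beta> c) (of_nat (wsfact ws) / of_nat (wsfact a * wsfact b * wsfact c))"
  have D': "D (\<beta> gs) = (\<Sum>p\<in>factorizations gs. Poly_Mapping.single (\<beta> (fst p), \<beta> (snd p)) (weight (fst p) (snd p)))"
    if "gs \<in> forests" for gs
    using D[OF that] by (simp add: case_prod_beta)
  have in1: "fst p \<in> forests" "snd p \<in> forests" "graft (snd p) (fst p) = gs" if "p \<in> factorizations gs" for p gs
    using that by (cases p, simp add: in_factorizations)+
  have "lin_ext (\<lambda>((a, b), c). delta (a, (b, c))) (tensor_map (comult H) id (D (\<beta> ws)))
    = (\<Sum>p\<in>factorizations ws. \<Sum>q\<in>factorizations (fst p). ?s (fst q) (snd q) (snd p))"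
    unfolding D'[OF assms] tensor_map_def lin_ext_sum lin_ext_single comult
    by (intro sum.cong refl)
      (simp add: in1 D' tensor_def lin_ext_sum lin_ext_smult smult_sum smult_single weight_def mult.commute mult.left_commute cong: sum.cong)
  also have "\<dots> = (\<Sum>x\<in>(SIGMA p:factorizations ws. factorizations (fst p)).
      ?s (fst (snd x)) (snd (snd x)) (snd (fst x)))"
    by (simp add: sum.Sigma finite_factorizations case_prod_beta)
  also have "\<dots> = (\<Sum>x\<in>(SIGMA p:factorizations ws. factorizations (snd p)).
      ?s (fst (fst x)) (fst (snd x)) (snd (snd x)))"
    by (subst sum.reindex_bij_betw[OF factorizations_assoc, symmetric]) (simp add: case_prod_beta)
  also have "\<dots> = (\<Sum>p\<in>factorizations ws. \<Sum>q\<in>factorizations (snd p). ?s (fst p) (fst q) (snd q))"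
    by (simp add: sum.Sigma finite_factorizations case_prod_beta)
  also have "\<dots> = tensor_map id (comult H) (D (\<beta> ws))"
    unfolding D'[OF assms] tensor_map_def lin_ext_sum lin_ext_single comult
    by (intro sum.cong refl)
      (simp add: in1 D' tensor_def lin_ext_sum lin_ext_smult smult_sum smult_single weight_def mult.commute mult.left_commute cong: sum.cong)
  finally show ?thesis .
qed

text \<open>Only the factorization through a layer of units survives, and its weight is 1 because
  the word \<open>[1]\<close> has factorial 1.\<close>

lemma counit_gen:
  assumes "ws \<in> forests"
  shows "lin_ext (\<lambda>(a, b). smult (counit H (delta a)) (delta b)) (D (\<beta> ws)) = delta (\<beta> ws)"
    and "lin_ext (\<lambda>(a, b). smult (counit H (delta b)) (delta a)) (D (\<beta> ws)) = delta (\<beta> ws)"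
proof -
  let ?s = "\<lambda>a b. Poly_Mapping.single (\<beta> a) (weight (fst b) (snd b))"
  have "lin_ext (\<lambda>(a, b). smult (counit H (delta a)) (delta b)) (D (\<beta> ws))
    = (\<Sum>p\<in>factorizations ws. if set (fst p) \<subseteq> {[1]} then ?s (snd p) p else 0)"
    unfolding D[OF assms] lin_ext_sum
    by (intro sum.cong refl) (auto simp: in_factorizations counit e smult_single split: if_splits)
  also have "\<dots> = (\<Sum>p\<in>{p \<in> factorizations ws. set (fst p) \<subseteq> {[1]}}. ?s (snd p) p)"
    by (simp add: sum.inter_filter finite_factorizations)
  also have "\<dots> = delta (\<beta> ws)"
    unfolding factorizations_unit_left[OF assms[unfolded forests_def]] by (simp add: weight_def graft_unit_right[simplified] wsfact_units[simplified])
  finally show "lin_ext (\<lambda>(a, b). smult (counit H (delta a)) (delta b)) (D (\<beta> ws)) = delta (\<beta> ws)" .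
  have "lin_ext (\<lambda>(a, b). smult (counit H (delta b)) (delta a)) (D (\<beta> ws))
    = (\<Sum>p\<in>factorizations ws. if set (snd p) \<subseteq> {[1]} then ?s (fst p) p else 0)"
    unfolding D[OF assms] lin_ext_sum
    by (intro sum.cong refl) (auto simp: in_factorizations counit e smult_single split: if_splits)
  also have "\<dots> = (\<Sum>p\<in>{p \<in> factorizations ws. set (snd p) \<subseteq> {[1]}}. ?s (fst p) p)"
    by (simp add: sum.inter_filter finite_factorizations)
  also have "\<dots> = delta (\<beta> ws)"
    unfolding factorizations_unit_right[OF assms[unfolded forests_def]] by (simp add: weight_def graft_unit_left[simplified] wsfact_units[simplified])
  finally show "lin_ext (\<lambda>(a, b). smult (counit H (delta b)) (delta a)) (D (\<beta> ws)) = delta (\<beta> ws)" .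
qed

abbreviation mult2 where
  "mult2 t u \<equiv> lin_ext (\<lambda>(a, b). lin_ext (\<lambda>(c, d).
     tensor (bmult H (delta a) (delta c)) (bmult H (delta b) (delta d))) u) t"

text \<open>Factorials are multiplicative and grafting commutes with concatenation, so the weight of
  a concatenated factorization is the product of the weights.\<close>

lemma comult_mult_gen:
  assumes "us \<in> forests" "ws \<in> forests"
  shows "D (\<beta> (us @ ws)) = mult2 (D (\<beta> us)) (D (\<beta> ws))"
proof -
  let ?f = "\<lambda>((gs, vs), (gs', vs')). (gs @ gs', vs @ vs')"
  let ?s = "\<lambda>(gs, vs). Poly_Mapping.single (\<beta> gs, \<beta> vs) (weight gs vs)"
  have "D (\<beta> (us @ ws)) = (\<Sum>x\<in>factorizations us \<times> factorizations ws. ?s (?f x))"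
    using assms
    by (simp only: D append_forests simp_thms factorizations_append sum.reindex[OF inj_on_append_factorizations] o_def)
  also have "\<dots> = (\<Sum>p\<in>factorizations us. \<Sum>q\<in>factorizations ws. ?s (?f (p, q)))"
    by (simp add: sum.cartesian_product case_prod_beta)
  also have "\<dots> = mult2 (D (\<beta> us)) (D (\<beta> ws))"
    unfolding D[OF assms(1)] D[OF assms(2)] lin_ext_sum smult_sum
    by (intro sum.cong refl)
      (auto simp: in_factorizations bmult_delta tensor_single lin_ext_sum smult_sum smult_single
         weight_def wsfact_append graft_append mult.commute mult.left_commute intro!: sum.cong)
  finally show ?thesis .
qed

lemma bialgebra: "bialgebra H"
  unfolding bialgebra_def Let_def
proof (intro conjI ballI allI)
  show "bone H \<in> span_of (basis H)"
    by (auto simp: bone basis intro: span_of_single)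
  show "linear_on (basis H) (bmult H v)" "linear_on (basis H) (\<lambda>w. bmult H w v)" for v
    by (simp_all add: linear_on_def bmult lin_ext_add lin_ext_smult lin_ext_add_fun lin_ext_smult_fun)
  show "linear_on (basis H) (comult H)"
    by (simp add: comult linear_on_lin_ext)
  show "counit H (v + w) = counit H v + counit H w" for v w
    by (simp add: counit lin_form_add)
  show "counit H (smult c v) = c * counit H v" for c v
    by (simp add: counit lin_form_smult)
  show "comult H (bone H) = tensor (bone H) (bone H)"
    by (simp add: comult bone D factorizations_Nil tensor_single weight_def wsfact_def)
  show "counit H (bone H) = 1"
    by (simp add: counit bone e)
  fix v assume v: "v \<in> span_of (basis H)"
  show "bmult H (bone H) v = v" "bmult H v (bone H) = v"
    using bmult_unit[OF v] .
  show "comult H v \<in> span_of (basis H \<times> basis H)"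
    using v by (rule comult_closed)
  show "lin_ext (\<lambda>((a, b), c). delta (a, (b, c))) (tensor_map (comult H) id (comult H v))
      = tensor_map id (comult H) (comult H v)"
    unfolding comult tensor_map_def lin_ext_comp
    \<comment> \<open>Linearity leaves the basis vectors; folding \<open>lin_ext_comp\<close> back
      turns each of them into an instance of \<open>coassoc_gen\<close>.\<close>
    by (rule span_cong[OF v], fold lin_ext_comp, fold tensor_map_def comult) (rule coassoc_gen)
  show "lin_ext (\<lambda>(a, b). smult (counit H (delta a)) (delta b)) (comult H v) = v"
    unfolding comult lin_ext_comp
    by (rule trans[OF span_cong[OF v] lin_ext_delta]) (rule counit_gen)
  show "lin_ext (\<lambda>(a, b). smult (counit H (delta b)) (delta a)) (comult H v) = v"
    unfolding comult lin_ext_comp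
    by (rule trans[OF span_cong[OF v] lin_ext_delta]) (rule counit_gen)
  fix w assume w: "w \<in> span_of (basis H)"
  show "bmult H v w \<in> span_of (basis H)"
    using v w by (rule bmult_closed)
  show "bmult H (bmult H v w) u = bmult H v (bmult H w u)" if "u \<in> span_of (basis H)" for u
    using v w that by (rule bmult_assoc)
  have "comult H (bmult H v w) = lin_ext (\<lambda>a. lin_ext (\<lambda>b. D (m a b)) w) v"
    by (simp add: comult bmult lin_ext_comp)
  also have "\<dots> = lin_ext (\<lambda>a. lin_ext (\<lambda>b. mult2 (D a) (D b)) w) v"
    by (intro span_cong v w) (simp add: m comult_mult_gen)
  also have "\<dots> = mult2 (comult H v) (comult H w)"
    unfolding comult lin_ext_comp
    by (intro lin_ext_cong, subst lin_ext_swap) (simp add: case_prod_beta' lin_ext_comp)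
  finally show "comult H (bmult H v w) = mult2 (comult H v) (comult H w)" .
  have "counit H (bmult H v w) = lin_form (\<lambda>a. lin_form (\<lambda>b. e (m a b)) w) v"
    by (simp add: counit bmult lin_form_lin_ext)
  also have "\<dots> = lin_form (\<lambda>a. lin_form (\<lambda>b. e a * e b) w) v"
    by (intro span_form_cong v w) (simp add: m e)
  also have "\<dots> = counit H v * counit H w"
    by (simp add: counit lin_form_mult_fun lin_form_mult_fun_right)
  finally show "counit H (bmult H v w) = counit H v * counit H w" .
qed

end

text \<open>The isomorphism relabels the basis, \<open>\<beta> ws\<close> becoming
  \<open>\<beta>' ws\<close>. It respects all the structure because the structure constants of both
  sides are indexed by the same forests.\<close>

lemma isomorphic_bialgebras_word:
  assumes "word_bialgebra H \<beta> m D e" "word_bialgebra K \<beta>' m' D' e'"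
  shows "isomorphic_bialgebras H K"
proof -
  interpret H: word_bialgebra H \<beta> m D e by fact
  interpret K: word_bialgebra K \<beta>' m' D' e' by fact
  define \<theta> where "\<theta> b = \<beta>' (inv_into forests \<beta> b)" for b
  define \<theta>' where "\<theta>' b = \<beta> (inv_into forests \<beta>' b)" for b
  have \<theta> [simp]: "\<theta> (\<beta> ws) = \<beta>' ws" "\<theta>' (\<beta>' ws) = \<beta> ws" if "ws \<in> forests" for ws
    using that H.inj K.inj by (simp_all add: \<theta>_def \<theta>'_def)
  define \<phi> where "\<phi> = lin_ext (\<lambda>b. delta (\<theta> b))"
  define \<psi> where "\<psi> = lin_ext (\<lambda>b. delta (\<theta>' b))"
  have "bij_betw \<phi> (span_of (basis H)) (span_of (basis K))"
  proof (rule bij_betw_byWitness[where f' = \<psi>])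
    have "lin_ext (\<lambda>b. delta (\<theta>' (\<theta> b))) v = lin_ext delta v" if "v \<in> span_of (basis H)" for v
      using that by (rule H.span_cong) simp
    then show "\<forall>v\<in>span_of (basis H). \<psi> (\<phi> v) = v"
      by (simp add: \<phi>_def \<psi>_def lin_ext_comp lin_ext_delta)
    have "lin_ext (\<lambda>b. delta (\<theta> (\<theta>' b))) v = lin_ext delta v" if "v \<in> span_of (basis K)" for v
      using that by (rule K.span_cong) simp
    then show "\<forall>v\<in>span_of (basis K). \<phi> (\<psi> v) = v"
      by (simp add: \<phi>_def \<psi>_def lin_ext_comp lin_ext_delta)
    show "\<phi> ` span_of (basis H) \<subseteq> span_of (basis K)" "\<psi> ` span_of (basis K) \<subseteq> span_of (basis H)"
      by (auto simp: \<phi>_def \<psi>_def H.basis K.basis intro!: lin_ext_in_span span_of_single)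
  qed
  moreover have "linear_on (basis H) \<phi>"
    by (simp add: \<phi>_def linear_on_lin_ext)
  moreover have "\<phi> (bone H) = bone K"
    by (simp add: \<phi>_def H.bone K.bone)
  moreover have "\<phi> (bmult H v w) = bmult K (\<phi> v) (\<phi> w)"
    if "v \<in> span_of (basis H)" "w \<in> span_of (basis H)" for v w
    unfolding \<phi>_def H.bmult K.bmult lin_ext_comp lin_ext_single smult_1
    by (intro H.span_cong that) (simp add: H.m K.m)
  moreover have "comult K (\<phi> v) = tensor_map \<phi> \<phi> (comult H v)" if "v \<in> span_of (basis H)" for v
    unfolding \<phi>_def H.comult K.comult tensor_map_def lin_ext_comp lin_ext_single smult_1
    using that by (rule H.span_cong)
      (auto simp: H.D K.D lin_ext_sum in_factorizations tensor_single smult_single intro!: sum.cong)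
  moreover have "counit K (\<phi> v) = counit H v" if "v \<in> span_of (basis H)" for v
    unfolding \<phi>_def H.counit K.counit lin_form_lin_ext
    using that by (rule H.span_form_cong) (simp add: H.e K.e)
  ultimately show ?thesis
    using H.bialgebra K.bialgebra unfolding isomorphic_bialgebras_def bialgebra_iso_def by blast
qed

section \<open>The plethystic bialgebra\<close>

text \<open>Multiplication of finitely supported functions on a monoid is convolution, here brought
  to the form in which \<open>word_bialgebra\<close> expects a product.\<close>

lemma times_eq_lin_ext:
  "v * w = lin_ext (\<lambda>a. lin_ext (\<lambda>b. delta (a + b)) w) (v :: 'a::monoid_add \<Rightarrow>\<^sub>0 rat)"
proof -
  have "v * w = lin_ext delta v * lin_ext delta w"
    by (simp add: lin_ext_delta)
  also have "\<dots> = lin_ext (\<lambda>a. lin_ext (\<lambda>b. delta (a + b)) w) v"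
    unfolding lin_ext_def smult_single sum_product smult_sum by (simp add: mult_single)
  finally show ?thesis .
qed

lemma W_pos: "v \<in> W \<Longrightarrow> k \<in> set v \<Longrightarrow> 0 < k"
  by (simp add: W_def)

text \<open>The coproduct of a generator is a sum over the factorizations of one word, and
  multiplying such sums in the tensor square concatenates the layers in both components. Hence the
  multiplicative extension to a monomial runs over the factorizations of its list of
  letters.\<close>

lemma prod_pleth_comult_gen:
  "prod_list (map pleth_comult_gen ws) =
    (\<Sum>(gs, vs)\<in>factorizations ws. Poly_Mapping.single (Fmon gs, Fmon vs) (weight gs vs))"
proof (induction ws)
  case Nil
  show ?case
    by (simp add: factorizations_Nil weight_def wsfact_def flip: zero_fmon_def zero_prod_def)
next
  case (Cons w ws)
  let ?f = "\<lambda>((gs, vs), (gs', vs')). (gs @ gs', vs @ vs')"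
  let ?s = "\<lambda>(gs, vs). Poly_Mapping.single (Fmon gs, Fmon vs) (weight gs vs)"
  \<comment> \<open>\<open>pleth_comult_gen_eq\<close> sums over the root word first and over its
    splittings second; the pairs are reordered accordingly.\<close>
  have "factorizations [w] = (\<lambda>(v, gs). (gs, [v])) ` (SIGMA v:{v \<in> W. splits v w \<noteq> {}}. splits v w)"
    by (auto simp: factorizations_single)
  then have "(\<Sum>p\<in>factorizations [w]. ?s p) =
      (\<Sum>x\<in>(SIGMA v:{v \<in> W. splits v w \<noteq> {}}. splits v w). ?s ((\<lambda>(v, gs). (gs, [v])) x))"
    by (simp only:) (subst sum.reindex, auto simp: inj_on_def)
  also have "\<dots> = (\<Sum>v | v \<in> W \<and> splits v w \<noteq> {}. \<Sum>gs\<in>splits v w. ?s (gs, [v]))"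
    by (subst sum.Sigma) (use finite_splits_ne in \<open>auto intro!: finite_splits dest: W_pos simp: case_prod_beta\<close>)
  also have "\<dots> = pleth_comult_gen w"
    unfolding pleth_comult_gen_eq
    by (intro sum.cong refl) (auto simp: weight_def wsfact_def splits_def layer_def mult.commute)
  finally have single: "pleth_comult_gen w = (\<Sum>p\<in>factorizations [w]. ?s p)" by simp
  have "prod_list (map pleth_comult_gen (w # ws)) =
      (\<Sum>p\<in>factorizations [w]. ?s p) * (\<Sum>q\<in>factorizations ws. ?s q)"
    using Cons.IH single by simp
  also have "\<dots> = (\<Sum>x\<in>factorizations [w] \<times> factorizations ws. ?s (?f x))"
    unfolding sum_product sum.cartesian_product
    by (intro sum.cong refl)
      (auto simp: in_factorizations mult_single plus_fmon_def weight_def wsfact_append graft_append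
         wsfact_simps mult.commute mult.left_commute)
  also have "\<dots> = (\<Sum>p\<in>factorizations (w # ws). ?s p)"
    using factorizations_append[of "[w]" ws]
    by (simp only: append_Cons append_Nil sum.reindex[OF inj_on_append_factorizations] o_def)
  finally show ?case .
qed

lemma word_bialgebra_plethystic:
  "word_bialgebra plethystic_bialgebra Fmon (+)
     (\<lambda>u. prod_list (map pleth_comult_gen (letters u))) (\<lambda>u. prod_list (map pleth_counit_gen (letters u)))"
proof
  show "inj_on Fmon forests" by (simp add: inj_on_def)
  show "basis plethystic_bialgebra = Fmon ` forests"
    by (auto simp: plethystic_bialgebra_def forests_def lists_eq_set)
  show "bone plethystic_bialgebra = delta (Fmon [])"
    by (simp add: plethystic_bialgebra_def flip: zero_fmon_def)
  show "bmult plethystic_bialgebra v w = lin_ext (\<lambda>a. lin_ext (\<lambda>b. delta (a + b)) w) v" for v w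
    by (simp add: plethystic_bialgebra_def times_eq_lin_ext)
  show "comult plethystic_bialgebra = lin_ext (\<lambda>u. prod_list (map pleth_comult_gen (letters u)))"
    "counit plethystic_bialgebra = lin_form (\<lambda>u. prod_list (map pleth_counit_gen (letters u)))"
    by (simp_all add: plethystic_bialgebra_def)
  show "Fmon us + Fmon ws = Fmon (us @ ws)" for us ws :: "nat list list"
    by (simp add: plus_fmon_def)
  show "prod_list (map pleth_comult_gen (letters (Fmon ws))) =
      (\<Sum>(gs, vs)\<in>factorizations ws. Poly_Mapping.single (Fmon gs, Fmon vs) (weight gs vs))" for ws
    by (simp add: prod_pleth_comult_gen)
  show "prod_list (map pleth_counit_gen (letters (Fmon ws))) = (if set ws \<subseteq> {[1]} then 1 else 0)" for ws
    by (induction ws) (auto simp: pleth_counit_gen_def acoeff_def qscale_rat_def wfact_def)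
qed

section \<open>Groupoids, functors and homotopy fibres\<close>

text \<open>The records carry data without laws. The laws are collected here because counting arrows
  yields homotopy cardinalities only in true groupoids.\<close>

locale groupoid =
  fixes G :: "('o, 'a) grpd"
  assumes src_in [simp]: "f \<in> Ar G \<Longrightarrow> src G f \<in> Ob G"
    and tgt_in [simp]: "f \<in> Ar G \<Longrightarrow> tgt G f \<in> Ob G"
    and gid_in [simp]: "x \<in> Ob G \<Longrightarrow> gid G x \<in> Ar G"
    and src_gid [simp]: "x \<in> Ob G \<Longrightarrow> src G (gid G x) = x"
    and tgt_gid [simp]: "x \<in> Ob G \<Longrightarrow> tgt G (gid G x) = x"
    and gcomp_in [simp]: "f \<in> Ar G \<Longrightarrow> g \<in> Ar G \<Longrightarrow> src G g = tgt G f \<Longrightarrow> gcomp G g f \<in> Ar G"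
    and src_gcomp [simp]: "f \<in> Ar G \<Longrightarrow> g \<in> Ar G \<Longrightarrow> src G g = tgt G f \<Longrightarrow> src G (gcomp G g f) = src G f"
    and tgt_gcomp [simp]: "f \<in> Ar G \<Longrightarrow> g \<in> Ar G \<Longrightarrow> src G g = tgt G f \<Longrightarrow> tgt G (gcomp G g f) = tgt G g"
    and gcomp_gid_right [simp]: "f \<in> Ar G \<Longrightarrow> gcomp G f (gid G (src G f)) = f"
    and gcomp_gid_left [simp]: "f \<in> Ar G \<Longrightarrow> gcomp G (gid G (tgt G f)) f = f"
    and gcomp_assoc: "f \<in> Ar G \<Longrightarrow> g \<in> Ar G \<Longrightarrow> h \<in> Ar G \<Longrightarrow> src G g = tgt G f \<Longrightarrow> src G h = tgt G g \<Longrightarrow>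
      gcomp G (gcomp G h g) f = gcomp G h (gcomp G g f)"
    and ex_inverse: "f \<in> Ar G \<Longrightarrow> \<exists>g\<in>Ar G. src G g = tgt G f \<and> tgt G g = src G f \<and>
      gcomp G g f = gid G (src G f) \<and> gcomp G f g = gid G (tgt G f)"
begin

lemma gid_simps [simp]:
  "f \<in> Ar G \<Longrightarrow> src G f = x \<Longrightarrow> gcomp G f (gid G x) = f"
  "f \<in> Ar G \<Longrightarrow> tgt G f = x \<Longrightarrow> gcomp G (gid G x) f = f"
  by auto

lemma left_cancel:
  assumes "f \<in> Ar G" "g \<in> Ar G" "h \<in> Ar G" "src G h = tgt G f" "src G h = tgt G g" "gcomp G h f = gcomp G h g"
  shows "f = g"
proof -
  obtain k where "k \<in> Ar G" "src G k = tgt G h" "gcomp G k h = gid G (src G h)"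
    using ex_inverse[OF assms(3)] by blast
  then show ?thesis
    using gcomp_assoc[of f h k] gcomp_assoc[of g h k] assms by (metis gcomp_gid_left)
qed

lemma right_cancel:
  assumes "f \<in> Ar G" "g \<in> Ar G" "h \<in> Ar G" "src G f = tgt G h" "src G g = tgt G h" "gcomp G f h = gcomp G g h"
  shows "f = g"
proof -
  obtain k where "k \<in> Ar G" "src G h = tgt G k" "gcomp G h k = gid G (tgt G h)"
    using ex_inverse[OF assms(3)] by metis
  then show ?thesis
    using gcomp_assoc[of k h f] gcomp_assoc[of k h g] assms by (metis gcomp_gid_right)
qed

lemma equiv_iso_rel: "equiv (Ob G) (iso_rel G)"
proof (rule equivI)
  show "iso_rel G \<subseteq> Ob G \<times> Ob G" by (auto simp: iso_rel_def)
  show "refl_on (Ob G) (iso_rel G)"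
    unfolding refl_on_def iso_rel_def using gid_in src_gid tgt_gid by blast
  show "sym (iso_rel G)"
    using ex_inverse by (fastforce simp: sym_def iso_rel_def)
  show "trans (iso_rel G)"
    unfolding trans_def iso_rel_def
    by clarsimp (metis gcomp_in src_gcomp tgt_gcomp)
qed

definition hom :: "'o \<Rightarrow> 'o \<Rightarrow> 'a set" where
  "hom x y = {f \<in> Ar G. src G f = x \<and> tgt G f = y}"

lemma inverse_hom:
  assumes "h \<in> hom x y"
  obtains k where "k \<in> hom y x" "gcomp G k h = gid G x" "gcomp G h k = gid G y"
  using assms ex_inverse[of h] by (auto simp: hom_def)

lemma bij_postcomp:
  assumes "h \<in> hom y z"
  shows "bij_betw (gcomp G h) (hom x y) (hom x z)"
proof -
  obtain k where k: "k \<in> hom z y" "gcomp G k h = gid G y" "gcomp G h k = gid G z"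
    using inverse_hom[OF assms] .
  show ?thesis
    by (rule bij_betw_byWitness[where f' = "gcomp G k"])
      (use assms k in \<open>auto simp: hom_def simp flip: gcomp_assoc\<close>)
qed

lemma bij_precomp:
  assumes "h \<in> hom x y"
  shows "bij_betw (\<lambda>f. gcomp G f h) (hom y z) (hom x z)"
proof -
  obtain k where k: "k \<in> hom y x" "gcomp G k h = gid G x" "gcomp G h k = gid G y"
    using inverse_hom[OF assms] .
  show ?thesis
    by (rule bij_betw_byWitness[where f' = "\<lambda>f. gcomp G f k"])
      (use assms k in \<open>auto simp: hom_def gcomp_assoc\<close>)
qed

text \<open>Composition with isomorphisms from \<open>r\<close> to \<open>x\<close> and to
  \<open>y\<close> matches the arrows from \<open>x\<close> to \<open>y\<close> with the
  automorphisms of \<open>r\<close>.\<close>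

lemma card_hom_eq_card_Aut:
  assumes "(r, x) \<in> iso_rel G" "(r, y) \<in> iso_rel G"
  shows "card (hom x y) = card (Aut G r)"
proof -
  obtain p q where "p \<in> hom r x" "q \<in> hom r y"
    using assms by (auto simp: iso_rel_def hom_def)
  then have "card (hom x y) = card (hom r y)" "card (hom r r) = card (hom r y)"
    using bij_betw_same_card[OF bij_precomp] bij_betw_same_card[OF bij_postcomp] by blast+
  then show ?thesis by (simp add: hom_def Aut_def)
qed

text \<open>There are \<open>|c| * |Aut|\<close> arrows out of each object of a component \<open>c\<close>.\<close>

lemma hcard_eq_sum:
  assumes fin: "finite (Ob G)" and out: "\<And>x. x \<in> Ob G \<Longrightarrow> finite {f \<in> Ar G. src G f = x}"
  shows "hcard G = (\<Sum>x\<in>Ob G. 1 / of_nat (card {f \<in> Ar G. src G f = x}))"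
proof -
  have class_sum: "(\<Sum>x\<in>c. 1 / of_nat (card {f \<in> Ar G. src G f = x})) = (1 :: rat) / of_nat (card (Aut G (rep c)))"
    if c: "c \<in> pi0 G" for c
  proof -
    obtain z where z: "z \<in> Ob G" "c = iso_rel G `` {z}"
      using c by (auto simp: pi0_def elim: quotientE)
    have "z \<in> c" using equiv_class_self[OF equiv_iso_rel z(1)] by (simp add: z(2))
    then have "rep c \<in> c" unfolding rep_def by (rule someI)
    then have rep: "(rep c, x) \<in> iso_rel G" if "x \<in> c" for x
      using that z equiv_iso_rel by (metis Image_singleton_iff equivE symE transE)
    have c_sub: "c \<subseteq> Ob G" using z by (auto simp: iso_rel_def)
    then have fin_c: "finite c" using fin by (rule finite_subset)
    have "card {f \<in> Ar G. src G f = x} = card c * card (Aut G (rep c))" if x: "x \<in> c" for x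
    proof -
      have "{f \<in> Ar G. src G f = x} = (\<Union>y\<in>c. hom x y)"
      proof (intro set_eqI iffI)
        fix f assume f: "f \<in> {f \<in> Ar G. src G f = x}"
        then have "(x, tgt G f) \<in> iso_rel G" by (auto simp: iso_rel_def)
        then have "tgt G f \<in> c" using x z equiv_iso_rel by (metis Image_singleton_iff equivE transE)
        then show "f \<in> (\<Union>y\<in>c. hom x y)" using f by (auto simp: hom_def)
      qed (auto simp: hom_def)
      moreover have "finite (hom x y)" for y
        using out[of x] x c_sub by (auto simp: hom_def intro: rev_finite_subset)
      then have "card (\<Union>y\<in>c. hom x y) = (\<Sum>y\<in>c. card (hom x y))"
        by (intro card_UN_disjoint fin_c) (auto simp: hom_def)
      moreover have "card (hom x y) = card (Aut G (rep c))" if "y \<in> c" for y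
        using rep[OF x] rep[OF that] by (rule card_hom_eq_card_Aut)
      ultimately show ?thesis by simp
    qed
    then have "(\<Sum>x\<in>c. 1 / of_nat (card {f \<in> Ar G. src G f = x}))
        = (\<Sum>x\<in>c. (1 :: rat) / (of_nat (card c) * of_nat (card (Aut G (rep c)))))"
      by (intro sum.cong refl) simp
    also have "\<dots> = 1 / of_nat (card (Aut G (rep c)))"
      using fin_c \<open>z \<in> c\<close> by (auto simp: card_eq_0_iff)
    finally show ?thesis .
  qed
  have "(\<Sum>x\<in>Ob G. (1 :: rat) / of_nat (card {f \<in> Ar G. src G f = x}))
      = (\<Sum>c\<in>pi0 G. \<Sum>x\<in>c. 1 / of_nat (card {f \<in> Ar G. src G f = x}))"
  proof -
    have "Ob G = \<Union>(pi0 G)"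
      unfolding pi0_def using Union_quotient[OF equiv_iso_rel] by simp
    moreover have "\<forall>c\<in>pi0 G. finite c"
      using fin finite_equiv_class[OF fin] equiv_iso_rel unfolding pi0_def by (auto simp: equiv_def)
    moreover have "\<forall>c\<in>pi0 G. \<forall>d\<in>pi0 G. c \<noteq> d \<longrightarrow> c \<inter> d = {}"
      unfolding pi0_def using quotient_disj[OF equiv_iso_rel] by blast
    ultimately show ?thesis by (simp add: sum.Union_disjoint)
  qed
  then show ?thesis by (simp add: hcard_def class_sum)
qed

end

section \<open>Functors and homotopy fibres\<close>

definition is_functor :: "('o, 'a) grpd \<Rightarrow> ('p, 'b) grpd \<Rightarrow> ('o, 'a, 'p, 'b) funct \<Rightarrow> bool" where
  "is_functor G H F \<longleftrightarrow> (\<forall>x\<in>Ob G. onOb F x \<in> Ob H) \<and>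
     (\<forall>f\<in>Ar G. onAr F f \<in> Ar H \<and> src H (onAr F f) = onOb F (src G f) \<and> tgt H (onAr F f) = onOb F (tgt G f)) \<and>
     (\<forall>f\<in>Ar G. \<forall>g\<in>Ar G. src G g = tgt G f \<longrightarrow> onAr F (gcomp G g f) = gcomp H (onAr F g) (onAr F f))"

lemma is_functorD:
  assumes "is_functor G H F"
  shows "x \<in> Ob G \<Longrightarrow> onOb F x \<in> Ob H" "f \<in> Ar G \<Longrightarrow> onAr F f \<in> Ar H"
    "f \<in> Ar G \<Longrightarrow> src H (onAr F f) = onOb F (src G f)" "f \<in> Ar G \<Longrightarrow> tgt H (onAr F f) = onOb F (tgt G f)"
    "f \<in> Ar G \<Longrightarrow> g \<in> Ar G \<Longrightarrow> src G g = tgt G f \<Longrightarrow> onAr F (gcomp G g f) = gcomp H (onAr F g) (onAr F f)"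
  using assms by (auto simp: is_functor_def)

text \<open>The image of an identity is idempotent, and cancellation makes an idempotent arrow of a
  groupoid an identity.\<close>

lemma functor_gid:
  assumes "groupoid G" "groupoid H" "is_functor G H F" "x \<in> Ob G"
  shows "onAr F (gid G x) = gid H (onOb F x)"
proof -
  interpret G: groupoid G by fact
  interpret H: groupoid H by fact
  note F = is_functorD[OF assms(3)]
  let ?e = "onAr F (gid G x)"
  have e: "?e \<in> Ar H" "src H ?e = onOb F x" "tgt H ?e = onOb F x"
    using assms(4) by (simp_all add: F)
  have "gcomp G (gid G x) (gid G x) = gid G x"
    using G.gcomp_gid_right[of "gid G x"] assms(4) by simp
  then have "gcomp H ?e ?e = ?e"
    using F(5)[of "gid G x" "gid G x"] assms(4) by simp
  also have "\<dots> = gcomp H ?e (gid H (onOb F x))"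
    using H.gcomp_gid_right[of ?e] e by simp
  finally show ?thesis
    using e assms(4) by (rule_tac h = ?e in H.left_cancel) (simp_all add: F(1))
qed

lemma groupoid_hofib:
  assumes "groupoid G" "groupoid H" "is_functor G H F"
  shows "groupoid (hofib G H F y)"
proof -
  interpret G: groupoid G by fact
  interpret H: groupoid H by fact
  note F = is_functorD[OF assms(3)] and F_gid = functor_gid[OF assms]
  let ?K = "hofib G H F y"
  have Ob: "p \<in> Ob ?K \<longleftrightarrow> fst p \<in> Ob G \<and> snd p \<in> Ar H \<and> src H (snd p) = onOb F (fst p) \<and> tgt H (snd p) = y" for p
    by (auto simp: hofib_def Let_def case_prod_beta)
  have Ar: "(p, f, q) \<in> Ar ?K \<longleftrightarrow> p \<in> Ob ?K \<and> q \<in> Ob ?K \<and> f \<in> Ar G \<and> src G f = fst p \<and> tgt G f = fst q \<and>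
      gcomp H (snd q) (onAr F f) = snd p" for p f q
    by (simp add: hofib_def Let_def)
  have simps: "src ?K (p, f, q) = p" "tgt ?K (p, f, q) = q" "gid ?K p = (p, gid G (fst p), p)"
    "gcomp ?K (q', g, r) (p, f, q) = (p, gcomp G g f, r)" for p f q q' g r
    by (simp_all add: hofib_def Let_def)
  show ?thesis
  proof
    fix x assume x: "x \<in> Ob ?K"
    show "gid ?K x \<in> Ar ?K"
      using x H.gcomp_gid_right[of "snd x"] by (simp add: simps Ar Ob F_gid)
    show "src ?K (gid ?K x) = x" "tgt ?K (gid ?K x) = x" by (simp_all add: simps)
  next
    fix u assume "u \<in> Ar ?K"
    then obtain p f q where u: "u = (p, f, q)" "(p, f, q) \<in> Ar ?K" by (metis prod_cases3)
    show "src ?K u \<in> Ob ?K" "tgt ?K u \<in> Ob ?K" using u by (simp_all add: simps Ar)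
    show "gcomp ?K u (gid ?K (src ?K u)) = u" "gcomp ?K (gid ?K (tgt ?K u)) u = u"
      using u G.gcomp_gid_left[of f] G.gcomp_gid_right[of f] by (simp_all add: simps Ar)
    obtain g where g: "g \<in> Ar G" "src G g = tgt G f" "tgt G g = src G f"
      "gcomp G g f = gid G (src G f)" "gcomp G f g = gid G (tgt G f)"
      using G.ex_inverse[of f] u by (auto simp: Ar)
    \<comment> \<open>To lift the inverse \<open>g\<close> of \<open>f\<close>, the triangle
      \<open>snd q \<circ> F f = snd p\<close> is composed with \<open>F g\<close>.\<close>
    have "gcomp H (onAr F f) (onAr F g) = gid H (onOb F (fst q))"
      using F(5)[of g f] u(2) g by (simp add: Ar Ob F_gid)
    then have "gcomp H (snd p) (onAr F g) = snd q"
      using H.gcomp_assoc[of "onAr F g" "onAr F f" "snd q"] u(2) g by (simp add: Ar Ob F)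
    then have "(q, g, p) \<in> Ar ?K"
      using u(2) g by (simp add: Ar)
    then show "\<exists>v\<in>Ar ?K. src ?K v = tgt ?K u \<and> tgt ?K v = src ?K u \<and>
        gcomp ?K v u = gid ?K (src ?K u) \<and> gcomp ?K u v = gid ?K (tgt ?K u)"
      using u g by (intro bexI[of _ "(q, g, p)"]) (simp_all add: simps Ar)
    fix v assume "v \<in> Ar ?K" and comp: "src ?K v = tgt ?K u"
    then obtain g r where v: "v = (q, g, r)" "(q, g, r) \<in> Ar ?K"
      using u by (metis prod_cases3 simps(1,2))
    have "gcomp H (snd r) (onAr F (gcomp G g f)) = gcomp H (gcomp H (snd r) (onAr F g)) (onAr F f)"
      using u(2) v(2) H.gcomp_assoc[of "onAr F f" "onAr F g" "snd r"] by (simp add: Ar Ob F)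
    then show "gcomp ?K v u \<in> Ar ?K"
      using u v by (simp add: simps Ar)
    show "src ?K (gcomp ?K v u) = src ?K u" "tgt ?K (gcomp ?K v u) = tgt ?K v"
      using u v by (simp_all add: simps)
    fix w assume "w \<in> Ar ?K" and "src ?K w = tgt ?K v"
    then obtain h s where w: "w = (r, h, s)" "(r, h, s) \<in> Ar ?K"
      using v by (metis prod_cases3 simps(1,2))
    show "gcomp ?K (gcomp ?K w v) u = gcomp ?K w (gcomp ?K v u)"
      using u v w by (simp add: simps Ar G.gcomp_assoc)
  qed
qed

text \<open>The comparison arrow at the target is forced: it is that of \<open>p\<close> composed
  with the inverse of \<open>F f\<close>. An arrow out of \<open>p\<close> is thus the same as an
  arrow \<open>f\<close> out of the underlying object, and out-degrees do not change in passing to a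
  homotopy fibre.\<close>

lemma bij_betw_out_hofib:
  assumes "groupoid G" "groupoid H" "is_functor G H F" "p \<in> Ob (hofib G H F y)"
  shows "bij_betw (\<lambda>(p, f, q). f) {u \<in> Ar (hofib G H F y). src (hofib G H F y) u = p} {f \<in> Ar G. src G f = fst p}"
proof -
  interpret G: groupoid G by fact
  interpret H: groupoid H by fact
  note F = is_functorD[OF assms(3)]
  let ?K = "hofib G H F y"
  have Ob: "p \<in> Ob ?K \<longleftrightarrow> fst p \<in> Ob G \<and> snd p \<in> Ar H \<and> src H (snd p) = onOb F (fst p) \<and> tgt H (snd p) = y" for p
    by (auto simp: hofib_def Let_def case_prod_beta)
  have Ar: "(p, f, q) \<in> Ar ?K \<longleftrightarrow> p \<in> Ob ?K \<and> q \<in> Ob ?K \<and> f \<in> Ar G \<and> src G f = fst p \<and> tgt G f = fst q \<and>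
      gcomp H (snd q) (onAr F f) = snd p" for p f q
    by (simp add: hofib_def Let_def)
  have src: "src ?K (p, f, q) = p" for p f q
    by (simp add: hofib_def Let_def)
  have inj: "q = q'" if "(p, f, q) \<in> Ar ?K" "(p, f, q') \<in> Ar ?K" for f q q'
  proof -
    have "snd q = snd q'"
      using that by (rule_tac h = "onAr F f" in H.right_cancel) (simp_all add: Ar Ob F)
    then show ?thesis using that by (simp add: Ar prod_eq_iff)
  qed
  have surj: "\<exists>q. (p, f, q) \<in> Ar ?K" if f: "f \<in> Ar G" "src G f = fst p" for f
  proof -
    obtain h where h: "h \<in> Ar H" "src H h = tgt H (onAr F f)" "tgt H h = src H (onAr F f)"
      "gcomp H h (onAr F f) = gid H (src H (onAr F f))"
      using H.ex_inverse[of "onAr F f"] f F(2) by blast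
    have "gcomp H (gcomp H (snd p) h) (onAr F f) = gcomp H (snd p) (gid H (src H (snd p)))"
      using assms(4) f h by (simp add: Ob F H.gcomp_assoc)
    then have "(p, f, (tgt G f, gcomp H (snd p) h)) \<in> Ar ?K"
      using assms(4) f h by (simp add: Ar Ob F)
    then show ?thesis by blast
  qed
  show ?thesis
    unfolding bij_betw_def
  proof
    show "inj_on (\<lambda>(p, f, q). f) {u \<in> Ar ?K. src ?K u = p}"
    proof (rule inj_onI)
      fix u v assume *: "u \<in> {u \<in> Ar ?K. src ?K u = p}" "v \<in> {u \<in> Ar ?K. src ?K u = p}"
        "(\<lambda>(p, f, q). f) u = (\<lambda>(p, f, q). f) v"
      obtain q f r q' f' r' where "u = (q, f, r)" "v = (q', f', r')" by (metis prod_cases3)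
      then show "u = v" using * inj[of f r r'] by (auto simp add: src)
    qed
    show "(\<lambda>(p, f, q). f) ` {u \<in> Ar ?K. src ?K u = p} = {f \<in> Ar G. src G f = fst p}"
    proof (intro set_eqI iffI)
      fix f assume "f \<in> {f \<in> Ar G. src G f = fst p}"
      then obtain q where "(p, f, q) \<in> Ar ?K" using surj by blast
      then show "f \<in> (\<lambda>(p, f, q). f) ` {u \<in> Ar ?K. src ?K u = p}"
        by (intro image_eqI[of _ _ "(p, f, q)"]) (simp_all add: src)
    qed (auto simp: src Ar)
  qed
qed

section \<open>Products, tuples and the symmetric groups\<close>

lemma groupoid_one: "groupoid one_grpd"
  by unfold_locales (simp_all add: one_grpd_def)

lemma prod_grpd_simps [simp]:
  "Ob (prod_grpd G H) = Ob G \<times> Ob H" "Ar (prod_grpd G H) = Ar G \<times> Ar H"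
  "src (prod_grpd G H) (f, f') = (src G f, src H f')" "tgt (prod_grpd G H) (f, f') = (tgt G f, tgt H f')"
  "gid (prod_grpd G H) (x, x') = (gid G x, gid H x')"
  "gcomp (prod_grpd G H) (g, g') (f, f') = (gcomp G g f, gcomp H g' f')"
  by (simp_all add: prod_grpd_def)

lemma groupoid_prod:
  assumes "groupoid G" "groupoid H"
  shows "groupoid (prod_grpd G H)"
proof -
  interpret G: groupoid G by fact
  interpret H: groupoid H by fact
  show ?thesis
  proof
    fix u assume "u \<in> Ar (prod_grpd G H)"
    then obtain f f' where u: "u = (f, f')" "f \<in> Ar G" "f' \<in> Ar H" by auto
    obtain g g' where "g \<in> Ar G" "src G g = tgt G f \<and> tgt G g = src G f \<and>
        gcomp G g f = gid G (src G f) \<and> gcomp G f g = gid G (tgt G f)"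
      "g' \<in> Ar H" "src H g' = tgt H f' \<and> tgt H g' = src H f' \<and>
        gcomp H g' f' = gid H (src H f') \<and> gcomp H f' g' = gid H (tgt H f')"
      using G.ex_inverse[OF u(2)] H.ex_inverse[OF u(3)] by blast
    then show "\<exists>v\<in>Ar (prod_grpd G H). src (prod_grpd G H) v = tgt (prod_grpd G H) u \<and>
        tgt (prod_grpd G H) v = src (prod_grpd G H) u \<and>
        gcomp (prod_grpd G H) v u = gid (prod_grpd G H) (src (prod_grpd G H) u) \<and>
        gcomp (prod_grpd G H) u v = gid (prod_grpd G H) (tgt (prod_grpd G H) u)"
      using u by (intro bexI[of _ "(g, g')"]) auto
  qed (auto simp: G.gcomp_assoc H.gcomp_assoc)
qed

lemma is_functor_comp:
  "is_functor G H F \<Longrightarrow> is_functor H K F' \<Longrightarrow> is_functor G K (fun_comp F' F)"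
  by (simp add: is_functor_def fun_comp_def)

lemma M_grpd_simps [simp]:
  "Ob (M_grpd G) = nelists (Ob G)" "Ar (M_grpd G) = nelists (Ar G)"
  "src (M_grpd G) = map (src G)" "tgt (M_grpd G) = map (tgt G)" "gid (M_grpd G) = map (gid G)"
  "gcomp (M_grpd G) = map2 (gcomp G)"
  by (simp_all add: M_grpd_def)

lemma map2_gcomp:
  assumes "groupoid G" "set fs \<subseteq> Ar G" "set gs \<subseteq> Ar G" "map (src G) gs = map (tgt G) fs"
  shows "set (map2 (gcomp G) gs fs) \<subseteq> Ar G" "map (src G) (map2 (gcomp G) gs fs) = map (src G) fs"
    "map (tgt G) (map2 (gcomp G) gs fs) = map (tgt G) gs"
proof -
  interpret groupoid G by fact
  have "length gs = length fs" using assms(4) by (rule map_eq_imp_length_eq)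
  then have "set (map2 (gcomp G) gs fs) \<subseteq> Ar G \<and> map (src G) (map2 (gcomp G) gs fs) = map (src G) fs \<and>
    map (tgt G) (map2 (gcomp G) gs fs) = map (tgt G) gs"
    using assms(2-4) by (induction gs fs rule: list_induct2) auto
  then show "set (map2 (gcomp G) gs fs) \<subseteq> Ar G" "map (src G) (map2 (gcomp G) gs fs) = map (src G) fs"
    "map (tgt G) (map2 (gcomp G) gs fs) = map (tgt G) gs" by auto
qed

lemma map2_gcomp_assoc:
  assumes "groupoid G" "set fs \<subseteq> Ar G" "set gs \<subseteq> Ar G" "set hs \<subseteq> Ar G"
    "map (src G) gs = map (tgt G) fs" "map (src G) hs = map (tgt G) gs"
  shows "map2 (gcomp G) (map2 (gcomp G) hs gs) fs = map2 (gcomp G) hs (map2 (gcomp G) gs fs)"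
proof -
  interpret groupoid G by fact
  have "length hs = length gs" "length gs = length fs"
    using assms(5,6) by (auto dest: map_eq_imp_length_eq)
  then show ?thesis
    using assms(2-6) by (induction hs gs fs rule: list_induct3) (auto simp: gcomp_assoc)
qed

lemma groupoid_M:
  assumes "groupoid G"
  shows "groupoid (M_grpd G)"
proof -
  interpret groupoid G by fact
  show ?thesis
  proof
    fix fs assume fs: "fs \<in> Ar (M_grpd G)"
    show "src (M_grpd G) fs \<in> Ob (M_grpd G)" "tgt (M_grpd G) fs \<in> Ob (M_grpd G)"
      using fs by (auto simp: nelists_def)
    show "gcomp (M_grpd G) fs (gid (M_grpd G) (src (M_grpd G) fs)) = fs"
      "gcomp (M_grpd G) (gid (M_grpd G) (tgt (M_grpd G) fs)) fs = fs"
      using fs by (auto simp: nelists_def zip_map1 zip_map2 map2_map_map[of _ _ fs id, simplified] zip_same_conv_map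
        intro!: map_idI)
    \<comment> \<open>Inverses are chosen for all arrows at once, so that they can be mapped along a
      tuple.\<close>
    obtain i where i: "\<And>f. f \<in> Ar G \<Longrightarrow> i f \<in> Ar G \<and> src G (i f) = tgt G f \<and> tgt G (i f) = src G f \<and>
      gcomp G (i f) f = gid G (src G f) \<and> gcomp G f (i f) = gid G (tgt G f)"
      using ex_inverse by metis
    show "\<exists>gs\<in>Ar (M_grpd G). src (M_grpd G) gs = tgt (M_grpd G) fs \<and> tgt (M_grpd G) gs = src (M_grpd G) fs \<and>
        gcomp (M_grpd G) gs fs = gid (M_grpd G) (src (M_grpd G) fs) \<and>
        gcomp (M_grpd G) fs gs = gid (M_grpd G) (tgt (M_grpd G) fs)"
      using fs i by (intro bexI[of _ "map i fs"]) (auto simp: nelists_def zip_map1 zip_map2 zip_same_conv_map)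
    fix gs assume gs: "gs \<in> Ar (M_grpd G)" "src (M_grpd G) gs = tgt (M_grpd G) fs"
    show "gcomp (M_grpd G) gs fs \<in> Ar (M_grpd G)"
      "src (M_grpd G) (gcomp (M_grpd G) gs fs) = src (M_grpd G) fs"
      "tgt (M_grpd G) (gcomp (M_grpd G) gs fs) = tgt (M_grpd G) gs"
      using fs gs map2_gcomp[OF assms, of fs gs] by (auto simp: nelists_def)
    fix hs assume "hs \<in> Ar (M_grpd G)" "src (M_grpd G) hs = tgt (M_grpd G) gs"
    then show "gcomp (M_grpd G) (gcomp (M_grpd G) hs gs) fs = gcomp (M_grpd G) hs (gcomp (M_grpd G) gs fs)"
      using fs gs by (simp add: nelists_def map2_gcomp_assoc[OF assms])
  qed (auto simp: nelists_def o_def intro!: map_idI)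
qed

lemma is_functor_M_fun:
  assumes "is_functor G H F"
  shows "is_functor (M_grpd G) (M_grpd H) (M_fun F)"
proof -
  note F = is_functorD[OF assms]
  have "map (onAr F) (map2 (gcomp G) gs fs) = map2 (gcomp H) (map (onAr F) gs) (map (onAr F) fs)"
    if "set fs \<subseteq> Ar G" "set gs \<subseteq> Ar G" "map (src G) gs = map (tgt G) fs" for fs gs
    using map_eq_imp_length_eq[OF that(3)] that by (induction gs fs rule: list_induct2) (auto simp: F)
  then show ?thesis
    by (auto simp: is_functor_def M_fun_def nelists_def F)
qed

lemma concat_nelists: "xss \<in> nelists (nelists A) \<Longrightarrow> concat xss \<in> nelists A"
  by (cases xss) (auto simp: nelists_def)

text \<open>Flattening commutes with entrywise composition as long as corresponding blocks have
  equal length, which composability supplies.\<close>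

lemma is_functor_mu: "is_functor (M_grpd (M_grpd G)) (M_grpd G) M_mu"
proof -
  have "concat (map2 (map2 (gcomp G)) gss fss) = map2 (gcomp G) (concat gss) (concat fss)"
    if "map (map (src G)) gss = map (map (tgt G)) fss" for gss fss
    using map_eq_imp_length_eq[OF that] that
    by (induction gss fss rule: list_induct2) (auto dest: map_eq_imp_length_eq)
  then show ?thesis
    by (auto simp: is_functor_def M_mu_def map_concat concat_nelists)
qed

text \<open>Lists of units are mere lengths. Hence permuting the entries of such a list changes
  nothing, and conditions on the unique colour become equations between lengths.\<close>

lemma unit_list_eqI: "length xs = length ys \<Longrightarrow> xs = (ys :: unit list)"
  by (rule nth_equalityI) simp_all

text \<open>Units serve both as objects and as arrows of \<open>one_grpd\<close>, so the list in an
  arrow is also its source and its target; the arrow proper is the permutation.\<close>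

lemma S_one_simps:
  "xs \<in> Ob (S_grpd one_grpd) \<longleftrightarrow> xs \<noteq> []"
  "(fs, \<sigma>) \<in> Ar (S_grpd one_grpd) \<longleftrightarrow> fs \<noteq> [] \<and> \<sigma> permutes {..<length fs}"
  "src (S_grpd one_grpd) (fs, \<sigma>) = fs" "tgt (S_grpd one_grpd) (fs, \<sigma>) = fs"
  "gid (S_grpd one_grpd) xs = (xs, id)"
  "length gs = length fs \<Longrightarrow> gcomp (S_grpd one_grpd) (gs, \<tau>) (fs, \<sigma>) = (fs, \<sigma> \<circ> \<tau>)"
  by (auto simp: S_grpd_def one_grpd_def nelists_def intro: unit_list_eqI)

lemma groupoid_S_one: "groupoid (S_grpd one_grpd)"
proof
  fix u assume "u \<in> Ar (S_grpd one_grpd)"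
  then obtain fs \<sigma> where "u = (fs, \<sigma>)" "fs \<noteq> []" "\<sigma> permutes {..<length fs}"
    by (cases u) (auto simp: S_one_simps)
  then show "\<exists>v\<in>Ar (S_grpd one_grpd). src (S_grpd one_grpd) v = tgt (S_grpd one_grpd) u \<and>
      tgt (S_grpd one_grpd) v = src (S_grpd one_grpd) u \<and>
      gcomp (S_grpd one_grpd) v u = gid (S_grpd one_grpd) (src (S_grpd one_grpd) u) \<and>
      gcomp (S_grpd one_grpd) u v = gid (S_grpd one_grpd) (tgt (S_grpd one_grpd) u)"
    by (intro bexI[of _ "(fs, inv \<sigma>)"]) (auto simp: S_one_simps permutes_inv permutes_inv_o)
qed (auto simp: S_one_simps permutes_id comp_assoc intro!: permutes_compose)

lemma src_eq_tgt_S_one: "u \<in> Ar (S_grpd one_grpd) \<Longrightarrow> src (S_grpd one_grpd) u = tgt (S_grpd one_grpd) u"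
  by (cases u) (simp add: S_one_simps)

lemma card_out_S_one:
  assumes "xs \<noteq> []"
  shows "card {u \<in> Ar (S_grpd one_grpd). src (S_grpd one_grpd) u = xs} = fact (length xs)"
proof -
  have "{u \<in> Ar (S_grpd one_grpd). src (S_grpd one_grpd) u = xs} = {xs} \<times> {\<sigma>. \<sigma> permutes {..<length xs}}"
    using assms by (auto simp: S_one_simps)
  then show ?thesis
    using card_permutations[of "{..<length xs}" "length xs"] by (simp add: card_cartesian_product)
qed

section \<open>Groupoids of level trees\<close>

abbreviation tout_funct where
  "tout_funct Q \<equiv> \<lparr>onOb = tout (onOb (outp Q)), onAr = tout (onAr (outp Q))\<rparr>"

lemma tree_grpd_0:
  "Ob (tree_grpd Q 0) = Leaf ` Ob (colours Q)" "Ar (tree_grpd Q 0) = Leaf ` Ar (colours Q)"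
  "src (tree_grpd Q 0) (Leaf a) = Leaf (src (colours Q) a)" "tgt (tree_grpd Q 0) (Leaf a) = Leaf (tgt (colours Q) a)"
  "gid (tree_grpd Q 0) (Leaf c) = Leaf (gid (colours Q) c)"
  "gcomp (tree_grpd Q 0) (Leaf b) (Leaf a) = Leaf (gcomp (colours Q) b a)"
  by (simp_all add: tree_grpd_def)

text \<open>One more level is the fibre product of \<open>ops Q\<close> with tuples of smaller
  trees; in this shape the groupoid laws are inherited from the two factors.\<close>

lemma tree_grpd_Suc:
  "Node q ts \<in> Ob (tree_grpd Q (Suc n)) \<longleftrightarrow>
     q \<in> Ob (ops Q) \<and> ts \<in> nelists (Ob (tree_grpd Q n)) \<and> map (onOb (tout_funct Q)) ts = onOb (inp Q) q"
  "Node f us \<in> Ar (tree_grpd Q (Suc n)) \<longleftrightarrow>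
     f \<in> Ar (ops Q) \<and> us \<in> nelists (Ar (tree_grpd Q n)) \<and> map (onAr (tout_funct Q)) us = onAr (inp Q) f"
  "src (tree_grpd Q (Suc n)) (Node f us) = Node (src (ops Q) f) (map (src (tree_grpd Q n)) us)"
  "tgt (tree_grpd Q (Suc n)) (Node f us) = Node (tgt (ops Q) f) (map (tgt (tree_grpd Q n)) us)"
  "gid (tree_grpd Q (Suc n)) (Node q ts) = Node (gid (ops Q) q) (map (gid (tree_grpd Q n)) ts)"
  "gcomp (tree_grpd Q (Suc n)) (Node g vs) (Node f us) = Node (gcomp (ops Q) g f) (map2 (gcomp (tree_grpd Q n)) vs us)"
  by (simp_all add: tree_grpd_def zip_map1 case_prod_beta o_def)

lemma tree_grpd_SucE:
  assumes "x \<in> Ob (tree_grpd Q (Suc n))"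
  obtains q ts where "x = Node q ts" "q \<in> Ob (ops Q)" "ts \<in> nelists (Ob (tree_grpd Q n))"
    "map (onOb (tout_funct Q)) ts = onOb (inp Q) q"
  using assms by (auto simp: tree_grpd_def)

lemma tree_grpd_Suc_ArE:
  assumes "u \<in> Ar (tree_grpd Q (Suc n))"
  obtains f us where "u = Node f us" "f \<in> Ar (ops Q)" "us \<in> nelists (Ar (tree_grpd Q n))"
    "map (onAr (tout_funct Q)) us = onAr (inp Q) f"
  using assms by (auto simp: tree_grpd_def)

text \<open>A composite of nodes satisfies the fibre condition because taking outputs preserves
  composition, so the functoriality of \<open>tout\<close> is carried along in the
  induction.\<close>

lemma groupoid_tree_aux:
  assumes "groupoid (colours Q)" "groupoid (ops Q)"
    and "is_functor (ops Q) (M_grpd (colours Q)) (inp Q)" "is_functor (ops Q) (colours Q) (outp Q)"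
  shows "groupoid (tree_grpd Q n) \<and> is_functor (tree_grpd Q n) (colours Q) (tout_funct Q)"
proof (induction n)
  case 0
  interpret groupoid "colours Q" by fact
  have "groupoid (tree_grpd Q 0)"
    by unfold_locales (auto simp: tree_grpd_0 gcomp_assoc ex_inverse)
  moreover have "is_functor (tree_grpd Q 0) (colours Q) (tout_funct Q)"
    by (auto simp: is_functor_def tree_grpd_0)
  ultimately show ?case ..
next
  case (Suc n)
  let ?T = "tree_grpd Q n" and ?T' = "tree_grpd Q (Suc n)"
  interpret C: groupoid "colours Q" by fact
  interpret M: groupoid "M_grpd (colours Q)" by (rule groupoid_M) fact
  interpret O: groupoid "ops Q" by fact
  interpret T: groupoid ?T using Suc by simp
  interpret MT: groupoid "M_grpd ?T" by (rule groupoid_M) (rule T.groupoid_axioms)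
  have MF: "is_functor (M_grpd ?T) (M_grpd (colours Q)) (M_fun (tout_funct Q))"
    using Suc by (intro is_functor_M_fun) simp
  note s = is_functorD[OF assms(3)] and s_gid = functor_gid[OF O.groupoid_axioms M.groupoid_axioms assms(3)]
  note t = is_functorD[OF assms(4)]
  note F = is_functorD[OF MF, unfolded M_fun_def funct.simps M_grpd_simps]
    and F_gid = functor_gid[OF MT.groupoid_axioms M.groupoid_axioms MF, unfolded M_fun_def funct.simps M_grpd_simps]
  have "groupoid ?T'"
  proof
    fix x assume "x \<in> Ob ?T'"
    then obtain q ts where x: "x = Node q ts" "q \<in> Ob (ops Q)" "ts \<in> nelists (Ob ?T)"
      "map (tout (onOb (outp Q))) ts = onOb (inp Q) q" by (auto elim: tree_grpd_SucE)
    show "gid ?T' x \<in> Ar ?T'"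
      using x MT.gid_in[of ts] F_gid[of ts] s_gid[of q] by (simp add: tree_grpd_Suc)
    show "src ?T' (gid ?T' x) = x" "tgt ?T' (gid ?T' x) = x"
      using x MT.src_gid[of ts] MT.tgt_gid[of ts] by (simp_all add: tree_grpd_Suc)
  next
    fix u assume "u \<in> Ar ?T'"
    then obtain f us where u: "u = Node f us" "f \<in> Ar (ops Q)" "us \<in> nelists (Ar ?T)"
      "map (tout (onAr (outp Q))) us = onAr (inp Q) f" by (auto elim: tree_grpd_Suc_ArE)
    show "src ?T' u \<in> Ob ?T'" "tgt ?T' u \<in> Ob ?T'"
      using u MT.src_in[of us] MT.tgt_in[of us] F(3,4)[of us] s(3,4)[of f] by (simp_all add: tree_grpd_Suc)
    show "gcomp ?T' u (gid ?T' (src ?T' u)) = u" "gcomp ?T' (gid ?T' (tgt ?T' u)) u = u"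
      using u MT.gcomp_gid_right[of us] MT.gcomp_gid_left[of us] by (simp_all add: tree_grpd_Suc)
    obtain g where g: "g \<in> Ar (ops Q)" "src (ops Q) g = tgt (ops Q) f" "tgt (ops Q) g = src (ops Q) f"
      "gcomp (ops Q) g f = gid (ops Q) (src (ops Q) f)" "gcomp (ops Q) f g = gid (ops Q) (tgt (ops Q) f)"
      using O.ex_inverse[OF u(2)] by blast
    obtain vs where vs: "vs \<in> Ar (M_grpd ?T)" "src (M_grpd ?T) vs = tgt (M_grpd ?T) us"
      "tgt (M_grpd ?T) vs = src (M_grpd ?T) us"
      "gcomp (M_grpd ?T) vs us = gid (M_grpd ?T) (src (M_grpd ?T) us)"
      "gcomp (M_grpd ?T) us vs = gid (M_grpd ?T) (tgt (M_grpd ?T) us)"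
      using MT.ex_inverse[of us] u(3) by auto
    \<comment> \<open>The inverses at the root and at the subtrees were chosen separately. They
      agree on colours because both are inverse to the same arrow there, which right cancellation
      makes precise.\<close>
    have "map (tout (onAr (outp Q))) vs = onAr (inp Q) g"
    proof (rule M.right_cancel[of _ _ "onAr (inp Q) f"])
      have "gcomp (M_grpd (colours Q)) (map (tout (onAr (outp Q))) vs) (map (tout (onAr (outp Q))) us)
          = map (tout (onAr (outp Q))) (map2 (gcomp ?T) vs us)"
        unfolding M_grpd_simps by (rule F(5)[symmetric]) (use vs(1,2) u(3) in simp_all)
      also have "map2 (gcomp ?T) vs us = map (gid ?T) (map (src ?T) us)"
        using vs(4) by simp
      also have "map (tout (onAr (outp Q))) \<dots> = gid (M_grpd (colours Q)) (map (tout (onOb (outp Q))) (map (src ?T) us))"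
        using F_gid[of "map (src ?T) us"] u MT.src_in[of us] by simp
      also have "\<dots> = gcomp (M_grpd (colours Q)) (onAr (inp Q) g) (onAr (inp Q) f)"
        using s(5)[of f g] s_gid[of "src (ops Q) f"] g u F(3)[of us] s(3)[of f] by simp
      finally show "gcomp (M_grpd (colours Q)) (map (tout (onAr (outp Q))) vs) (onAr (inp Q) f)
          = gcomp (M_grpd (colours Q)) (onAr (inp Q) g) (onAr (inp Q) f)"
        by (simp only: u(4))
    qed (use u g vs s(2-4)[of f] s(2-4)[of g] F(2,3)[of vs] F(4)[of us] in simp_all)
    then show "\<exists>v\<in>Ar ?T'. src ?T' v = tgt ?T' u \<and> tgt ?T' v = src ?T' u \<and>
        gcomp ?T' v u = gid ?T' (src ?T' u) \<and> gcomp ?T' u v = gid ?T' (tgt ?T' u)"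
      using u g vs by (intro bexI[of _ "Node g vs"]) (simp_all add: tree_grpd_Suc)
    fix v assume "v \<in> Ar ?T'" and comp: "src ?T' v = tgt ?T' u"
    then obtain g vs where v: "v = Node g vs" "g \<in> Ar (ops Q)" "vs \<in> nelists (Ar ?T)"
      "map (tout (onAr (outp Q))) vs = onAr (inp Q) g" by (auto elim: tree_grpd_Suc_ArE)
    have c: "src (ops Q) g = tgt (ops Q) f" "map (src ?T) vs = map (tgt ?T) us"
      using comp u v by (simp_all add: tree_grpd_Suc)
    show "gcomp ?T' v u \<in> Ar ?T'"
      using u v c MT.gcomp_in[of us vs] F(5)[of us vs] s(5)[of f g] by (simp add: tree_grpd_Suc)
    show "src ?T' (gcomp ?T' v u) = src ?T' u" "tgt ?T' (gcomp ?T' v u) = tgt ?T' v"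
      using u v c MT.src_gcomp[of us vs] MT.tgt_gcomp[of us vs] by (simp_all add: tree_grpd_Suc)
    fix w assume "w \<in> Ar ?T'" and "src ?T' w = tgt ?T' v"
    then obtain h ws where w: "w = Node h ws" "h \<in> Ar (ops Q)" "ws \<in> nelists (Ar ?T)"
      "src (ops Q) h = tgt (ops Q) g" "map (src ?T) ws = map (tgt ?T) vs"
      using v by (auto elim!: tree_grpd_Suc_ArE simp: tree_grpd_Suc)
    show "gcomp ?T' (gcomp ?T' w v) u = gcomp ?T' w (gcomp ?T' v u)"
      using u v w c O.gcomp_assoc[of f g h] MT.gcomp_assoc[of us vs ws] by (simp add: tree_grpd_Suc)
  qed
  moreover have "is_functor ?T' (colours Q) (tout_funct Q)"
    unfolding is_functor_def by (auto elim!: tree_grpd_SucE tree_grpd_Suc_ArE simp: tree_grpd_Suc t)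
  ultimately show ?case ..
qed

lemma is_functor_subtrees:
  "is_functor (tree_grpd Q (Suc n)) (M_grpd (tree_grpd Q n)) \<lparr>onOb = subtrees, onAr = subtrees\<rparr>"
  unfolding is_functor_def by (auto elim!: tree_grpd_SucE tree_grpd_Suc_ArE simp: tree_grpd_Suc)

lemma tface_truncate: "tface t m 2 0 (Node q ts) = Node q (map (\<lambda>x. Leaf (tout t x)) ts)"
  by (simp add: numeral_2_eq_2)

text \<open>Truncation replaces each subtree by its output, so its functoriality is that of
  \<open>tout\<close> on tuples of one-level trees.\<close>

lemma is_functor_truncate:
  assumes "is_functor (tree_grpd Q 1) (colours Q) (tout_funct Q)"
  shows "is_functor (tree_grpd Q 2) (tree_grpd Q 1)
    \<lparr>onOb = tface (onOb (outp Q)) (onOb (mul Q)) 2 0, onAr = tface (onAr (outp Q)) (onAr (mul Q)) 2 0\<rparr>"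
proof -
  note t = is_functorD[OF is_functor_M_fun[OF assms], unfolded M_fun_def funct.simps M_grpd_simps]
  have T0: "map Leaf xs \<in> nelists (Leaf ` A) \<longleftrightarrow> xs \<in> nelists A" for xs A
    by (auto simp: nelists_def)
  have map_Leaf: "map (\<lambda>x. Leaf (tout f x)) xs = map Leaf (map (tout f) xs)" for f xs
    by simp
  have comp: "map2 (gcomp (tree_grpd Q 0)) (map Leaf xs) (map Leaf ys) = map Leaf (map2 (gcomp (colours Q)) xs ys)"
    for xs ys by (simp add: zip_map1 zip_map2 tree_grpd_0 case_prod_beta o_def)
  have src0: "map (src (tree_grpd Q 0)) (map Leaf xs) = map Leaf (map (src (colours Q)) xs)"
    "map (tgt (tree_grpd Q 0)) (map Leaf xs) = map Leaf (map (tgt (colours Q)) xs)" for xs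
    by (simp_all add: tree_grpd_0)
  have tout_Leaf: "map (tout f) (map Leaf xs) = xs" for f xs
    by (simp add: o_def)
  show ?thesis
    unfolding is_functor_def funct.simps numeral_2_eq_2 One_nat_def
  proof (intro conjI ballI impI)
    fix x assume "x \<in> Ob (tree_grpd Q (Suc (Suc 0)))"
    then show "tface (onOb (outp Q)) (onOb (mul Q)) (Suc (Suc 0)) 0 x \<in> Ob (tree_grpd Q (Suc 0))"
      by (elim tree_grpd_SucE, drule_tac t(1)[unfolded One_nat_def]) (simp add: tface_truncate[unfolded numeral_2_eq_2] tree_grpd_Suc tree_grpd_0
        map_Leaf T0 tout_Leaf del: map_map tface.simps)
  next
    fix u assume u: "u \<in> Ar (tree_grpd Q (Suc (Suc 0)))"
    then show "tface (onAr (outp Q)) (onAr (mul Q)) (Suc (Suc 0)) 0 u \<in> Ar (tree_grpd Q (Suc 0))"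
      by (elim tree_grpd_Suc_ArE, drule_tac t(2)[unfolded One_nat_def]) (simp add: tface_truncate[unfolded numeral_2_eq_2] tree_grpd_Suc tree_grpd_0
        map_Leaf T0 tout_Leaf del: map_map tface.simps)
    show "src (tree_grpd Q (Suc 0)) (tface (onAr (outp Q)) (onAr (mul Q)) (Suc (Suc 0)) 0 u)
        = tface (onOb (outp Q)) (onOb (mul Q)) (Suc (Suc 0)) 0 (src (tree_grpd Q (Suc (Suc 0))) u)"
      "tgt (tree_grpd Q (Suc 0)) (tface (onAr (outp Q)) (onAr (mul Q)) (Suc (Suc 0)) 0 u)
        = tface (onOb (outp Q)) (onOb (mul Q)) (Suc (Suc 0)) 0 (tgt (tree_grpd Q (Suc (Suc 0))) u)"
      using u
      by (auto elim!: tree_grpd_Suc_ArE simp add: t(3,4)[unfolded One_nat_def, symmetric] tface_truncate[unfolded numeral_2_eq_2] tree_grpd_Suc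
        map_Leaf src0 simp del: map_map tface.simps)
    fix v assume "v \<in> Ar (tree_grpd Q (Suc (Suc 0)))"
      "src (tree_grpd Q (Suc (Suc 0))) v = tgt (tree_grpd Q (Suc (Suc 0))) u"
    then show "tface (onAr (outp Q)) (onAr (mul Q)) (Suc (Suc 0)) 0 (gcomp (tree_grpd Q (Suc (Suc 0))) v u)
        = gcomp (tree_grpd Q (Suc 0)) (tface (onAr (outp Q)) (onAr (mul Q)) (Suc (Suc 0)) 0 v)
            (tface (onAr (outp Q)) (onAr (mul Q)) (Suc (Suc 0)) 0 u)"
      using t(5) u unfolding One_nat_def
      by (elim tree_grpd_Suc_ArE) (simp add: tface_truncate[unfolded numeral_2_eq_2] tree_grpd_Suc
        map_Leaf comp del: map_map tface.simps)
  qed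
qed

section \<open>Counting the arrows out of a tree\<close>

lemma card_lists_src:
  assumes "\<And>x. x \<in> set xs \<Longrightarrow> finite {f \<in> Ar G. src G f = x}"
  shows "finite {fs. set fs \<subseteq> Ar G \<and> map (src G) fs = xs} \<and>
    card {fs. set fs \<subseteq> Ar G \<and> map (src G) fs = xs} = (\<Prod>x\<leftarrow>xs. card {f \<in> Ar G. src G f = x})"
  using assms
proof (induction xs)
  case Nil
  have "{fs. set fs \<subseteq> Ar G \<and> map (src G) fs = []} = {[]}" by auto
  then show ?case by simp
next
  case (Cons x xs)
  have eq: "{fs. set fs \<subseteq> Ar G \<and> map (src G) fs = x # xs} = (\<lambda>(f, fs). f # fs) `
     ({f \<in> Ar G. src G f = x} \<times> {fs. set fs \<subseteq> Ar G \<and> map (src G) fs = xs})"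
    by (auto simp: image_iff)
  have inj: "inj_on (\<lambda>(f, fs). f # fs) A" for A by (auto simp: inj_on_def)
  then show ?case
    using Cons unfolding eq card_image[OF inj] by (simp add: card_cartesian_product)
qed

text \<open>Over the unit colour an arrow at the root and arrows at the subtrees are compatible as
  soon as their numbers match. The choices are therefore independent, and the counts
  multiply.\<close>

lemma card_out_Node:
  fixes Q :: "(unit, unit, 'q, 'qa) M_operad"
  assumes F: "is_functor (ops Q) (M_grpd (colours Q)) (inp Q)"
    and x: "Node q ts \<in> Ob (tree_grpd Q (Suc n))"
    and fin: "finite {f \<in> Ar (ops Q). src (ops Q) f = q}"
      "\<And>t. t \<in> set ts \<Longrightarrow> finite {u \<in> Ar (tree_grpd Q n). src (tree_grpd Q n) u = t}"
  shows "finite {u \<in> Ar (tree_grpd Q (Suc n)). src (tree_grpd Q (Suc n)) u = Node q ts}" (is "finite ?A")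
    and "card {u \<in> Ar (tree_grpd Q (Suc n)). src (tree_grpd Q (Suc n)) u = Node q ts} =
      card {f \<in> Ar (ops Q). src (ops Q) f = q} *
      (\<Prod>t\<leftarrow>ts. card {u \<in> Ar (tree_grpd Q n). src (tree_grpd Q n) u = t})"
proof -
  let ?B = "{f \<in> Ar (ops Q). src (ops Q) f = q} \<times> {us. set us \<subseteq> Ar (tree_grpd Q n) \<and> map (src (tree_grpd Q n)) us = ts}"
  have len: "length (onAr (inp Q) f) = length (onOb (inp Q) (src (ops Q) f))" if "f \<in> Ar (ops Q)" for f
    using is_functorD(3)[OF F that] by (auto dest: arg_cong[of _ _ length])
  have "?A = (\<lambda>(f, us). Node f us) ` ?B"
  proof (intro set_eqI iffI)
    fix u assume "u \<in> ?A"
    then show "u \<in> (\<lambda>(f, us). Node f us) ` ?B"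
      by (auto elim!: tree_grpd_Suc_ArE simp: tree_grpd_Suc nelists_def)
  next
    fix u assume "u \<in> (\<lambda>(f, us). Node f us) ` ?B"
    then obtain f us where u: "u = Node f us" "f \<in> Ar (ops Q)" "src (ops Q) f = q"
      "set us \<subseteq> Ar (tree_grpd Q n)" "map (src (tree_grpd Q n)) us = ts" by auto
    have "length us = length ts" using u(5) by auto
    also have "\<dots> = length (onOb (inp Q) q)"
      using x by (auto simp: tree_grpd_Suc dest: arg_cong[of _ _ length])
    finally have "map (tout (onAr (outp Q))) us = onAr (inp Q) f"
      using u len by (intro unit_list_eqI) simp
    moreover have "us \<noteq> []" using x u(5) by (auto simp: tree_grpd_Suc nelists_def)
    ultimately show "u \<in> ?A" using u by (simp add: tree_grpd_Suc nelists_def)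
  qed
  moreover have "inj_on (\<lambda>(f, us). Node f us) ?B" by (auto simp: inj_on_def)
  moreover have "finite ?B \<and> card ?B = card {f \<in> Ar (ops Q). src (ops Q) f = q} *
      (\<Prod>t\<leftarrow>ts. card {u \<in> Ar (tree_grpd Q n). src (tree_grpd Q n) u = t})"
    using card_lists_src[OF fin(2)] fin(1) by (simp add: card_cartesian_product)
  ultimately show "finite ?A" "card ?A = card {f \<in> Ar (ops Q). src (ops Q) f = q} *
      (\<Prod>t\<leftarrow>ts. card {u \<in> Ar (tree_grpd Q n). src (tree_grpd Q n) u = t})"
    by (simp_all add: card_image)
qed

text \<open>\<open>card_lists_src\<close> admits the empty list for the sake of its induction; on
  nonempty tuples it counts the arrows of \<open>M_grpd\<close>.\<close>

lemma out_M:
  assumes "xs \<noteq> []"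
  shows "{fs \<in> Ar (M_grpd G). src (M_grpd G) fs = xs} = {fs. set fs \<subseteq> Ar G \<and> map (src G) fs = xs}"
  using assms by (auto simp: nelists_def)

section \<open>The operad of words\<close>

lemma is_functor_one: "is_functor G one_grpd F"
  by (simp add: is_functor_def one_grpd_def)

text \<open>The position in row \<open>i\<close> and column \<open>j\<close> of a \<open>k\<close> by \<open>n\<close> grid is numbered \<open>i * n + j\<close>.\<close>

definition grid_perm :: "nat \<Rightarrow> nat \<Rightarrow> (nat \<Rightarrow> nat) \<Rightarrow> (nat \<Rightarrow> nat) \<Rightarrow> nat \<Rightarrow> nat" where
  "grid_perm k n \<sigma> \<rho> = (\<lambda>p. if p < k * n then \<sigma> (p div n) * n + \<rho> (p mod n) else p)"

text \<open>Row-major enumeration: \<open>div\<close> and \<open>mod\<close> recover the row and the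
  column of a position.\<close>

lemma concat_grid:
  assumes "0 < n"
  shows "concat (map (\<lambda>i. map (h i) [0..<n]) [0..<k]) = map (\<lambda>p. h (p div n) (p mod n)) [0..<k * n]"
proof (induction k)
  case 0
  then show ?case by simp
next
  case (Suc k)
  have "map (h k) [0..<n] = map (\<lambda>p. h (p div n) (p mod n)) (map (\<lambda>j. j + k * n) [0..<n])"
    using assms by simp
  also have "map (\<lambda>j. j + k * n) [0..<n] = [k * n..<Suc k * n]"
    by (simp add: map_add_upt add.commute)
  finally have "map (\<lambda>p. h (p div n) (p mod n)) [k * n..<Suc k * n] = map (h k) [0..<n]" ..
  moreover have "[0..<Suc k * n] = [0..<k * n] @ [k * n..<Suc k * n]"
    using upt_add_eq_append[of 0 "k * n" n] by (simp add: add.commute)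
  ultimately show ?case using Suc by simp
qed

lemma grid_index:
  fixes i j k n :: nat
  assumes "i < k" "j < n"
  shows "i * n + j < k * n" "(i * n + j) div n = i" "(i * n + j) mod n = j"
proof -
  have "i * n + j < Suc i * n" using assms(2) by simp
  also have "\<dots> \<le> k * n" using assms(1) by (intro mult_le_mono1) simp
  finally show "i * n + j < k * n" .
qed (use assms in simp_all)

text \<open>The permutations applied first keep rows and columns in range, so \<open>div\<close> and
  \<open>mod\<close> still separate them for the second map.\<close>

lemma grid_perm_comp:
  assumes "\<sigma>' permutes {..<k}" "\<rho>' permutes {..<n}"
  shows "grid_perm k n (\<sigma> \<circ> \<sigma>') (\<rho> \<circ> \<rho>') = grid_perm k n \<sigma> \<rho> \<circ> grid_perm k n \<sigma>' \<rho>'"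
proof
  fix p
  show "grid_perm k n (\<sigma> \<circ> \<sigma>') (\<rho> \<circ> \<rho>') p = (grid_perm k n \<sigma> \<rho> \<circ> grid_perm k n \<sigma>' \<rho>') p"
  proof (cases "p < k * n")
    case True
    then have "0 < n" by (cases n) auto
    then have "p div n < k" "p mod n < n" using True by (simp_all add: less_mult_imp_div_less)
    then have "\<sigma>' (p div n) < k" "\<rho>' (p mod n) < n"
      using permutes_in_image[OF assms(1)] permutes_in_image[OF assms(2)] by simp_all
    then show ?thesis using True by (simp add: grid_perm_def grid_index)
  qed (simp add: grid_perm_def)
qed

lemma grid_perm_id: "grid_perm k n id id = id"
  by (auto simp: grid_perm_def fun_eq_iff)

text \<open>Inverting the row and the column permutation inverts the permutation of the
  grid.\<close>

lemma grid_perm_permutes: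
  assumes "\<sigma> permutes {..<k}" "\<rho> permutes {..<n}"
  shows "grid_perm k n \<sigma> \<rho> permutes {..<k * n}"
proof -
  have "grid_perm k n \<sigma> \<rho> \<circ> grid_perm k n (inv \<sigma>) (inv \<rho>) = id"
    "grid_perm k n (inv \<sigma>) (inv \<rho>) \<circ> grid_perm k n \<sigma> \<rho> = id"
    using assms grid_perm_comp[of "inv \<sigma>" k "inv \<rho>" n \<sigma> \<rho>] grid_perm_comp[of \<sigma> k \<rho> n "inv \<sigma>" "inv \<rho>"]
    by (simp_all add: permutes_inv permutes_inv_o grid_perm_id)
  then have "bij (grid_perm k n \<sigma> \<rho>)" by (metis o_bij)
  then show ?thesis
    unfolding permutes_def by (auto simp: grid_perm_def bij_iff)
qed

text \<open>In \<open>m((x,...,x);y)\<close> all blocks have the size of \<open>x\<close>.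
  Reordering them leaves the list of sizes unchanged, and the block number \<open>\<sigma> i\<close>
  starts at \<open>\<sigma> i * length as\<close>.\<close>

lemma block_perm_replicate:
  assumes "\<sigma> permutes {..<k}" "0 < length as"
  shows "block_perm (replicate k (as, \<rho>)) \<sigma> = grid_perm k (length as) \<sigma> \<rho>"
proof -
  let ?n = "length as"
  have sizes: "permute_list (inv \<sigma>) (map (\<lambda>(fs, \<sigma>). length fs) (replicate k (as, \<rho>))) = replicate k ?n"
    using permutes_in_image[OF permutes_inv[OF assms(1)]]
    by (intro nth_equalityI) (simp_all add: permute_list_def)
  have lt: "\<sigma> i < k" if "i < k" for i
    using permutes_in_image[OF assms(1), of i] that by simp
  have "concat (map (\<lambda>i. map (\<lambda>j. sum_list (take (\<sigma> i) (replicate k ?n)) + snd (replicate k (as, \<rho>) ! i) j)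
      [0..<length (fst (replicate k (as, \<rho>) ! i))]) [0..<k])
    = concat (map (\<lambda>i. map (\<lambda>j. \<sigma> i * ?n + \<rho> j) [0..<?n]) [0..<k])"
    by (intro arg_cong[where f = concat] map_cong refl) (simp_all add: lt sum_list_replicate min.absorb2 less_imp_le)
  also have "\<dots> = map (\<lambda>p. \<sigma> (p div ?n) * ?n + \<rho> (p mod ?n)) [0..<k * ?n]"
    using assms(2) by (rule concat_grid)
  finally have positions: "concat (map (\<lambda>i. map (\<lambda>j. sum_list (take (\<sigma> i) (replicate k ?n)) + snd (replicate k (as, \<rho>) ! i) j)
      [0..<length (fst (replicate k (as, \<rho>) ! i))]) [0..<k])
    = map (\<lambda>p. \<sigma> (p div ?n) * ?n + \<rho> (p mod ?n)) [0..<k * ?n]" .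
  show ?thesis
    unfolding block_perm_def sizes Let_def length_replicate positions by (simp add: grid_perm_def fun_eq_iff)
qed

text \<open>Over a single colour the conditions by which \<open>T_S\<close> and \<open>T_M\<close>
  select operations hold for every object, and this identifies the selected subgroupoids with the
  whole groupoids.\<close>

lemma full_subgrpd_all:
  assumes "groupoid G" "Ob G \<subseteq> S"
  shows "full_subgrpd G S = G"
proof -
  interpret groupoid G by fact
  have "Ob G \<inter> S = Ob G" "{f \<in> Ar G. src G f \<in> S \<and> tgt G f \<in> S} = Ar G"
    using assms(2) src_in tgt_in by blast+
  then show ?thesis by (simp add: full_subgrpd_def)
qed

lemma set_unit_list: "xs \<noteq> [] \<Longrightarrow> set xs = {()}"
  by (cases xs) auto

lemma C1_T_Sym: "C1 (T_S Sym) = S_grpd one_grpd"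
proof -
  have "Ob (S_grpd one_grpd) \<subseteq> {q. set q = {()}}" by (auto simp: S_one_simps set_unit_list)
  then show ?thesis
    using full_subgrpd_all[OF groupoid_S_one] by (simp add: T_S_def Sym_def fun_id_def)
qed

lemma icomp_T_Sym:
  "onOb (icomp (T_S Sym)) (y, x) = concat (replicate (length y) x)"
  "\<sigma> permutes {..<length cs} \<Longrightarrow> as \<noteq> [] \<Longrightarrow> onAr (icomp (T_S Sym)) ((cs, \<sigma>), (as, \<rho>)) =
     (concat (replicate (length cs) as), grid_perm (length cs) (length as) \<sigma> \<rho>)"
  by (simp_all add: T_S_def Sym_def fun_id_def fun_comp_def S_mu_def block_perm_replicate)

lemma length_concat_replicate [simp]: "length (concat (replicate k xs)) = k * length xs"
  by (induction k) simp_all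

text \<open>A pair of arrows is a pair of permutations acting independently on the rows and the
  columns of a grid, so composition is respected by \<open>grid_perm_comp\<close>.\<close>

lemma is_functor_icomp_T_Sym:
  "is_functor (prod_grpd (S_grpd one_grpd) (S_grpd one_grpd)) (S_grpd one_grpd) (icomp (T_S Sym))"
  unfolding is_functor_def
proof (intro conjI ballI impI)
  let ?S = "S_grpd one_grpd"
  fix p assume "p \<in> Ob (prod_grpd ?S ?S)"
  then show "onOb (icomp (T_S Sym)) p \<in> Ob ?S"
    by (auto simp: S_one_simps icomp_T_Sym)
next
  let ?S = "S_grpd one_grpd"
  fix u assume "u \<in> Ar (prod_grpd ?S ?S)"
  then obtain cs \<sigma> as \<rho> where u: "u = ((cs, \<sigma>), (as, \<rho>))" "cs \<noteq> []" "\<sigma> permutes {..<length cs}"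
    "as \<noteq> []" "\<rho> permutes {..<length as}"
    by (cases u) (auto simp: S_one_simps)
  then show "onAr (icomp (T_S Sym)) u \<in> Ar ?S"
    "src ?S (onAr (icomp (T_S Sym)) u) = onOb (icomp (T_S Sym)) (src (prod_grpd ?S ?S) u)"
    "tgt ?S (onAr (icomp (T_S Sym)) u) = onOb (icomp (T_S Sym)) (tgt (prod_grpd ?S ?S) u)"
    by (simp_all add: icomp_T_Sym S_one_simps grid_perm_permutes)
  fix v assume "v \<in> Ar (prod_grpd ?S ?S)" "src (prod_grpd ?S ?S) v = tgt (prod_grpd ?S ?S) u"
  then obtain \<sigma>' \<rho>' where v: "v = ((cs, \<sigma>'), (as, \<rho>'))" "\<sigma>' permutes {..<length cs}" "\<rho>' permutes {..<length as}"
    using u by (cases v) (auto simp: S_one_simps)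
  show "onAr (icomp (T_S Sym)) (gcomp (prod_grpd ?S ?S) v u)
      = gcomp ?S (onAr (icomp (T_S Sym)) v) (onAr (icomp (T_S Sym)) u)"
    using u v by (simp add: icomp_T_Sym S_one_simps permutes_compose grid_perm_comp)
qed

text \<open>Composition in \<open>T_M\<close> with the composition \<open>k\<close> of the internal
  category as a parameter, so that one expression serves objects and arrows.\<close>

definition lmul :: "('a \<times> 'a \<Rightarrow> 'b) \<Rightarrow> 'a list list \<Rightarrow> 'a list \<Rightarrow> 'b list" where
  "lmul k gss fs = concat (map2 (\<lambda>gs f. map (\<lambda>g. k (f, g)) gs) gss fs)"

lemma lmul_Cons [simp]: "lmul k (gs # gss) (f # fs) = map (\<lambda>g. k (f, g)) gs @ lmul k gss fs"
  by (simp add: lmul_def)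

lemma lmul_Nil [simp]: "lmul k [] fs = []"
  by (simp add: lmul_def)

lemma length_lmul: "length gss = length fs \<Longrightarrow> length (lmul k gss fs) = length (concat gss)"
  by (induction gss fs rule: list_induct2) auto

lemma lmul_in:
  assumes "gss \<in> nelists (nelists A)" "fs \<in> nelists A" "length gss = length fs"
    and "\<And>f g. f \<in> A \<Longrightarrow> g \<in> A \<Longrightarrow> k (f, g) \<in> B"
  shows "lmul k gss fs \<in> nelists B"
proof -
  have "set (lmul k gss fs) \<subseteq> B" if "set (map set gss) \<subseteq> Pow A" "set fs \<subseteq> A" "length gss = length fs" for gss fs
    using that(3,1,2) by (induction gss fs rule: list_induct2) (auto intro: assms(4))
  moreover have "lmul k gss fs \<noteq> []"
    using assms(1-3) by (cases gss; cases fs) (auto simp: nelists_def)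
  ultimately show ?thesis using assms(1-3) by (auto simp: nelists_def)
qed

lemma map_lmul:
  assumes "length gss = length fs" "set (concat gss) \<subseteq> A" "set fs \<subseteq> A"
    and "\<And>f g. f \<in> A \<Longrightarrow> g \<in> A \<Longrightarrow> h (k (f, g)) = k' (h' f, h' g)"
  shows "map h (lmul k gss fs) = lmul k' (map (map h') gss) (map h' fs)"
  using assms(1-3) by (induction gss fs rule: list_induct2) (auto simp: assms(4))

text \<open>Composition in \<open>T_M\<close> inherits functoriality from \<open>K\<close> entry by
  entry; composability makes the blocks on both sides match.\<close>

lemma lmul_gcomp:
  assumes K: "is_functor (prod_grpd G G) G K"
    and "set (concat gss) \<subseteq> Ar G" "set (concat gss') \<subseteq> Ar G" "set fs \<subseteq> Ar G" "set fs' \<subseteq> Ar G"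
    and "length gss = length fs"
    and "map (map (src G)) gss' = map (map (tgt G)) gss" "map (src G) fs' = map (tgt G) fs"
  shows "lmul (onAr K) (map2 (map2 (gcomp G)) gss' gss) (map2 (gcomp G) fs' fs) =
    map2 (gcomp G) (lmul (onAr K) gss' fs') (lmul (onAr K) gss fs)"
proof -
  have inner: "map (\<lambda>g. onAr K (gcomp G f' f, g)) (map2 (gcomp G) gs' gs) =
      map2 (gcomp G) (map (\<lambda>g. onAr K (f', g)) gs') (map (\<lambda>g. onAr K (f, g)) gs)"
    if "set gs \<subseteq> Ar G" "set gs' \<subseteq> Ar G" "f \<in> Ar G" "f' \<in> Ar G" "map (src G) gs' = map (tgt G) gs" "src G f' = tgt G f"
    for f f' gs gs'
  proof -
    have step: "onAr K (gcomp G f' f, gcomp G g' g) = gcomp G (onAr K (f', g')) (onAr K (f, g))"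
      if "g \<in> Ar G" "g' \<in> Ar G" "src G g' = tgt G g" for g g'
      using is_functorD(5)[OF K, of "(f, g)" "(f', g')"] that \<open>f \<in> Ar G\<close> \<open>f' \<in> Ar G\<close> \<open>src G f' = tgt G f\<close> by simp
    show ?thesis
      using map_eq_imp_length_eq[OF that(5)] that(1,2,5) by (induction gs' gs rule: list_induct2) (auto simp: step)
  qed
  have "length gss' = length gss" "length gss = length fs'" "length fs' = length fs"
    using assms(6-8) by (auto dest: map_eq_imp_length_eq)
  then show ?thesis
    using assms(2-5,7,8)
  proof (induction gss' gss fs' fs rule: list_induct4)
    case Nil
    then show ?case by simp
  next
    case (Cons gs' gss' gs gss f' fs' f fs)
    have "length gs' = length gs" using Cons.prems by (auto dest: map_eq_imp_length_eq)
    moreover have "map (\<lambda>g. onAr K (gcomp G f' f, g)) (map2 (gcomp G) gs' gs) =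
        map2 (gcomp G) (map (\<lambda>g. onAr K (f', g)) gs') (map (\<lambda>g. onAr K (f, g)) gs)"
      using Cons.prems by (intro inner) auto
    moreover have "lmul (onAr K) (map2 (map2 (gcomp G)) gss' gss) (map2 (gcomp G) fs' fs) =
        map2 (gcomp G) (lmul (onAr K) gss' fs') (lmul (onAr K) gss fs)"
      using Cons.prems by (intro Cons.IH) auto
    ultimately show ?case
      by (simp only: list.map zip_Cons_Cons lmul_Cons prod.case zip_append length_map map_append)
  qed
qed

abbreviation TSym :: "(unit, unit, unit list list, unit s_arrow list) M_operad" where
  "TSym \<equiv> T_M (T_S Sym)"

lemma colours_TSym: "colours TSym = one_grpd"
  by (simp add: T_M_def T_S_def Sym_def)

lemma ops_TSym: "ops TSym = M_grpd (S_grpd one_grpd)"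
proof -
  have "Ob (M_grpd (S_grpd one_grpd)) \<subseteq> {fs. \<exists>c. set (map (onOb (itgt (T_S Sym))) fs) = {c}}"
  proof
    fix fs :: "unit list list" assume "fs \<in> Ob (M_grpd (S_grpd one_grpd))"
    then have "map (onOb (itgt (T_S Sym))) fs \<noteq> []" by (simp add: nelists_def)
    then show "fs \<in> {fs. \<exists>c. set (map (onOb (itgt (T_S Sym))) fs) = {c}}"
      by (intro CollectI exI) (rule set_unit_list)
  qed
  then show ?thesis
    using full_subgrpd_all[OF groupoid_M[OF groupoid_S_one]] by (simp add: T_M_def C1_T_Sym)
qed

lemma mul_TSym: "onOb (mul TSym) (gss, fs) = lmul (onOb (icomp (T_S Sym))) gss fs"
  "onAr (mul TSym) (hss, us) = lmul (onAr (icomp (T_S Sym))) hss us"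
  by (simp_all add: T_M_def lmul_def)

lemma inp_TSym: "is_functor (ops TSym) (M_grpd (colours TSym)) (inp TSym)"
  unfolding ops_TSym colours_TSym by (simp add: T_M_def is_functor_M_fun is_functor_one)

lemma length_inp_TSym: "length (onOb (inp TSym) q) = length q" "length (onAr (inp TSym) f) = length f"
  by (simp_all add: T_M_def M_fun_def)

lemma
  shows groupoid_tree_TSym: "groupoid (tree_grpd TSym n)"
    and is_functor_tout_TSym: "is_functor (tree_grpd TSym n) (colours TSym) (tout_funct TSym)"
  using groupoid_tree_aux[OF _ _ inp_TSym, of n]
  by (simp_all add: colours_TSym ops_TSym groupoid_one groupoid_M groupoid_S_one is_functor_one)

lemma length_subtrees:
  "x \<in> Ob (tree_grpd TSym (Suc n)) \<Longrightarrow> length (subtrees x) = length (rootop x)"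
  "u \<in> Ar (tree_grpd TSym (Suc n)) \<Longrightarrow> length (subtrees u) = length (rootop u)"
  by (auto elim!: tree_grpd_SucE tree_grpd_Suc_ArE simp: length_inp_TSym dest!: arg_cong[of _ _ length])

text \<open>The fibre condition over the unique colour equates two lists of units, that is, two
  lengths.\<close>

lemma Node_Ob_TSym: "Node q ts \<in> Ob (tree_grpd TSym (Suc n)) \<longleftrightarrow>
    q \<in> nelists (nelists UNIV) \<and> ts \<in> nelists (Ob (tree_grpd TSym n)) \<and> length ts = length q"
  "Node f us \<in> Ar (tree_grpd TSym (Suc n)) \<longleftrightarrow>
    f \<in> nelists (Ar (S_grpd one_grpd)) \<and> us \<in> nelists (Ar (tree_grpd TSym n)) \<and> length us = length f"
proof -
  have "map g ts = onOb (inp TSym) q \<longleftrightarrow> length ts = length q" for g :: "(unit, unit list list) ltree \<Rightarrow> unit"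
    using length_inp_TSym(1)[of q] by (auto intro: unit_list_eqI dest: arg_cong[of _ _ length])
  moreover have "Ob (S_grpd one_grpd) = nelists UNIV"
    by (auto simp: S_one_simps nelists_def)
  ultimately show "Node q ts \<in> Ob (tree_grpd TSym (Suc n)) \<longleftrightarrow>
    q \<in> nelists (nelists UNIV) \<and> ts \<in> nelists (Ob (tree_grpd TSym n)) \<and> length ts = length q"
    by (simp add: tree_grpd_Suc ops_TSym)
  have "map g us = onAr (inp TSym) f \<longleftrightarrow> length us = length f" for g :: "(unit, unit s_arrow list) ltree \<Rightarrow> unit"
    using length_inp_TSym(2)[of f] by (auto intro: unit_list_eqI dest: arg_cong[of _ _ length])
  then show "Node f us \<in> Ar (tree_grpd TSym (Suc n)) \<longleftrightarrow>
    f \<in> nelists (Ar (S_grpd one_grpd)) \<and> us \<in> nelists (Ar (tree_grpd TSym n)) \<and> length us = length f"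
    by (simp add: tree_grpd_Suc ops_TSym)
qed

lemma is_functor_rootop:
  "is_functor (tree_grpd Q (Suc n)) (ops Q) \<lparr>onOb = rootop, onAr = rootop\<rparr>"
  unfolding is_functor_def by (auto elim!: tree_grpd_SucE tree_grpd_Suc_ArE simp: tree_grpd_Suc)

lemma tface_compose:
  "tface t m (Suc (Suc 0)) (Suc 0) x = Node (m (map rootop (subtrees x), rootop x)) (concat (map subtrees (subtrees x)))"
  by simp

text \<open>The inner face is \<open>lmul\<close> on roots and \<open>concat\<close> on what sits
  above. The two parts fit together because a composite has as many inputs as the grafted operations
  have in total.\<close>

lemma is_functor_compose_TSym:
  "is_functor (tree_grpd TSym (Suc (Suc 0))) (tree_grpd TSym (Suc 0))
    \<lparr>onOb = tface (onOb (outp TSym)) (onOb (mul TSym)) (Suc (Suc 0)) (Suc 0),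
     onAr = tface (onAr (outp TSym)) (onAr (mul TSym)) (Suc (Suc 0)) (Suc 0)\<rparr>"
  (is "is_functor ?T2 ?T1 \<lparr>onOb = ?dO, onAr = ?dA\<rparr>")
proof -
  let ?S = "S_grpd one_grpd" and ?K = "icomp (T_S Sym)"
  note K = is_functor_icomp_T_Sym
  \<comment> \<open>\<open>R\<close> handles the root operations of the subtrees, \<open>B\<close>
    the flattening of their own subtrees, which is \<open>M_mu\<close> after an entrywise
    functor.\<close>
  note R = is_functorD[OF is_functor_M_fun[OF is_functor_rootop[of TSym 0]], unfolded M_fun_def funct.simps M_grpd_simps ops_TSym]
  note B = is_functorD[OF is_functor_comp[OF is_functor_M_fun[OF is_functor_subtrees[of TSym 0]] is_functor_mu],
      unfolded fun_comp_def M_fun_def M_mu_def funct.simps M_grpd_simps o_apply]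
  have K34: "src ?S (onAr ?K (f, g)) = onOb ?K (src ?S f, src ?S g)"
    "tgt ?S (onAr ?K (f, g)) = onOb ?K (tgt ?S f, tgt ?S g)" if "f \<in> Ar ?S" "g \<in> Ar ?S" for f g
    using is_functorD(3,4)[OF K, of "(f, g)"] that by simp_all
  have ObS: "Ob ?S = nelists UNIV" by (auto simp: S_one_simps nelists_def)
  have arity: "length (concat (map subtrees ts)) = length (concat (map rootop ts))"
    if "(\<forall>t\<in>set ts. length (subtrees t) = length (rootop t))" for ts :: "('x, 'y list) ltree list"
    using that by (induction ts) auto
  show ?thesis
    unfolding is_functor_def funct.simps
  proof (intro conjI ballI impI)
    fix x assume "x \<in> Ob ?T2"
    then obtain q ts where x: "x = Node q ts" "q \<in> nelists (nelists UNIV)" "ts \<in> nelists (Ob ?T1)" "length ts = length q"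
      by (cases x) (auto simp: Node_Ob_TSym elim: tree_grpd_SucE)
    have "lmul (onOb ?K) (map rootop ts) q \<in> nelists (nelists UNIV)"
      using R(1)[OF x(3)] x is_functorD(1)[OF K]
      by (intro lmul_in[where A = "nelists UNIV"]) (auto simp: ObS)
    moreover have "length (concat (map subtrees ts)) = length (lmul (onOb ?K) (map rootop ts) q)"
      using x by (subst length_lmul) (auto intro!: arity simp: nelists_def length_subtrees(1))
    ultimately show "?dO x \<in> Ob ?T1"
      using B(1)[OF x(3)] unfolding tface_compose by (simp add: x(1) mul_TSym Node_Ob_TSym)
  next
    fix u assume "u \<in> Ar ?T2"
    then obtain f us where u: "u = Node f us" "f \<in> nelists (Ar ?S)" "us \<in> nelists (Ar ?T1)" "length us = length f"
      by (cases u) (auto simp: Node_Ob_TSym elim: tree_grpd_Suc_ArE)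
    have "lmul (onAr ?K) (map rootop us) f \<in> nelists (Ar ?S)"
      using R(2)[OF u(3)] u is_functorD(2)[OF K]
      by (intro lmul_in[where A = "Ar ?S"]) auto
    moreover have "length (concat (map subtrees us)) = length (lmul (onAr ?K) (map rootop us) f)"
      using u by (subst length_lmul) (auto intro!: arity simp: nelists_def length_subtrees(2))
    ultimately show "?dA u \<in> Ar ?T1"
      using B(2)[OF u(3)] unfolding tface_compose by (simp add: u(1) mul_TSym Node_Ob_TSym)
    have roots: "set (concat (map rootop us)) \<subseteq> Ar ?S" "set f \<subseteq> Ar ?S"
      using R(2)[OF u(3)] u(2) by (auto simp: nelists_def)
    have "map (src ?S) (lmul (onAr ?K) (map rootop us) f) = lmul (onOb ?K) (map rootop (map (src ?T1) us)) (map (src ?S) f)"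
      "map (tgt ?S) (lmul (onAr ?K) (map rootop us) f) = lmul (onOb ?K) (map rootop (map (tgt ?T1) us)) (map (tgt ?S) f)"
      unfolding R(3)[OF u(3), symmetric] R(4)[OF u(3), symmetric]
      by (rule map_lmul[where A = "Ar ?S"]; use roots u(4) in \<open>simp add: K34\<close>)+
    then show "src ?T1 (?dA u) = ?dO (src ?T2 u)" "tgt ?T1 (?dA u) = ?dO (tgt ?T2 u)"
      using B(3,4)[OF u(3)] unfolding tface_compose u(1) by (simp_all add: tree_grpd_Suc mul_TSym ops_TSym)
    fix v assume "v \<in> Ar ?T2" and comp: "src ?T2 v = tgt ?T2 u"
    then obtain g vs where v: "v = Node g vs" "g \<in> nelists (Ar ?S)" "vs \<in> nelists (Ar ?T1)" "length vs = length g"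
      by (cases v) (auto simp: Node_Ob_TSym elim: tree_grpd_Suc_ArE)
    have c: "map (src ?S) g = map (tgt ?S) f" "map (src ?T1) vs = map (tgt ?T1) us"
      using comp unfolding u(1) v(1) by (simp_all add: tree_grpd_Suc ops_TSym)
    have roots': "set (concat (map rootop vs)) \<subseteq> Ar ?S" "set g \<subseteq> Ar ?S"
      using R(2)[OF v(3)] v(2) by (auto simp: nelists_def)
    have "lmul (onAr ?K) (map rootop (map2 (gcomp ?T1) vs us)) (map2 (gcomp ?S) g f)
        = map2 (gcomp ?S) (lmul (onAr ?K) (map rootop vs) g) (lmul (onAr ?K) (map rootop us) f)"
      unfolding R(5)[OF u(3) v(3) c(2)]
      using roots roots' u(4) c R(3)[OF v(3)] R(4)[OF u(3)] by (intro lmul_gcomp K) simp_all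
    then show "?dA (gcomp ?T2 v u) = gcomp ?T1 (?dA v) (?dA u)"
      using B(5)[OF u(3) v(3) c(2)] unfolding tface_compose u(1) v(1)
      by (simp add: tree_grpd_Suc mul_TSym ops_TSym)
  qed
qed

section \<open>Incidence coefficients\<close>

lemma hofib_Ob:
  "(x, \<phi>) \<in> Ob (hofib G H F y) \<longleftrightarrow> x \<in> Ob G \<and> \<phi> \<in> Ar H \<and> src H \<phi> = onOb F x \<and> tgt H \<phi> = y"
  by (auto simp: hofib_def Let_def)

lemma hofib_ArE:
  assumes "u \<in> Ar (hofib G H F y)"
  obtains p g q where "u = (p, g, q)" "g \<in> Ar G" "src G g = fst p" "tgt G g = fst q"
    "src (hofib G H F y) u = p" "tgt (hofib G H F y) u = q"
  using assms by (auto simp: hofib_def Let_def)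

lemma card_out_hofib:
  assumes "groupoid G" "groupoid H" "is_functor G H F" "p \<in> Ob (hofib G H F y)"
  shows "card {u \<in> Ar (hofib G H F y). src (hofib G H F y) u = p} = card {f \<in> Ar G. src G f = fst p}"
    and "finite {f \<in> Ar G. src G f = fst p} \<Longrightarrow> finite {u \<in> Ar (hofib G H F y). src (hofib G H F y) u = p}"
  using bij_betw_out_hofib[OF assms] by (auto dest: bij_betw_same_card bij_betw_finite)

text \<open>Combines the sum over objects with the invariance of out-degrees: only arrows of
  \<open>G\<close> have to be counted.\<close>

lemma hcard_hofib:
  assumes "groupoid G" "groupoid H" "is_functor G H F"
    and fin: "finite (Ob (hofib G H F y))"
    and out: "\<And>p. p \<in> Ob (hofib G H F y) \<Longrightarrow> finite {f \<in> Ar G. src G f = fst p}"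
  shows "hcard (hofib G H F y) = (\<Sum>p\<in>Ob (hofib G H F y). 1 / of_nat (card {f \<in> Ar G. src G f = fst p}))"
proof -
  interpret K: groupoid "hofib G H F y" by (rule groupoid_hofib) fact+
  show ?thesis
    using K.hcard_eq_sum[OF fin] card_out_hofib[OF assms(1-3)] out by simp
qed

text \<open>Since every arrow of \<open>X\<^sub>1\<close> is an automorphism, an object of the iterated homotopy fibre is an
  object of the strict fibre \<open>N\<close> together with arbitrary automorphisms of \<open>f\<close>, \<open>a\<close> and \<open>b\<close>.\<close>

lemma hcard_Phi:
  assumes G: "groupoid (lev X 2)" and H: "groupoid (lev X 1)"
    and d: "\<And>i. i \<le> 2 \<Longrightarrow> is_functor (lev X 2) (lev X 1) (face X 2 i)"
    and loops: "\<And>u. u \<in> Ar (lev X 1) \<Longrightarrow> src (lev X 1) u = tgt (lev X 1) u"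
    and fin: "finite (Aut (lev X 1) f)" "finite (Aut (lev X 1) a)" "finite (Aut (lev X 1) b)"
    and N: "N = {x \<in> Ob (lev X 2). onOb (face X 2 1) x = f \<and> onOb (face X 2 2) x = a \<and> onOb (face X 2 0) x = b}"
    and finN: "finite N"
    and out: "\<And>x. x \<in> N \<Longrightarrow> finite {u \<in> Ar (lev X 2). src (lev X 2) u = x}"
  shows "hcard (Phi X f a b) = (\<Sum>x\<in>N. of_nat (card (Aut (lev X 1) f) * card (Aut (lev X 1) a) * card (Aut (lev X 1) b)) /
    of_nat (card {u \<in> Ar (lev X 2). src (lev X 2) u = x}))"
proof -
  let ?G = "lev X 2" and ?H = "lev X 1"
  let ?K = "hofib ?G ?H (face X 2 1) f"
  let ?P = "\<lparr>onOb = (\<lambda>(x, \<phi>). (onOb (face X 2 2) x, onOb (face X 2 0) x)),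
    onAr = (\<lambda>(p, g, q). (onAr (face X 2 2) g, onAr (face X 2 0) g))\<rparr>"
  let ?o = "\<lambda>x. card {u \<in> Ar ?G. src ?G u = x}"
  have d1: "is_functor ?G ?H (face X 2 1)" using d by simp
  note F2 = is_functorD[OF d[of 2, simplified]] and F0 = is_functorD[OF d[of 0, simplified]]
  have K: "groupoid ?K" by (rule groupoid_hofib) (use G H d1 in auto)
  have P: "is_functor ?K (prod_grpd ?H ?H) ?P"
    unfolding is_functor_def
  proof (intro conjI ballI impI)
    fix p assume "p \<in> Ob ?K"
    then show "onOb ?P p \<in> Ob (prod_grpd ?H ?H)"
      by (cases p) (auto simp: hofib_Ob F2 F0)
  next
    fix u assume "u \<in> Ar ?K"
    then obtain p g q where u: "u = (p, g, q)" "g \<in> Ar ?G" "src ?G g = fst p" "tgt ?G g = fst q"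
      "src ?K u = p" "tgt ?K u = q" by (rule hofib_ArE)
    then show "onAr ?P u \<in> Ar (prod_grpd ?H ?H)" "src (prod_grpd ?H ?H) (onAr ?P u) = onOb ?P (src ?K u)"
      "tgt (prod_grpd ?H ?H) (onAr ?P u) = onOb ?P (tgt ?K u)"
      by (simp_all add: F2 F0 case_prod_beta)
    fix v assume "v \<in> Ar ?K" and comp: "src ?K v = tgt ?K u"
    then obtain g' r where v: "v = (q, g', r)" "g' \<in> Ar ?G" "src ?G g' = fst q"
      using u by (metis hofib_ArE)
    have "gcomp ?K v u = (p, gcomp ?G g' g, r)"
      by (simp add: hofib_def Let_def u(1) v(1))
    then show "onAr ?P (gcomp ?K v u) = gcomp (prod_grpd ?H ?H) (onAr ?P v) (onAr ?P u)"
      using u v by (simp add: F2 F0)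
  qed
  let ?Phi = "hofib ?K (prod_grpd ?H ?H) ?P (a, b)"
  let ?h = "\<lambda>(x, \<phi>, \<psi>). ((x, \<phi>), \<psi>)"
  let ?D = "N \<times> Aut ?H f \<times> Aut ?H a \<times> Aut ?H b"
  have Ob: "Ob ?Phi = ?h ` ?D"
  proof (intro set_eqI iffI)
    fix z assume z: "z \<in> Ob ?Phi"
    obtain x \<phi> \<alpha> \<beta> where "z = ((x, \<phi>), (\<alpha>, \<beta>))" by (metis surj_pair)
    then show "z \<in> ?h ` ?D"
      using z loops unfolding N by (intro image_eqI[of _ _ "(x, \<phi>, \<alpha>, \<beta>)"]) (auto simp: hofib_Ob Aut_def)
  next
    fix z assume "z \<in> ?h ` ?D"
    then show "z \<in> Ob ?Phi" unfolding N by (auto simp: hofib_Ob Aut_def)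
  qed
  have inj: "inj_on ?h ?D" by (auto simp: inj_on_def)
  have PHI: "Phi X f a b = ?Phi" by (simp add: Phi_def)
  have oK: "finite {u \<in> Ar ?K. src ?K u = fst z} \<and> card {u \<in> Ar ?K. src ?K u = fst z} = ?o (fst (fst z))"
    if "z \<in> Ob ?Phi" for z
  proof -
    have "z \<in> ?h ` ?D" using that unfolding Ob .
    then obtain x \<phi> \<psi> where "z = ((x, \<phi>), \<psi>)" "x \<in> N" "\<phi> \<in> Aut ?H f" by auto
    then have z: "fst z \<in> Ob ?K" "fst (fst z) \<in> N"
      by (simp_all add: hofib_Ob Aut_def) (simp add: N)
    show ?thesis using card_out_hofib[OF G H d1 z(1)] out[OF z(2)] by simp
  qed
  have finPhi: "finite (Ob ?Phi)" unfolding Ob using finN fin by simp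
  \<comment> \<open>The outer fibre has the out-degrees of \<open>?K\<close>, which
    \<open>oK\<close> in turn identifies with those of \<open>lev X 2\<close>.\<close>
  have "hcard ?Phi = (\<Sum>z\<in>Ob ?Phi. 1 / of_nat (card {u \<in> Ar ?K. src ?K u = fst z}))"
    by (rule hcard_hofib[OF K groupoid_prod[OF H H] P finPhi]) (use oK in blast)
  also have "\<dots> = (\<Sum>z\<in>Ob ?Phi. 1 / of_nat (?o (fst (fst z))))"
    using oK by (intro sum.cong refl) simp
  also have "\<dots> = (\<Sum>z\<in>?D. 1 / of_nat (?o (fst z)))"
    unfolding Ob by (subst sum.reindex[OF inj]) (simp add: case_prod_beta)
  also have "\<dots> = (\<Sum>x\<in>N. \<Sum>y\<in>Aut ?H f \<times> Aut ?H a \<times> Aut ?H b. 1 / of_nat (?o x))"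
    unfolding sum.cartesian_product by (simp add: case_prod_beta)
  finally show ?thesis
    unfolding PHI by (simp add: card_cartesian_product mult.assoc)
qed

section \<open>The simplicial groupoid of the operad of words\<close>

abbreviation BSym where
  "BSym \<equiv> bar TSym"

lemma lev_BSym: "lev BSym n = M_grpd (tree_grpd TSym n)"
  by (simp add: bar_def)

lemma groupoid_lev: "groupoid (lev BSym n)"
  unfolding lev_BSym by (intro groupoid_M groupoid_tree_TSym)

lemma face_BSym:
  "face BSym 2 2 = fun_comp M_mu (M_fun \<lparr>onOb = subtrees, onAr = subtrees\<rparr>)"
  "face BSym 2 0 = M_fun \<lparr>onOb = tface (onOb (outp TSym)) (onOb (mul TSym)) 2 0,
     onAr = tface (onAr (outp TSym)) (onAr (mul TSym)) 2 0\<rparr>"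
  "face BSym 2 1 = M_fun \<lparr>onOb = tface (onOb (outp TSym)) (onOb (mul TSym)) (Suc (Suc 0)) (Suc 0),
     onAr = tface (onAr (outp TSym)) (onAr (mul TSym)) (Suc (Suc 0)) (Suc 0)\<rparr>"
  by (simp_all add: bar_def numeral_2_eq_2)

lemma is_functor_face:
  assumes "i \<le> 2"
  shows "is_functor (lev BSym 2) (lev BSym 1) (face BSym 2 i)"
proof -
  consider "i = 0" | "i = 1" | "i = 2" using assms by linarith
  then show ?thesis
  proof cases
    case 1
    then show ?thesis unfolding lev_BSym
      by (simp only: face_BSym) (intro is_functor_M_fun is_functor_truncate is_functor_tout_TSym)
  next
    case 2
    then show ?thesis unfolding lev_BSym
      using is_functor_M_fun[OF is_functor_compose_TSym] by (simp only: face_BSym) (simp add: numeral_2_eq_2)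
  next
    case 3
    then show ?thesis unfolding lev_BSym
      using is_functor_comp[OF is_functor_M_fun[OF is_functor_subtrees[of TSym 1]] is_functor_mu]
      by (simp only: face_BSym) (simp add: numeral_2_eq_2)
  qed
qed

text \<open>Nodes are decorated by permutations of lists of units and leaves by the identity of the
  colour, all of which are loops.\<close>

lemma loops_tree_TSym: "u \<in> Ar (tree_grpd TSym n) \<Longrightarrow> src (tree_grpd TSym n) u = tgt (tree_grpd TSym n) u"
proof (induction n arbitrary: u)
  case 0
  then show ?case by (auto simp: tree_grpd_0 colours_TSym one_grpd_def)
next
  case (Suc n)
  then show ?case
    by (elim tree_grpd_Suc_ArE) (auto simp: tree_grpd_Suc ops_TSym nelists_def subset_iff src_eq_tgt_S_one)
qed

lemma loops_lev: "u \<in> Ar (lev BSym n) \<Longrightarrow> src (lev BSym n) u = tgt (lev BSym n) u"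
  by (auto simp: lev_BSym nelists_def loops_tree_TSym subset_iff)

lemma Aut_lev: "Aut (lev BSym n) x = {u \<in> Ar (lev BSym n). src (lev BSym n) u = x}"
  using loops_lev by (auto simp: Aut_def)

lemma iso_class_lev: "x \<in> Ob (lev BSym n) \<Longrightarrow> iso_class (lev BSym n) x = {x}"
  using groupoid.gid_in[OF groupoid_lev] groupoid.src_gid[OF groupoid_lev] groupoid.tgt_gid[OF groupoid_lev]
  by (force simp: iso_class_def iso_rel_def loops_lev)

text \<open>Components are singletons, so the representative chosen by \<open>rep\<close> is the
  object itself.\<close>

lemma pi0_lev: "pi0 (lev BSym n) = (\<lambda>x. {x}) ` Ob (lev BSym n)"
  using iso_class_lev[of _ n] by (auto simp: pi0_def quotient_def iso_class_def)

lemma rep_singleton [simp]: "rep {x} = x"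
  by (simp add: rep_def)

section \<open>Trees encoded by words\<close>

definition bunch :: "nat \<Rightarrow> unit list" where
  "bunch n = replicate n ()"

text \<open>\<open>corolla w\<close> and \<open>two_level gs vs\<close> are the trees with the root operation \<open>w\<close>, respectively the
  root operations \<open>vs\<close> followed by the operations \<open>gs\<close>; the colour being unique, they are determined by the words.\<close>

definition corolla :: "nat list \<Rightarrow> (unit, unit list list) ltree" where
  "corolla w = Node (map bunch w) (map (\<lambda>_. Leaf ()) w)"

primrec two_level :: "nat list list \<Rightarrow> nat list list \<Rightarrow> (unit, unit list list) ltree list" where
  "two_level gs [] = []"
| "two_level gs (v # vs) = Node (map bunch v) (map corolla (take (length v) gs)) # two_level (drop (length v) gs) vs"

lemma inj_bunch: "inj bunch"
  by (rule inj_on_inverseI[where g = length]) (simp add: bunch_def)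

lemma inj_corolla: "inj corolla"
  using inj_mapI[OF inj_bunch] by (auto simp: corolla_def inj_def)

lemma bunch_length: "bunch (length xs) = xs"
  by (rule unit_list_eqI) (simp add: bunch_def)

text \<open>An operation is read as the word of the arities of its entries; nonempty entries give
  positive letters.\<close>

lemma bunch_words: "nelists (nelists UNIV) = map bunch ` W"
proof (intro set_eqI iffI)
  fix q :: "unit list list" assume "q \<in> nelists (nelists UNIV)"
  then have "map length q \<in> W" by (auto simp: W_def nelists_def)
  moreover have "q = map bunch (map length q)" by (simp add: bunch_length map_idI)
  ultimately show "q \<in> map bunch ` W" by (rule rev_image_eqI)
qed (fastforce simp: W_def nelists_def bunch_def)

lemma Ob_tree_1: "Ob (tree_grpd TSym (Suc 0)) = corolla ` W"
proof (intro set_eqI iffI)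
  fix x assume x: "x \<in> Ob (tree_grpd TSym (Suc 0))"
  then obtain q ts where q: "x = Node q ts" "q \<in> nelists (nelists UNIV)" "ts \<in> nelists (Leaf ` UNIV)" "length ts = length q"
    by (cases x) (auto simp: Node_Ob_TSym tree_grpd_0 colours_TSym one_grpd_def elim: tree_grpd_SucE)
  obtain w where w: "w \<in> W" "q = map bunch w" using q(2) by (auto simp: bunch_words)
  have "t = Leaf ()" if "t \<in> set ts" for t
    using q(3) that by (auto simp: nelists_def)
  then have "ts = map (\<lambda>_. Leaf ()) w"
    using q(4) w(2) by (intro nth_equalityI) simp_all
  then show "x \<in> corolla ` W" using q(1) w by (auto simp: corolla_def)
next
  fix x assume "x \<in> corolla ` W"
  then obtain w where w: "w \<in> W" "x = corolla w" by blast
  then have "map bunch w \<in> nelists (nelists UNIV)" by (simp add: bunch_words)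
  then show "x \<in> Ob (tree_grpd TSym (Suc 0))"
    using w by (auto simp: corolla_def Node_Ob_TSym tree_grpd_0 colours_TSym one_grpd_def nelists_def)
qed

lemma Ob_lev_1: "Ob (lev BSym 1) = map corolla ` (forests - {[]})"
proof -
  have nelists: "nelists A = lists A - {[]}" for A :: "'z set"
    by (auto simp: nelists_def lists_eq_set)
  have "nelists (corolla ` W) = map corolla ` lists W - {[]}"
    unfolding nelists by (simp add: lists_image)
  also have "\<dots> = map corolla ` (forests - {[]})"
    unfolding forests_def by blast
  finally show ?thesis by (simp add: lev_BSym Ob_tree_1)
qed

lemma bunch_mult: "bunch (k * n) = concat (replicate k (bunch n))"
  by (rule unit_list_eqI) (simp add: bunch_def)

text \<open>Arities multiply in \<open>T_S Sym\<close>, so operadic composition of tuples becomes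
  grafting of words.\<close>

lemma lmul_bunch:
  "length v = length gs \<Longrightarrow>
    lmul (onOb (icomp (T_S Sym))) (map (map bunch) gs) (map bunch v) = map bunch (layer v gs)"
proof (induction v gs rule: list_induct2)
  case (Cons k v g gs)
  then show ?case by (simp add: icomp_T_Sym bunch_mult) (simp add: bunch_def)
qed simp

lemma concat_map_replicate_length: "concat (map (\<lambda>x. replicate (length x) a) xs) = replicate (sum_list (map length xs)) a"
  by (induction xs) (simp_all add: replicate_add)

lemma face_two_level:
  assumes "arity vs = length gs"
  shows "onOb (face BSym 2 2) (two_level gs vs) = map corolla gs"
    and "onOb (face BSym 2 0) (two_level gs vs) = map corolla vs"
    and "onOb (face BSym 2 1) (two_level gs vs) = map corolla (graft vs gs)"
proof -
  show "onOb (face BSym 2 2) (two_level gs vs) = map corolla gs"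
    unfolding face_BSym fun_comp_def M_mu_def M_fun_def
    using assms by (induction vs arbitrary: gs) (auto simp flip: map_append)
  show "onOb (face BSym 2 0) (two_level gs vs) = map corolla vs"
    unfolding face_BSym M_fun_def
    using assms by (induction vs arbitrary: gs) (auto simp: tface_truncate corolla_def map_replicate_const)
  have "tface t (onOb (mul TSym)) (Suc (Suc 0)) (Suc 0) (Node (map bunch v) (map corolla hs)) = corolla (layer v hs)"
    if "length v = length hs" for t v hs
    unfolding tface_compose ltree.sel mul_TSym
    using lmul_bunch[OF that] length_layer[OF that]
    by (simp add: o_def corolla_def map_replicate_const length_concat concat_map_replicate_length)
  then show "onOb (face BSym 2 1) (two_level gs vs) = map corolla (graft vs gs)"
    unfolding face_BSym M_fun_def
    using assms by (induction vs arbitrary: gs) (auto simp del: tface.simps)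
qed

lemma two_level_in:
  assumes "gs \<in> forests" "vs \<in> forests" "arity vs = length gs" "vs \<noteq> []"
  shows "two_level gs vs \<in> Ob (lev BSym 2)"
proof -
  have "set (two_level gs vs) \<subseteq> Ob (tree_grpd TSym (Suc (Suc 0)))"
    using assms(1-3)
  proof (induction vs arbitrary: gs)
    case Nil
    then show ?case by simp
  next
    case (Cons v vs)
    let ?g = "take (length v) gs" and ?g' = "drop (length v) gs"
    have g: "?g \<in> forests" "?g' \<in> forests" using Cons.prems(1) by (metis append_forests append_take_drop_id)+
    have v: "v \<in> W" "vs \<in> forests" using Cons.prems(2) by (auto simp: forests_def)
    have "map bunch v \<in> nelists (nelists UNIV)" using v(1) by (simp add: bunch_words)
    moreover have "map corolla ?g \<in> nelists (Ob (tree_grpd TSym (Suc 0)))"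
      using g(1) v(1) Cons.prems(3) unfolding Ob_tree_1 nelists_def forests_def lists_eq_set
      by (auto simp: W_def)
    moreover have "length (map corolla ?g) = length (map bunch v)"
      using Cons.prems(3) by simp
    ultimately have "Node (map bunch v) (map corolla ?g) \<in> Ob (tree_grpd TSym (Suc (Suc 0)))"
      unfolding Node_Ob_TSym by blast
    moreover have "set (two_level ?g' vs) \<subseteq> Ob (tree_grpd TSym (Suc (Suc 0)))"
      using g v Cons.prems(3) by (intro Cons.IH) auto
    ultimately show ?case by simp
  qed
  moreover have "two_level gs vs \<noteq> []" using assms(4) by (cases vs) auto
  ultimately show ?thesis by (simp add: lev_BSym nelists_def numeral_2_eq_2)
qed

text \<open>A strict Segal property: a two-level forest is recovered from its two layers, the leaf
  layer being cut up by the root arities. It leaves at most one point in the strict fibre behind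
  each incidence coefficient.\<close>

lemma two_level_unique:
  assumes "x \<in> Ob (lev BSym 2)" "onOb (face BSym 2 2) x = map corolla gs" "onOb (face BSym 2 0) x = map corolla vs"
  shows "arity vs = length gs \<and> x = two_level gs vs"
proof -
  have "set x \<subseteq> Ob (tree_grpd TSym (Suc (Suc 0)))"
    using assms(1) by (simp add: lev_BSym nelists_def numeral_2_eq_2)
  then show ?thesis
    using assms(2,3) unfolding face_BSym fun_comp_def M_mu_def M_fun_def
  proof (induction x arbitrary: gs vs)
    case Nil
    then show ?case by simp
  next
    case (Cons t x)
    obtain q ts where t: "t = Node q ts" "length ts = length q"
      using Cons.prems(1) by (cases t) (auto simp: Node_Ob_TSym elim: tree_grpd_SucE)
    obtain v vs' where vs: "vs = v # vs'" using Cons.prems(3) by (cases vs) auto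
    have q: "q = map bunch v" using Cons.prems(3) by (simp add: t(1) vs tface_truncate corolla_def)
    have len: "length ts = length v" using t(2) q by simp
    have gs: "ts @ concat (map subtrees x) = map corolla (take (length v) gs) @ map corolla (drop (length v) gs)"
      using Cons.prems(2) by (simp add: t(1) flip: map_append)
    have "length v \<le> length gs"
      using Cons.prems(2) len by (auto simp: t(1) dest: arg_cong[of _ _ length])
    then have g: "ts = map corolla (take (length v) gs)" "concat (map subtrees x) = map corolla (drop (length v) gs)"
      using gs len by (simp_all add: append_eq_append_conv min_def)
    have "arity vs' = length (drop (length v) gs) \<and> x = two_level (drop (length v) gs) vs'"
      using Cons.prems g(2) by (intro Cons.IH) (simp_all add: vs)
    then show ?case
      using \<open>length v \<le> length gs\<close> g(1) by (simp add: vs t(1) q)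
  qed
qed

section \<open>Automorphism groups and factorials\<close>

lemma out_S_bunch:
  assumes "0 < n"
  shows "card {u \<in> Ar (S_grpd one_grpd). src (S_grpd one_grpd) u = bunch n} = fact n"
    and "finite {u \<in> Ar (S_grpd one_grpd). src (S_grpd one_grpd) u = bunch n}"
proof -
  show *: "card {u \<in> Ar (S_grpd one_grpd). src (S_grpd one_grpd) u = bunch n} = fact n"
    using card_out_S_one[of "bunch n"] assms by (simp add: bunch_def)
  show "finite {u \<in> Ar (S_grpd one_grpd). src (S_grpd one_grpd) u = bunch n}"
    by (rule card_ge_0_finite) (simp add: *)
qed

lemma out_ops_bunch:
  assumes "w \<in> W"
  shows "finite {u \<in> Ar (ops TSym). src (ops TSym) u = map bunch w}"
    and "card {u \<in> Ar (ops TSym). src (ops TSym) u = map bunch w} = wfact w"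
proof -
  have ne: "map bunch w \<noteq> []" using assms by (simp add: W_def)
  have *: "finite {u \<in> Ar (S_grpd one_grpd). src (S_grpd one_grpd) u = x}" if "x \<in> set (map bunch w)" for x
    using that assms by (auto simp: W_def intro: out_S_bunch)
  have "(\<Prod>x\<leftarrow>map bunch w. card {u \<in> Ar (S_grpd one_grpd). src (S_grpd one_grpd) u = x}) = wfact w"
    using assms by (auto simp: wfact_def W_def out_S_bunch o_def cong: map_cong)
  then show "finite {u \<in> Ar (ops TSym). src (ops TSym) u = map bunch w}"
    "card {u \<in> Ar (ops TSym). src (ops TSym) u = map bunch w} = wfact w"
    unfolding ops_TSym out_M[OF ne] using card_lists_src[where xs = "map bunch w", OF *] by simp_all
qed

lemma out_tree_0: "{u \<in> Ar (tree_grpd TSym 0). src (tree_grpd TSym 0) u = Leaf ()} = {Leaf ()}"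
  by (auto simp: tree_grpd_0 colours_TSym one_grpd_def)

lemma out_corolla:
  assumes "w \<in> W"
  shows "finite {u \<in> Ar (tree_grpd TSym (Suc 0)). src (tree_grpd TSym (Suc 0)) u = corolla w}"
    and "card {u \<in> Ar (tree_grpd TSym (Suc 0)). src (tree_grpd TSym (Suc 0)) u = corolla w} = wfact w"
proof -
  have x: "Node (map bunch w) (map (\<lambda>_. Leaf ()) w) \<in> Ob (tree_grpd TSym (Suc 0))"
    using assms Ob_tree_1 by (auto simp: corolla_def)
  have *: "finite {u \<in> Ar (tree_grpd TSym 0). src (tree_grpd TSym 0) u = t}" if "t \<in> set (map (\<lambda>_. Leaf ()) w)" for t
    using that by (auto simp: out_tree_0)
  show "finite {u \<in> Ar (tree_grpd TSym (Suc 0)). src (tree_grpd TSym (Suc 0)) u = corolla w}"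
    "card {u \<in> Ar (tree_grpd TSym (Suc 0)). src (tree_grpd TSym (Suc 0)) u = corolla w} = wfact w"
    unfolding corolla_def using card_out_Node[OF inp_TSym x out_ops_bunch(1)[OF assms] *]
    by (simp_all add: out_tree_0 o_def out_ops_bunch[OF assms] map_replicate_const)
qed

lemma out_corollas:
  assumes "gs \<in> forests"
  shows "finite {us. set us \<subseteq> Ar (tree_grpd TSym (Suc 0)) \<and> map (src (tree_grpd TSym (Suc 0))) us = map corolla gs}"
    and "card {us. set us \<subseteq> Ar (tree_grpd TSym (Suc 0)) \<and> map (src (tree_grpd TSym (Suc 0))) us = map corolla gs} = wsfact gs"
    and "(\<Prod>x\<leftarrow>map corolla gs. card {u \<in> Ar (tree_grpd TSym (Suc 0)). src (tree_grpd TSym (Suc 0)) u = x}) = wsfact gs"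
proof -
  have W: "g \<in> W" if "g \<in> set gs" for g using that assms by (auto simp: forests_def)
  have *: "finite {u \<in> Ar (tree_grpd TSym (Suc 0)). src (tree_grpd TSym (Suc 0)) u = x}" if "x \<in> set (map corolla gs)" for x
    using that by (auto intro: out_corolla W)
  show p: "(\<Prod>x\<leftarrow>map corolla gs. card {u \<in> Ar (tree_grpd TSym (Suc 0)). src (tree_grpd TSym (Suc 0)) u = x}) = wsfact gs"
    by (auto simp: wsfact_def out_corolla W o_def cong: map_cong)
  show "finite {us. set us \<subseteq> Ar (tree_grpd TSym (Suc 0)) \<and> map (src (tree_grpd TSym (Suc 0))) us = map corolla gs}"
    "card {us. set us \<subseteq> Ar (tree_grpd TSym (Suc 0)) \<and> map (src (tree_grpd TSym (Suc 0))) us = map corolla gs} = wsfact gs"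
    using card_lists_src[where xs = "map corolla gs", OF *] unfolding p by simp_all
qed

lemma Aut_corollas:
  assumes "ws \<in> forests" "ws \<noteq> []"
  shows "finite (Aut (lev BSym 1) (map corolla ws))" "card (Aut (lev BSym 1) (map corolla ws)) = wsfact ws"
  unfolding Aut_lev unfolding lev_BSym using assms by (simp_all add: out_M out_corollas del: M_grpd_simps)

text \<open>By \<open>card_out_Node\<close> the root operations contribute \<open>wsfact vs\<close>
  and the corollas above them \<open>wsfact gs\<close>.\<close>

lemma out_two_level:
  assumes "gs \<in> forests" "vs \<in> forests" "arity vs = length gs" "vs \<noteq> []"
  shows "finite {u \<in> Ar (lev BSym 2). src (lev BSym 2) u = two_level gs vs}"
    and "card {u \<in> Ar (lev BSym 2). src (lev BSym 2) u = two_level gs vs} = wsfact gs * wsfact vs"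
proof -
  let ?T = "tree_grpd TSym (Suc (Suc 0))"
  have ne: "two_level gs vs \<noteq> []" using assms(4) by (cases vs) auto
  have *: "(\<forall>x\<in>set (two_level gs vs). finite {u \<in> Ar ?T. src ?T u = x}) \<and>
      (\<Prod>x\<leftarrow>two_level gs vs. card {u \<in> Ar ?T. src ?T u = x}) = wsfact gs * wsfact vs"
    using assms(1-3)
  proof (induction vs arbitrary: gs)
    case Nil
    then show ?case by (simp add: wsfact_def)
  next
    case (Cons v vs)
    let ?g = "take (length v) gs" and ?g' = "drop (length v) gs"
    have g: "?g \<in> forests" "?g' \<in> forests" using Cons.prems(1) by (metis append_forests append_take_drop_id)+
    have v: "v \<in> W" "[v] \<in> forests" "vs \<in> forests" using Cons.prems(2) by (auto simp: forests_def)
    have "two_level ?g [v] \<in> Ob (lev BSym 2)"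
      using Cons.prems(3) by (intro two_level_in g v) auto
    then have x: "Node (map bunch v) (map corolla ?g) \<in> Ob ?T"
      using Cons.prems(3) by (simp add: lev_BSym nelists_def numeral_2_eq_2 min_def)
    have fin: "finite {u \<in> Ar (tree_grpd TSym (Suc 0)). src (tree_grpd TSym (Suc 0)) u = t}" if "t \<in> set (map corolla ?g)" for t
      using that g(1) by (auto simp: forests_def intro!: out_corolla)
    have IH: "(\<forall>x\<in>set (two_level ?g' vs). finite {u \<in> Ar ?T. src ?T u = x}) \<and>
        (\<Prod>x\<leftarrow>two_level ?g' vs. card {u \<in> Ar ?T. src ?T u = x}) = wsfact ?g' * wsfact vs"
      using g v Cons.prems(3) by (intro Cons.IH) auto
    have "wsfact gs = wsfact ?g * wsfact ?g'" by (simp flip: wsfact_append)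
    then show ?case
      using IH card_out_Node[OF inp_TSym x out_ops_bunch(1)[OF v(1)] fin]
      by (simp add: out_corollas(3)[OF g(1), unfolded map_map] out_ops_bunch[OF v(1)] wsfact_simps)
  qed
  then have fin: "\<And>x. x \<in> set (two_level gs vs) \<Longrightarrow> finite {u \<in> Ar ?T. src ?T u = x}" by blast
  show "finite {u \<in> Ar (lev BSym 2). src (lev BSym 2) u = two_level gs vs}"
    "card {u \<in> Ar (lev BSym 2). src (lev BSym 2) u = two_level gs vs} = wsfact gs * wsfact vs"
    unfolding lev_BSym out_M[OF ne] numeral_2_eq_2 using card_lists_src[where xs = "two_level gs vs", OF fin] * by simp_all
qed

lemma inc_coeff_BSym:
  assumes "fs \<in> forests - {[]}" "gs \<in> forests - {[]}" "vs \<in> forests - {[]}"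
  shows "inc_coeff BSym {map corolla fs} {map corolla gs} {map corolla vs} =
    (if (gs, vs) \<in> factorizations fs then weight gs vs else 0)"
proof -
  define N where "N = {x \<in> Ob (lev BSym 2). onOb (face BSym 2 1) x = map corolla fs \<and>
    onOb (face BSym 2 2) x = map corolla gs \<and> onOb (face BSym 2 0) x = map corolla vs}"
  have inj: "inj (map corolla)" by (rule inj_mapI[OF inj_corolla])
  have N_eq: "N = (if (gs, vs) \<in> factorizations fs then {two_level gs vs} else {})"
  proof -
    have "x = two_level gs vs \<and> (gs, vs) \<in> factorizations fs" if "x \<in> N" for x
    proof -
      have x: "arity vs = length gs" "x = two_level gs vs"
        using that two_level_unique[of x gs vs] by (auto simp: N_def)
      have "map corolla (graft vs gs) = map corolla fs"
        using that face_two_level(3)[OF x(1)] by (simp add: N_def x(2))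
      then have "graft vs gs = fs" using inj by (simp add: inj_eq)
      then show ?thesis using assms x by (simp add: in_factorizations)
    qed
    moreover have "two_level gs vs \<in> N" if "(gs, vs) \<in> factorizations fs"
      using that assms by (simp add: N_def in_factorizations two_level_in face_two_level face_two_level(3)[unfolded One_nat_def])
    ultimately show ?thesis by auto
  qed
  have "hcard (Phi BSym (map corolla fs) (map corolla gs) (map corolla vs)) =
      (\<Sum>x\<in>N. of_nat (card (Aut (lev BSym 1) (map corolla fs)) * card (Aut (lev BSym 1) (map corolla gs)) *
         card (Aut (lev BSym 1) (map corolla vs))) / of_nat (card {u \<in> Ar (lev BSym 2). src (lev BSym 2) u = x}))"
  proof (rule hcard_Phi[OF groupoid_lev groupoid_lev is_functor_face loops_lev _ _ _ N_def])
    fix x assume "x \<in> N"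
    then have "x = two_level gs vs" "(gs, vs) \<in> factorizations fs" by (auto simp: N_eq split: if_splits)
    then show "finite {u \<in> Ar (lev BSym 2). src (lev BSym 2) u = x}"
      using assms by (auto simp: in_factorizations intro!: out_two_level)
  qed (use assms in \<open>auto simp: N_eq intro!: Aut_corollas[unfolded One_nat_def]\<close>)
  \<comment> \<open>The product \<open>gs! vs!\<close> in the numerator comes from the comparison
    arrows at the two layers, the one in the denominator from the two-level forest. They cancel; the
    denominator of \<open>weight\<close> is supplied afterwards by the division in
    \<open>inc_coeff\<close>.\<close>
  also have "\<dots> = (if (gs, vs) \<in> factorizations fs then of_nat (wsfact fs * wsfact gs * wsfact vs) / of_nat (wsfact gs * wsfact vs) else 0)"
    using assms by (auto simp: N_eq Aut_corollas[unfolded One_nat_def] in_factorizations out_two_level)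
  finally show ?thesis
    using assms by (auto simp: inc_coeff_def Aut_corollas[unfolded One_nat_def] weight_def in_factorizations)
qed

section \<open>The degeneracy and the counit\<close>

lemma degen_BSym:
  "degen BSym 0 0 = M_fun \<lparr>onOb = tdegen (onOb (outp TSym)) (onOb (unt TSym)) 0 0,
     onAr = tdegen (onAr (outp TSym)) (onAr (unt TSym)) 0 0\<rparr>"
  by (simp add: bar_def)

lemma tdegen_Leaf:
  "tdegen (onOb (outp TSym)) (onOb (unt TSym)) 0 0 (Leaf ()) = corolla [1]"
  "tdegen (onAr (outp TSym)) (onAr (unt TSym)) 0 0 (Leaf ()) = Node [([()], id)] [Leaf ()]"
  by (simp_all add: T_M_def T_S_def Sym_def S_eta_def corolla_def bunch_def)

text \<open>There is one tree of level 0, with one arrow on it, so everything reduces to the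
  identity of \<open>corolla [1]\<close>.\<close>

lemma is_functor_degen: "is_functor (lev BSym 0) (lev BSym 1) (degen BSym 0 0)"
  unfolding lev_BSym degen_BSym
proof (rule is_functor_M_fun)
  let ?F = "\<lparr>onOb = tdegen (onOb (outp TSym)) (onOb (unt TSym)) 0 0,
     onAr = tdegen (onAr (outp TSym)) (onAr (unt TSym)) 0 0\<rparr>"
  have all: "Ob (tree_grpd TSym 0) = {Leaf ()}" "Ar (tree_grpd TSym 0) = {Leaf ()}"
    by (auto simp: tree_grpd_0 colours_TSym one_grpd_def)
  have "corolla [1] \<in> Ob (tree_grpd TSym 1)"
    by (simp add: Ob_tree_1 W_def)
  moreover have "Node [([()], id)] [Leaf ()] \<in> Ar (tree_grpd TSym 1)"
    by (simp add: Node_Ob_TSym nelists_def S_one_simps permutes_id all)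
  moreover have "src (tree_grpd TSym 1) (Node [([()], id)] [Leaf ()]) = corolla [1]"
    "tgt (tree_grpd TSym 1) (Node [([()], id)] [Leaf ()]) = corolla [1]"
    by (simp_all add: tree_grpd_Suc ops_TSym S_one_simps corolla_def bunch_def tree_grpd_0)
  moreover have "gcomp (tree_grpd TSym 1) (Node [([()], id)] [Leaf ()]) (Node [([()], id)] [Leaf ()]) =
      Node [([()], id)] [Leaf ()]"
    by (simp add: tree_grpd_Suc ops_TSym S_one_simps tree_grpd_0)
  ultimately show "is_functor (tree_grpd TSym 0) (tree_grpd TSym 1) ?F"
    unfolding is_functor_def by (simp add: all tdegen_Leaf tree_grpd_0(3-6) del: tdegen.simps)
qed

text \<open>A list of words \<open>[1]\<close> has a trivial automorphism group, so the fibre over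
  it is one object with one arrow out of it; over any other list it is empty.\<close>

lemma hcard_degen_BSym:
  assumes "ws \<in> forests - {[]}"
  shows "hcard (hofib (lev BSym 0) (lev BSym 1) (degen BSym 0 0) (map corolla ws)) = (if set ws \<subseteq> {[1]} then 1 else 0)"
proof -
  let ?K = "hofib (lev BSym 0) (lev BSym 1) (degen BSym 0 0) (map corolla ws)"
  let ?x = "replicate (length ws) (Leaf ()) :: (unit, unit list list) ltree list"
  have inj: "inj (map corolla)" by (rule inj_mapI[OF inj_corolla])
  have x: "x = ?x \<and> set ws \<subseteq> {[1]}" if "onOb (degen BSym 0 0) x = map corolla ws" "x \<in> Ob (lev BSym 0)" for x
  proof -
    have "t = Leaf ()" if "t \<in> set x" for t
      using that \<open>x \<in> Ob (lev BSym 0)\<close> by (auto simp: lev_BSym nelists_def tree_grpd_0)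
    then have x: "x = replicate (length x) (Leaf ())" by (metis replicate_length_same)
    have "onOb (degen BSym 0 0) (replicate n (Leaf ())) = map corolla (units n)" for n
      by (simp add: degen_BSym M_fun_def tdegen_Leaf del: tdegen.simps)
    then have "map corolla (units (length x)) = map corolla ws"
      using that(1) x by metis
    then have "units (length x) = ws" by (rule injD[OF inj])
    then show ?thesis using x by (auto split: if_splits)
  qed
  have Ob: "Ob ?K = (if set ws \<subseteq> {[1]} then {?x} \<times> Aut (lev BSym 1) (map corolla ws) else {})"
  proof -
    have mem: "?x \<in> Ob (lev BSym 0)"
      using assms by (auto simp: lev_BSym nelists_def tree_grpd_0 colours_TSym one_grpd_def)
    have deg: "onOb (degen BSym 0 0) ?x = map corolla ws" if "set ws \<subseteq> {[1]}"
    proof -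
      have "onOb (degen BSym 0 0) ?x = map corolla (units (length ws))"
        by (simp add: degen_BSym M_fun_def tdegen_Leaf del: tdegen.simps)
      then show ?thesis by (simp only: unit_words_eq[OF that])
    qed
    show ?thesis
    proof (intro set_eqI)
      fix p :: "(unit, unit list list) ltree list \<times> (unit, unit s_arrow list) ltree list"
      obtain y \<phi> where p: "p = (y, \<phi>)" by (cases p)
      have "(y, \<phi>) \<in> Ob ?K \<longleftrightarrow> set ws \<subseteq> {[1]} \<and> y = ?x \<and> \<phi> \<in> Aut (lev BSym 1) (map corolla ws)"
      proof
        assume "(y, \<phi>) \<in> Ob ?K"
        then have *: "y \<in> Ob (lev BSym 0)" "\<phi> \<in> Ar (lev BSym 1)"
          "src (lev BSym 1) \<phi> = onOb (degen BSym 0 0) y" "tgt (lev BSym 1) \<phi> = map corolla ws"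
          unfolding hofib_Ob by blast+
        then have src: "src (lev BSym 1) \<phi> = map corolla ws" by (simp only: loops_lev)
        then have "onOb (degen BSym 0 0) y = map corolla ws" using *(3) by simp
        then show "set ws \<subseteq> {[1]} \<and> y = ?x \<and> \<phi> \<in> Aut (lev BSym 1) (map corolla ws)"
          using x[OF _ *(1)] * src by (simp add: Aut_def)
      next
        assume *: "set ws \<subseteq> {[1]} \<and> y = ?x \<and> \<phi> \<in> Aut (lev BSym 1) (map corolla ws)"
        then show "(y, \<phi>) \<in> Ob ?K"
          unfolding hofib_Ob using mem deg by (simp add: Aut_def)
      qed
      then show "p \<in> Ob ?K \<longleftrightarrow> p \<in> (if set ws \<subseteq> {[1]} then {?x} \<times> Aut (lev BSym 1) (map corolla ws) else {})"
        unfolding p by (cases "set ws \<subseteq> {[1]}") simp_all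
    qed
  qed
  have out: "{u \<in> Ar (lev BSym 0). src (lev BSym 0) u = ?x} = {replicate (length ws) (Leaf ())}"
  proof -
    have "u = replicate (length ws) (Leaf ())" if "u \<in> Ar (lev BSym 0)" "src (lev BSym 0) u = ?x" for u
    proof -
      have "t = Leaf ()" if "t \<in> set u" for t
        using that \<open>u \<in> Ar (lev BSym 0)\<close> by (auto simp: lev_BSym nelists_def tree_grpd_0)
      moreover have "length u = length ws"
        using arg_cong[OF that(2), of length] by (simp add: lev_BSym)
      ultimately show ?thesis by (metis replicate_length_same)
    qed
    moreover have "replicate (length ws) (Leaf ()) \<in> {u \<in> Ar (lev BSym 0). src (lev BSym 0) u = ?x}"
      using assms by (auto simp: lev_BSym nelists_def tree_grpd_0 colours_TSym one_grpd_def)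
    ultimately show ?thesis by blast
  qed
  have "hcard ?K = (\<Sum>p\<in>Ob ?K. 1 / of_nat (card {f \<in> Ar (lev BSym 0). src (lev BSym 0) f = fst p}))"
  proof (rule hcard_hofib[OF groupoid_lev groupoid_lev is_functor_degen])
    show "finite (Ob ?K)" unfolding Ob using assms by (simp add: Aut_corollas[unfolded One_nat_def])
    fix p assume "p \<in> Ob ?K"
    then have "fst p = ?x" unfolding Ob by (auto split: if_splits)
    then show "finite {f \<in> Ar (lev BSym 0). src (lev BSym 0) f = fst p}" by (simp only: out) simp
  qed
  also have "\<dots> = (\<Sum>p\<in>Ob ?K. 1)"
  proof (rule sum.cong[OF refl])
    fix p assume "p \<in> Ob ?K"
    then have "fst p = ?x" unfolding Ob by (auto split: if_splits)
    then show "1 / of_nat (card {f \<in> Ar (lev BSym 0). src (lev BSym 0) f = fst p}) = (1 :: rat)" by (simp only: out) simp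
  qed
  also have "\<dots> = of_nat (card (Ob ?K))" by simp
  also have "\<dots> = (if set ws \<subseteq> {[1]} then 1 else 0)"
  proof (cases "set ws \<subseteq> {[1]}")
    case True
    have "wsfact ws = 1" using wsfact_units[of "length ws"] unfolding unit_words_eq[OF True] .
    then have "card ({?x} \<times> Aut (lev BSym 1) (map corolla ws)) = 1"
      using assms by (simp add: Aut_corollas[unfolded One_nat_def] card_cartesian_product)
    then show ?thesis unfolding Ob using True by simp
  next
    case False
    then show ?thesis unfolding Ob by simp
  qed
  finally show ?thesis .
qed

text \<open>The empty forest becomes the adjoined unit, since \<open>M_grpd\<close> has only
  nonempty tuples; every other forest is a one-point component.\<close>

definition component :: "nat list list \<Rightarrow> (unit, unit list list) ltree list set option" where
  "component ws = (if ws = [] then None else Some {map corolla ws})"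

lemma inj_component: "inj component"
  using inj_mapI[OF inj_corolla] by (auto simp: component_def inj_def)

lemma component_cases: "component ` forests = insert None (Some ` pi0 (lev BSym 1))"
proof -
  have "forests = insert [] (forests - {[]})" by auto
  then have "component ` forests = insert (component []) (component ` (forests - {[]}))" by (metis image_insert)
  then show ?thesis unfolding pi0_lev Ob_lev_1 by (auto simp: component_def image_image)
qed

text \<open>Keeps the adjoined unit out of the coproduct of a component: the root layer has as many
  nodes as \<open>ws\<close>, and each root has at least one input.\<close>

lemma factorizations_nonempty:
  assumes "ws \<noteq> []" "(gs, vs) \<in> factorizations ws"
  shows "gs \<noteq> []" "vs \<noteq> []"
proof -
  show vs: "vs \<noteq> []" using assms by (auto simp: in_factorizations)
  then show "gs \<noteq> []" using assms(2) by (cases vs) (auto simp: in_factorizations forests_def W_def)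
qed

lemma weight_nz: "weight gs vs \<noteq> 0"
  by (simp add: weight_def)

lemma word_bialgebra_incidence:
  "word_bialgebra (incidence_bialgebra BSym (@)) component
     (\<lambda>a b. case (a, b) of (None, _) \<Rightarrow> b | (_, None) \<Rightarrow> a
        | (Some a', Some b') \<Rightarrow> Some (iso_class (lev BSym 1) (rep a' @ rep b')))
     (\<lambda>x. case x of None \<Rightarrow> delta (None, None)
        | Some f \<Rightarrow> \<Sum>(a, b)\<in>{(a, b). a \<in> pi0 (lev BSym 1) \<and> b \<in> pi0 (lev BSym 1) \<and> inc_coeff BSym f a b \<noteq> 0}.
            Poly_Mapping.single (Some a, Some b) (inc_coeff BSym f a b))
     (\<lambda>x. case x of None \<Rightarrow> 1 | Some f \<Rightarrow> hcard (hofib (lev BSym 0) (lev BSym 1) (degen BSym 0 0) (rep f)))"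
  (is "word_bialgebra ?H _ ?m ?D ?e")
proof
  show "inj_on component forests" using inj_component by (rule inj_on_subset) simp
  show "basis ?H = component ` forests"
    by (simp add: incidence_bialgebra_def component_cases)
  show "bone ?H = delta (component [])"
    by (simp add: incidence_bialgebra_def component_def)
  show "bmult ?H v w = lin_ext (\<lambda>a. lin_ext (\<lambda>b. delta (?m a b)) w) v" for v w
    by (simp add: incidence_bialgebra_def)
  show "comult ?H = lin_ext ?D" "counit ?H = lin_form ?e"
    by (simp_all add: incidence_bialgebra_def)
  show "?m (component us) (component ws) = component (us @ ws)" if "us \<in> forests" "ws \<in> forests" for us ws
  proof (cases "us = [] \<or> ws = []")
    case False
    then have "map corolla us @ map corolla ws \<in> Ob (lev BSym 1)"
      using that unfolding Ob_lev_1 by (intro image_eqI[of _ _ "us @ ws"]) auto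
    then show ?thesis using False by (simp add: component_def iso_class_lev)
  qed (auto simp: component_def split: option.split)
  show "?e (component ws) = (if set ws \<subseteq> {[1]} then 1 else 0)" if "ws \<in> forests" for ws
    using that hcard_degen_BSym[of ws] by (auto simp: component_def)
  show "?D (component ws) = (\<Sum>(gs, vs)\<in>factorizations ws. Poly_Mapping.single (component gs, component vs) (weight gs vs))"
    if ws: "ws \<in> forests" for ws
  proof (cases "ws = []")
    case True
    then show ?thesis by (simp add: component_def factorizations_Nil weight_def wsfact_def)
  next
    case False
    let ?c = "\<lambda>ws. {map corolla ws}"
    let ?s = "\<lambda>(a, b). Poly_Mapping.single (Some a, Some b) (inc_coeff BSym (?c ws) a b)"
    have mem: "gs \<in> forests - {[]}" "vs \<in> forests - {[]}" if "(gs, vs) \<in> factorizations ws" for gs vs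
      using factorizations_nonempty[OF False that] that by (simp_all add: in_factorizations)
    have coeff: "inc_coeff BSym (?c ws) (?c gs) (?c vs) = (if (gs, vs) \<in> factorizations ws then weight gs vs else 0)"
      if "gs \<in> forests - {[]}" "vs \<in> forests - {[]}" for gs vs
      using inc_coeff_BSym[of ws gs vs] that ws False by simp
    \<comment> \<open>The comultiplication sums over the nonzero coefficients; weights never vanish,
      so these are indexed by the factorizations.\<close>
    have "{(a, b). a \<in> pi0 (lev BSym 1) \<and> b \<in> pi0 (lev BSym 1) \<and> inc_coeff BSym (?c ws) a b \<noteq> 0}
        = (\<lambda>(gs, vs). (?c gs, ?c vs)) ` factorizations ws" (is "?A = ?B")
    proof (intro subset_antisym subsetI)
      fix p assume "p \<in> ?A"
      then obtain gs vs where p: "p = (?c gs, ?c vs)" "gs \<in> forests - {[]}" "vs \<in> forests - {[]}"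
        "inc_coeff BSym (?c ws) (?c gs) (?c vs) \<noteq> 0"
        unfolding pi0_lev Ob_lev_1 by blast
      then have "(gs, vs) \<in> factorizations ws" using coeff[OF p(2,3)] by (simp split: if_splits)
      then show "p \<in> ?B" using p(1) by (intro image_eqI[of _ _ "(gs, vs)"]) auto
    next
      fix p assume "p \<in> ?B"
      then obtain gs vs where "p = (?c gs, ?c vs)" "(gs, vs) \<in> factorizations ws" by auto
      then show "p \<in> ?A"
        using mem[of gs vs] coeff[of gs vs] weight_nz unfolding pi0_lev Ob_lev_1 by auto
    qed
    moreover have "inj_on (\<lambda>(gs, vs). (?c gs, ?c vs)) (factorizations ws)"
      using inj_mapI[OF inj_corolla] by (auto simp: inj_on_def inj_def)
    ultimately have "?D (component ws) = (\<Sum>p\<in>factorizations ws. ?s ((\<lambda>(gs, vs). (?c gs, ?c vs)) p))"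
      using False by (simp add: component_def sum.reindex o_def)
    also have "\<dots> = (\<Sum>(gs, vs)\<in>factorizations ws. Poly_Mapping.single (component gs, component vs) (weight gs vs))"
    proof (rule sum.cong[OF refl])
      fix p assume p: "p \<in> factorizations ws"
      obtain gs vs where gv: "p = (gs, vs)" by (cases p)
      show "?s ((\<lambda>(gs, vs). (?c gs, ?c vs)) p) =
          (case p of (gs, vs) \<Rightarrow> Poly_Mapping.single (component gs, component vs) (weight gs vs))"
        using p mem[of gs vs] coeff[of gs vs] by (simp add: gv component_def)
    qed
    finally show ?thesis .
  qed
qed

theorem theorem5p6:
  shows "isomorphic_bialgebras plethystic_bialgebra (incidence_bialgebra (bar (T_M (T_S Sym))) (@))"
  using word_bialgebra_plethystic word_bialgebra_incidence by (rule isomorphic_bialgebras_word)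

end
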